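(* Suppose $\Lambda_0$ is the unique (up to rotation) critical covering lattice of the unit ball $B^n\subseteq\mathbb{R}^n$, and suppose $\Lambda_0$ is simple. Let $X(\Lambda_0)$ be the set of maximal primitive simplices of $\Lambda_0$. Then the following are equivalent: (1) $B^n$ is extensible; (2) $X(\Lambda_0)$ is redundantly semieutactic.
   Context: Bodies and coverings. $B^n$ is the closed Euclidean unit ball of $\mathbb{R}^n$ and $S^{n-1}$ its boundary. A "body" is a convex compact subset $K$ of $\mathbb{R}^n$ with nonempty interior which is symmetric about some point $\mathbf{x}$, i.e. $2\mathbf{x}-K=K$. An $n$-dimensional lattice is $\Lambda=T\mathbb{Z}^n$ with $T$ a nonsingular linear map; $d(\Lambda)=|\det T|$. The space of lattices carries the metric $\delta(\Lambda,\Lambda')=\min\{\|T-T'\|:\Lambda=T\mathbb{Z}^n,\Lambda'=T'\mathbb{Z}^n\}$ with $\|\cdot\|$ the Hilbert-Schmidt norm. $\Lambda$ is a covering lattice for $K$ if $\bigcup_{\mathbf{l}\in\Lambda}(K+\mathbf{l})=\mathbb{R}^n$. The critical (covering) determinant $d_K$ is the maximum of $d(\Lambda)$ over covering lattices $\Lambda$ for $K$ (it is attained); a covering lattice attaining it is a critical covering lattice of $K$. A body $K$ is inextensible if $d_{K'}>d_K$ for every body $K'$ that is a proper superset of $K$; otherwise it is extensible. Primitive simplices. The Voronoi polytope of $\Lambda$ is $P_0=\{\mathbf{x}\in\mathbb{R}^n:\|\mathbf{x}\|\le\|\mathbf{x}-\mathbf{l}\|\text{ for all }\mathbf{l}\in\Lambda\}$.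 $\Lambda$ is simple if the combinatorial type of $P_0$ is the same for all lattices in a neighborhood of $\Lambda$. If $\Lambda$ is simple, each vertex of $P_0$ is equivalent, modulo translations by vectors of $\Lambda$, to exactly $n$ other vertices of $P_0$, and equivalent vertices are equidistant from the origin; the convex hull of each equivalence class of $n+1$ vertices is a simplex with circumcenter at the origin, called a primitive simplex of $\Lambda$. The maximal primitive simplices are those with the largest circumradius among all primitive simplices; their set is $X(\Lambda)$. It is symmetric: $S\in X(\Lambda)$ iff $-S\in X(\Lambda)$. For a critical covering lattice of $B^n$ this largest circumradius is $1$. Semieutaxy. For a simplex $S$ with vertices $\mathbf{x}_1,\dots,\mathbf{x}_{n+1}\in S^{n-1}$, let $\alpha_j$ be the barycentric coordinates of its circumcenter (the origin): $\sum_j\alpha_j\mathbf{x}_j=0$, $\sum_j\alpha_j=1$; and let $Q_S(\cdot)=\sum_{j=1}^{n+1}\alpha_j\langle\mathbf{x}_j,\cdot\rangle\mathbf{x}_j$, a symmetric linear map of $\mathbb{R}^n$. A symmetric set $X$ (i.e. $S\in X$ iff $-S\in X$) of simplices inscribed in $S^{n-1}$ is semieutactic if there are non-negative numbers $\upsilon_S$, $S\in X$, with $\upsilon_S=\upsilon_{-S}$ and $\operatorname{Id}=\sum_{S\in X}\upsilon_S Q_S$. $X$ is redundantly semieutactic if $X\setminus\{S,-S\}$ is semieutactic for every $S\in X$. *)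

theory Defs
  imports "HOL-Analysis.Analysis"
begin

section \<open>Bodies and covering lattices\<close>

definition body :: "(real^'n) set \<Rightarrow> bool" where
  "body K \<longleftrightarrow> convex K \<and> compact K \<and> interior K \<noteq> {} \<and> (\<exists>x. (\<lambda>y. 2 *\<^sub>R x - y) ` K = K)"

definition lattice_of :: "real^'n^'n \<Rightarrow> (real^'n) set" where
  "lattice_of T = {T *v z | z. \<forall>i. z $ i \<in> \<int>}"

definition is_lattice :: "(real^'n) set \<Rightarrow> bool" where
  "is_lattice \<Lambda> \<longleftrightarrow> (\<exists>T. invertible T \<and> \<Lambda> = lattice_of T)"

text \<open>The value does not depend on the basis matrix: two bases of the same lattice differ by
  an integer matrix of determinant 1 or -1.\<close>

definition lattice_det :: "(real^'n) set \<Rightarrow> real" where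
  "lattice_det \<Lambda> = (THE d. \<exists>T. invertible T \<and> \<Lambda> = lattice_of T \<and> d = \<bar>det T\<bar>)"

definition covering_lattice :: "(real^'n) set \<Rightarrow> (real^'n) set \<Rightarrow> bool" where
  "covering_lattice K \<Lambda> \<longleftrightarrow> is_lattice \<Lambda> \<and> (\<Union>l\<in>\<Lambda>. (\<lambda>x. x + l) ` K) = UNIV"

text \<open>For a body the set below is nonempty, bounded above, and attains its supremum, which is
  therefore the maximum.\<close>

definition critical_det :: "(real^'n) set \<Rightarrow> real" where
  "critical_det K = Sup {lattice_det \<Lambda> | \<Lambda>. covering_lattice K \<Lambda>}"

definition critical_covering_lattice :: "(real^'n) set \<Rightarrow> (real^'n) set \<Rightarrow> bool" where
  "critical_covering_lattice K \<Lambda> \<longleftrightarrow> covering_lattice K \<Lambda> \<and> lattice_det \<Lambda> = critical_det K"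

definition inextensible :: "(real^'n) set \<Rightarrow> bool" where
  "inextensible K \<longleftrightarrow> body K \<and> (\<forall>K'. body K' \<and> K \<subset> K' \<longrightarrow> critical_det K' > critical_det K)"

definition extensible :: "(real^'n) set \<Rightarrow> bool" where
  "extensible K \<longleftrightarrow> body K \<and> \<not> inextensible K"


section \<open>Voronoi polytopes and primitive simplices\<close>

definition voronoi_polytope :: "(real^'n) set \<Rightarrow> (real^'n) set" where
  "voronoi_polytope \<Lambda> = {x. \<forall>l\<in>\<Lambda>. norm x \<le> norm (x - l)}"

text \<open>Equality of combinatorial types is isomorphism of face lattices.\<close>

definition same_combinatorial_type :: "(real^'n) set \<Rightarrow> (real^'n) set \<Rightarrow> bool" where
  "same_combinatorial_type P Q \<longleftrightarrow>
     (\<exists>\<phi>. bij_betw \<phi> {F. F face_of P} {G. G face_of Q} \<and>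
          (\<forall>F F'. F face_of P \<and> F' face_of P \<longrightarrow> (\<phi> F \<subseteq> \<phi> F' \<longleftrightarrow> F \<subseteq> F')))"

text \<open>The norm on matrices is the Hilbert-Schmidt norm. The topology on lattices is the usual
  one, i.e. the quotient topology of the invertible matrices: the neighborhoods of a lattice
  are obtained by perturbing one of its bases, and the choice of this basis is immaterial.
  One must not take instead the infimum of the distances between arbitrary bases of the two
  lattices as a metric: for \<open>n \<ge> 2\<close> this infimum need not be attained and vanishes for many
  pairs of distinct lattices.\<close>

definition simple_lattice :: "(real^'n) set \<Rightarrow> bool" where
  "simple_lattice \<Lambda> \<longleftrightarrow>
     (\<exists>T. invertible T \<and> \<Lambda> = lattice_of T \<and>
        (\<exists>\<epsilon>>0. \<forall>T'. invertible T' \<and> norm (T - T') < \<epsilon> \<longrightarrow>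
           same_combinatorial_type (voronoi_polytope \<Lambda>) (voronoi_polytope (lattice_of T'))))"

definition vertices :: "(real^'n) set \<Rightarrow> (real^'n) set" where
  "vertices P = {v. v extreme_point_of P}"

definition vertex_equiv :: "(real^'n) set \<Rightarrow> ((real^'n) \<times> (real^'n)) set" where
  "vertex_equiv \<Lambda> = {(v, w). v \<in> vertices (voronoi_polytope \<Lambda>) \<and>
                             w \<in> vertices (voronoi_polytope \<Lambda>) \<and> v - w \<in> \<Lambda>}"

definition primitive_simplices :: "(real^'n) set \<Rightarrow> (real^'n) set set" where
  "primitive_simplices \<Lambda> =
     {convex hull C | C. C \<in> vertices (voronoi_polytope \<Lambda>) // vertex_equiv \<Lambda>}"

definition circumradius :: "(real^'n) set \<Rightarrow> real" where
  "circumradius S = (THE r. \<exists>c \<in> affine hull S. \<forall>v \<in> vertices S. dist c v = r)"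

definition maximal_primitive_simplices :: "(real^'n) set \<Rightarrow> (real^'n) set set" where
  "maximal_primitive_simplices \<Lambda> =
     {S \<in> primitive_simplices \<Lambda>. \<forall>S' \<in> primitive_simplices \<Lambda>. circumradius S' \<le> circumradius S}"


section \<open>Semieutaxy\<close>

text \<open>Barycentric coordinates, indexed by the vertices and extended by zero.\<close>

definition barycentric :: "(real^'n) set \<Rightarrow> real^'n \<Rightarrow> real^'n \<Rightarrow> real" where
  "barycentric S p = (THE \<alpha>. (\<forall>v. v \<notin> vertices S \<longrightarrow> \<alpha> v = 0) \<and>
     (\<Sum>v\<in>vertices S. \<alpha> v) = 1 \<and> (\<Sum>v\<in>vertices S. \<alpha> v *\<^sub>R v) = p)"

text \<open>The circumcenter of a full-dimensional simplex inscribed in the unit sphere is the origin.\<close>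

definition Q_map :: "(real^'n) set \<Rightarrow> real^'n \<Rightarrow> real^'n" where
  "Q_map S y = (\<Sum>v\<in>vertices S. (barycentric S 0 v * (v \<bullet> y)) *\<^sub>R v)"

definition inscribed_simplex :: "(real^'n) set \<Rightarrow> bool" where
  "inscribed_simplex S \<longleftrightarrow> (int CARD('n)) simplex S \<and> vertices S \<subseteq> sphere 0 1"

definition symmetric_family :: "(real^'n) set set \<Rightarrow> bool" where
  "symmetric_family X \<longleftrightarrow> (\<forall>S. S \<in> X \<longleftrightarrow> uminus ` S \<in> X)"

text \<open>Only finite families occur: a lattice has finitely many primitive simplices.\<close>

definition semieutactic :: "(real^'n) set set \<Rightarrow> bool" where
  "semieutactic X \<longleftrightarrow>
     finite X \<and> (\<forall>S\<in>X. inscribed_simplex S) \<and> symmetric_family X \<and>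
     (\<exists>\<upsilon>. (\<forall>S\<in>X. \<upsilon> S \<ge> (0::real)) \<and> (\<forall>S\<in>X. \<upsilon> S = \<upsilon> (uminus ` S)) \<and>
          id = (\<lambda>y. \<Sum>S\<in>X. \<upsilon> S *\<^sub>R Q_map S y))"

definition redundantly_semieutactic :: "(real^'n) set set \<Rightarrow> bool" where
  "redundantly_semieutactic X \<longleftrightarrow> (\<forall>S\<in>X. semieutactic (X - {S, uminus ` S}))"

end

(*
Write C v for the class of a vertex v of the Voronoi polytope P, i.e. the points v - l for the lattice
points l nearest to v; these are the vertices of a primitive simplex S.  Its barycentric weights alpha
satisfy: the mean of norm (T w)^2 over w in C v is the trace of T^T T Q_S.  If the identity is a
non-negative combination of maps Q_S and all these means are at most 1, then the Hilbert-Schmidt norm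
of T is at most that of the identity, hence |det T| <= 1.  If it is not such a combination, a separating
hyperplane yields a volume increasing deformation that contracts all the simplices S to first order.

Redundant => extensible: attach to the ball a small pair of caps at u, -u.  By compactness of sets of
lattices and uniqueness, a better covering lattice is a small deformation T of the critical one.  The
caps can only help to cover near a single pair S, -S, so T satisfies the above means inequality for all
the other simplices and |det T| <= 1.

Extensible => redundant: if X without S, -S is not semieutactic, then any larger body contains, up to
translation and rotation, neighborhoods of a vertex of S and of its negative.  A deformation that contracts
all the other simplices yields a covering lattice of larger determinant.  Here positivity of the
barycentric coordinates is needed; it follows from the maximality of the distance of v to the lattice.

That all primitive simplices of a simple lattice are indeed simplices is shown by counting vertices of P:
every vertex of P survives a small perturbation, and if the contact vectors at v were linearly dependent,
a suitable perturbation would split v.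
*)
theory Submission
  imports Defs
begin

text \<open>The means over a class can be compared with circumradii because the weighted barycenter
  of a class is the origin, and a linear \<open>T\<close> keeps it there: the mean of
  \<open>norm (y + T w)^2\<close> is exactly \<open>norm y ^ 2\<close> plus the mean of
  \<open>norm (T w)^2\<close>. So a mean above 1 forces a point farther than 1 from the perturbed
  contacts, without error term. Conversely, a contraction of first order \<open>t\<close> can only
  be spoilt at a deviation \<open>y\<close> with \<open>norm y ^ 2\<close> of order at least
  \<open>t\<close>; at that scale the terms linear in \<open>y\<close> dominate, and positivity
  decides. The caps concern only one pair because the classes partition the vertices: the apex
  direction lies in at most one class. Simplicity speaks of the abstract face lattice and does not
  say which vertex moves where. Counting makes it local: near each old vertex there is exactly one
  new vertex, shared by all facets through the old one. An arbitrary matrix as direction of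
  perturbation then yields a first-order inequality between contact vectors, and two rank-one
  matrices refute linear dependence.\<close>

section \<open>Matrix products, inverses and limits\<close>

lemma matrix_vector_mult_le_norm:
  fixes A :: "real^'n^'m" and x :: "real^'n"
  shows "norm (A *v x) \<le> norm A * norm x"
proof -
  have "norm (A *v x) = L2_set (\<lambda>i. norm ((A *v x) $ i)) UNIV"
    by (simp add: norm_vec_def)
  also have "\<dots> \<le> L2_set (\<lambda>i. norm (A $ i) * norm x) UNIV"
    by (intro L2_set_mono) (auto simp: matrix_vector_mul_component Cauchy_Schwarz_ineq2)
  also have "\<dots> = norm A * norm x"
    by (simp add: norm_vec_def[of A] L2_set_left_distrib)
  finally show ?thesis .
qed

lemma bounded_bilinear_matrix_vector_mult:
  "bounded_bilinear (\<lambda>(A :: real^'n^'m) x. A *v x)"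
  by unfold_locales
    (auto simp: matrix_vector_mult_add_rdistrib matrix_vector_right_distrib scaleR_matrix_vector_assoc
      matrix_vector_mult_scaleR intro!: exI[of _ 1] matrix_vector_mult_le_norm)

lemma tendsto_matrix_vector_mult:
  fixes A :: "'a \<Rightarrow> real^'n^'m"
  assumes "(A \<longlongrightarrow> B) F" "(x \<longlongrightarrow> y) F"
  shows "((\<lambda>k. A k *v x k) \<longlongrightarrow> B *v y) F"
  using bounded_bilinear.tendsto[OF bounded_bilinear_matrix_vector_mult assms] .

lemma tendsto_matrix_matrix_mult_right:
  fixes A :: "'a \<Rightarrow> real^'n^'m" and C :: "real^'p^'n"
  assumes "(A \<longlongrightarrow> B) F"
  shows "((\<lambda>k. A k ** C) \<longlongrightarrow> B ** C) F"
  unfolding matrix_matrix_mult_def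
  by (intro tendsto_vec_lambda tendsto_sum tendsto_mult tendsto_const tendsto_vec_nth assms) 

lemma tendsto_matrix_matrix_mult_left:
  fixes A :: "'a \<Rightarrow> real^'n^'m" and C :: "real^'m^'p"
  assumes "(A \<longlongrightarrow> B) F"
  shows "((\<lambda>k. C ** A k) \<longlongrightarrow> C ** B) F"
  unfolding matrix_matrix_mult_def
  by (intro tendsto_vec_lambda tendsto_sum tendsto_mult tendsto_const tendsto_vec_nth assms) 

lemma continuous_on_det: "continuous_on S (det :: real^'n^'n \<Rightarrow> real)"
  unfolding det_def by (intro continuous_intros)

lemma tendsto_det:
  fixes A :: "'a \<Rightarrow> real^'n^'n"
  assumes "(A \<longlongrightarrow> B) F"
  shows "((\<lambda>k. det (A k)) \<longlongrightarrow> det B) F"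
  using continuous_on_tendsto_compose[OF continuous_on_det[of UNIV] assms] by simp

lemma matrix_inv_mult:
  fixes A :: "real^'n^'n"
  assumes "invertible A"
  shows "A ** matrix_inv A = mat 1" "matrix_inv A ** A = mat 1"
  using someI_ex[OF assms[unfolded invertible_def]] unfolding matrix_inv_def by auto

lemma matrix_inv_vector_mult:
  fixes A :: "real^'n^'n"
  assumes "invertible A"
  shows "matrix_inv A *v (A *v x) = x" "A *v (matrix_inv A *v x) = x"
  by (simp_all add: matrix_vector_mul_assoc matrix_inv_mult[OF assms])

lemma invertible_matrix_mult:
  fixes A B :: "real^'n^'n"
  shows "invertible (A ** B) \<longleftrightarrow> invertible A \<and> invertible B"
  by (auto simp: invertible_det_nz det_mul)

subsection \<open>Lattices\<close>

definition integer_vectors :: "(real^'n) set" where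
  "integer_vectors = {z. \<forall>i. z $ i \<in> \<int>}"

lemma lattice_of_eq_image: "lattice_of T = (*v) T ` integer_vectors"
  unfolding lattice_of_def integer_vectors_def by auto

lemma lattice_of_matrix_mult:
  fixes A T :: "real^'n^'n"
  shows "lattice_of (A ** T) = (*v) A ` lattice_of T"
  unfolding lattice_of_eq_image by (simp add: image_image matrix_vector_mul_assoc)

lemma lattice_ofI: "(\<And>i. z $ i \<in> \<int>) \<Longrightarrow> T *v z \<in> lattice_of T"
  unfolding lattice_of_def by auto

lemma is_lattice_matrix_image:
  fixes M :: "real^'n^'n"
  assumes "is_lattice \<Lambda>" "invertible M"
  shows "is_lattice ((*v) M ` \<Lambda>)"
proof -
  obtain T where "invertible T" "\<Lambda> = lattice_of T"
    using assms unfolding is_lattice_def by auto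
  then have "invertible (M ** T)" "(*v) M ` \<Lambda> = lattice_of (M ** T)"
    using assms by (simp_all add: lattice_of_matrix_mult invertible_matrix_mult)
  then show ?thesis
    unfolding is_lattice_def by blast
qed

lemma lattice_zero: assumes "is_lattice \<Lambda>" shows "0 \<in> \<Lambda>"
  using assms lattice_ofI[of 0] unfolding is_lattice_def by auto

lemma lattice_diff:
  assumes "is_lattice \<Lambda>" "a \<in> \<Lambda>" "b \<in> \<Lambda>"
  shows "a - b \<in> \<Lambda>"
proof -
  obtain T y z where "\<Lambda> = lattice_of T" "a = T *v y" "b = T *v z" "\<forall>i. y $ i \<in> \<int>" "\<forall>i. z $ i \<in> \<int>"
    using assms unfolding is_lattice_def lattice_of_def by blast
  then show ?thesis
    using lattice_ofI[of "y - z" T] by (simp add: matrix_vector_mult_diff_distrib)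
qed

lemma lattice_uminus:
  assumes "is_lattice \<Lambda>" "a \<in> \<Lambda>"
  shows "- a \<in> \<Lambda>"
  using lattice_diff[OF assms(1) lattice_zero[OF assms(1)] assms(2)] by simp

lemma lattice_add:
  assumes "is_lattice \<Lambda>" "a \<in> \<Lambda>" "b \<in> \<Lambda>"
  shows "a + b \<in> \<Lambda>"
  using lattice_diff[OF assms(1,2) lattice_uminus[OF assms(1,3)]] by simp

lemma finite_integer_vectors_bounded:
  "finite {z \<in> integer_vectors :: (real^'n) set. norm z \<le> r}"
proof (rule finite_subset)
  let ?I = "{k :: real. k \<in> \<int> \<and> \<bar>k\<bar> \<le> r}"
  have "finite ?I"
    by (rule finite_abs_int_segment)
  then have "finite (UNIV \<rightarrow>\<^sub>E ?I :: ('n \<Rightarrow> real) set)"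
    by (rule finite_PiE[OF finite_class.finite_UNIV])
  then have "finite (vec_lambda ` (UNIV \<rightarrow>\<^sub>E ?I) :: (real^'n) set)"
    by (rule finite_imageI)
  moreover have "{z :: real^'n. \<forall>i. z $ i \<in> ?I} \<subseteq> vec_lambda ` (UNIV \<rightarrow>\<^sub>E ?I)"
  proof
    fix z :: "real^'n" assume z: "z \<in> {z. \<forall>i. z $ i \<in> ?I}"
    have "vec_nth z \<in> UNIV \<rightarrow>\<^sub>E ?I"
      using z by (simp add: PiE_UNIV_domain)
    then show "z \<in> vec_lambda ` (UNIV \<rightarrow>\<^sub>E ?I)"
      by (rule image_eqI[rotated]) (simp only: vec_nth_inverse)
  qed
  ultimately show "finite {z :: real^'n. \<forall>i. z $ i \<in> ?I}"
    by (rule finite_subset[rotated])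
  show "{z \<in> integer_vectors :: (real^'n) set. norm z \<le> r} \<subseteq> {z. \<forall>i. z $ i \<in> ?I}"
  proof (intro subsetI CollectI allI conjI)
    fix z :: "real^'n" and i assume z: "z \<in> {z \<in> integer_vectors. norm z \<le> r}"
    show "z $ i \<in> \<int>"
      using z by (simp add: integer_vectors_def)
    show "\<bar>z $ i\<bar> \<le> r"
      using z component_le_norm_cart[of z i] by simp
  qed
qed

lemma lattice_finite_ball:
  assumes "is_lattice \<Lambda>"
  shows "finite {l \<in> \<Lambda>. norm l \<le> r}"
proof -
  obtain T where T: "invertible T" "\<Lambda> = lattice_of T"
    using assms unfolding is_lattice_def by auto
  let ?R = "norm (matrix_inv T) * r"
  have "{l \<in> \<Lambda>. norm l \<le> r} \<subseteq> (*v) T ` {z \<in> integer_vectors. norm z \<le> ?R}"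
  proof safe
    fix l assume l: "l \<in> \<Lambda>" "norm l \<le> r"
    then obtain z where z: "z \<in> integer_vectors" "l = T *v z"
      using T by (auto simp: lattice_of_eq_image)
    have "z = matrix_inv T *v l"
      using z T by (simp add: matrix_inv_vector_mult)
    then have "norm z \<le> norm (matrix_inv T) * norm l"
      using matrix_vector_mult_le_norm by auto
    also have "\<dots> \<le> ?R"
      by (intro mult_left_mono l) auto
    finally show "l \<in> (*v) T ` {z \<in> integer_vectors. norm z \<le> ?R}"
      using z by (intro image_eqI[of _ _ z]) simp_all
  qed
  then show ?thesis
    by (rule finite_subset) (intro finite_imageI finite_integer_vectors_bounded)
qed

text \<open>The columns of \<open>T\<close> are points of the larger lattice; their integer
  coordinates there form the columns of \<open>U\<close>.\<close>

lemma matrix_eq_mult_integer: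
  fixes T T' :: "real^'n^'n"
  assumes "lattice_of T \<subseteq> lattice_of T'"
  obtains U where "\<And>i j. U $ i $ j \<in> \<int>" "T = T' ** U"
proof -
  have "\<exists>z. z \<in> integer_vectors \<and> column j T = T' *v z" for j
  proof -
    have "T *v axis j 1 \<in> lattice_of T"
      by (intro lattice_ofI) (auto simp: axis_def)
    then show ?thesis
      using assms by (auto simp: lattice_of_eq_image matrix_vector_mult_basis)
  qed
  then obtain u where u: "\<And>j. u j \<in> integer_vectors" "\<And>j. column j T = T' *v u j"
    by metis
  define U where "U = (\<chi> i j. u j $ i)"
  have "T = T' ** U"
    unfolding vec_eq_iff
    using u(2) by (auto simp: U_def matrix_matrix_mult_def matrix_vector_mult_def column_def vec_eq_iff)
  moreover have "U $ i $ j \<in> \<int>" for i j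
    using u(1) by (auto simp: U_def integer_vectors_def)
  ultimately show thesis
    by (rule that[rotated])
qed

lemma det_integer:
  fixes U :: "real^'n^'n"
  assumes "\<And>i j. U $ i $ j \<in> \<int>"
  shows "det U \<in> \<int>"
  unfolding det_def by (intro Ints_sum Ints_mult Ints_prod assms) auto

text \<open>The transition matrix has a nonzero integer determinant, up to sign the index. Applied
  in both directions, this shows that the absolute determinant does not depend on the basis.\<close>

lemma abs_det_sublattice_ge:
  fixes T T' :: "real^'n^'n"
  assumes "invertible T" "lattice_of T \<subseteq> lattice_of T'"
  shows "\<bar>det T'\<bar> \<le> \<bar>det T\<bar>"
proof -
  obtain U where U: "\<And>i j. U $ i $ j \<in> \<int>" "T = T' ** U"
    using matrix_eq_mult_integer[OF assms(2)] by metis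
  have "det U \<noteq> 0"
    using assms(1) U by (auto simp: invertible_det_nz det_mul)
  then have "1 \<le> \<bar>det U\<bar>"
    using det_integer[OF U(1)] by (auto elim!: Ints_cases)
  then show ?thesis
    using U(2) by (auto simp: det_mul abs_mult mult_le_cancel_left1)
qed

lemma lattice_det_lattice_of:
  assumes "invertible T"
  shows "lattice_det (lattice_of T) = \<bar>det T\<bar>"
  unfolding lattice_det_def
proof (rule the_equality)
  show "\<exists>T'. invertible T' \<and> lattice_of T = lattice_of T' \<and> \<bar>det T\<bar> = \<bar>det T'\<bar>"
    using assms by blast
next
  fix d assume "\<exists>T'. invertible T' \<and> lattice_of T = lattice_of T' \<and> d = \<bar>det T'\<bar>"
  then show "d = \<bar>det T\<bar>"
    using abs_det_sublattice_ge assms by (metis order.antisym order.refl)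
qed

lemma lattice_det_matrix_image:
  assumes "is_lattice \<Lambda>" "invertible M"
  shows "lattice_det ((*v) M ` \<Lambda>) = \<bar>det M\<bar> * lattice_det \<Lambda>"
proof -
  obtain T where "invertible T" "\<Lambda> = lattice_of T"
    using assms unfolding is_lattice_def by auto
  then show ?thesis
    using lattice_det_lattice_of[of "M ** T"] assms
    by (simp add: lattice_of_matrix_mult lattice_det_lattice_of invertible_matrix_mult det_mul abs_mult)
qed

lemma lattice_det_pos: "is_lattice \<Lambda> \<Longrightarrow> lattice_det \<Lambda> > 0"
  unfolding is_lattice_def by (metis lattice_det_lattice_of invertible_det_nz zero_less_abs_iff)

lemma covering_lattice_iff:
  "covering_lattice K \<Lambda> \<longleftrightarrow> is_lattice \<Lambda> \<and> (\<forall>x. \<exists>l\<in>\<Lambda>. x - l \<in> K)"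
proof -
  have *: "x \<in> (\<lambda>x. x + l) ` K \<longleftrightarrow> x - l \<in> K" for x l
  proof
    show "x - l \<in> K" if "x \<in> (\<lambda>x. x + l) ` K"
      using that by auto
    show "x \<in> (\<lambda>x. x + l) ` K" if "x - l \<in> K"
      using that by (intro image_eqI[of _ _ "x - l"]) simp_all
  qed
  have "(\<Union>l\<in>\<Lambda>. (\<lambda>x. x + l) ` K) = UNIV \<longleftrightarrow> (\<forall>x. \<exists>l\<in>\<Lambda>. x - l \<in> K)"
    unfolding set_eq_iff UN_iff * by blast
  then show ?thesis
    unfolding covering_lattice_def by (rule conj_cong[OF refl])
qed

subsection \<open>Determinants and the Hilbert-Schmidt norm\<close>

lemma invertible_matrix_inv:
  fixes A :: "real^'n^'n"
  shows "invertible A \<Longrightarrow> invertible (matrix_inv A)"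
  unfolding invertible_def using matrix_inv_mult[unfolded invertible_def] by blast

lemma invertible_scaleR:
  fixes A :: "real^'n^'n"
  shows "c \<noteq> 0 \<Longrightarrow> invertible A \<Longrightarrow> invertible (c *\<^sub>R A)"
  using scalar_invertible by blast

lemma norm_matrix_sq: "(norm (A :: real^'n^'m))\<^sup>2 = (\<Sum>i\<in>UNIV. (norm (A $ i))\<^sup>2)"
  by (simp add: norm_vec_def[of A] L2_set_def sum_nonneg)

lemma norm_mat_1_sq: "(norm (mat 1 :: real^'n^'n))\<^sup>2 = CARD('n)"
proof -
  have "mat 1 $ i = (axis i 1 :: real^'n)" for i :: 'n
    by (simp add: mat_def axis_def vec_eq_iff)
  then show ?thesis
    by (simp add: norm_matrix_sq)
qed

lemma det_scaleR:
  fixes A :: "real^'n^'n"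
  shows "det (c *\<^sub>R A) = c ^ CARD('n) * det A"
proof -
  have "det (c *\<^sub>R A) = det ((\<chi> i. c *s A $ i) :: real^'n^'n)"
    by (rule arg_cong[where f = det]) (simp add: vec_eq_iff)
  then show ?thesis
    by (simp add: det_rows_mul)
qed

text \<open>A maximiser of the determinant has orthogonal rows: otherwise a row operation shortens a row
  and leaves room for scaling up.\<close>

proposition abs_det_le_1:
  fixes T :: "real^'n^'n"
  assumes "(norm T)\<^sup>2 \<le> CARD('n)"
  shows "\<bar>det T\<bar> \<le> 1"
proof -
  let ?N = "real CARD('n)"
  let ?S = "cball 0 (sqrt ?N) :: (real^'n^'n) set"
  have S: "A \<in> ?S \<longleftrightarrow> (norm A)\<^sup>2 \<le> ?N" for A
    by (simp add: real_le_rsqrt real_sqrt_le_iff abs_le_square_iff sqrt_le_D)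
      (metis norm_ge_zero of_nat_0_le_iff real_sqrt_le_iff real_sqrt_unique real_sqrt_pow2)
  have "continuous_on ?S (\<lambda>A. \<bar>det A\<bar>)"
    by (intro continuous_intros continuous_on_det)
  then obtain A where A: "A \<in> ?S" and max: "\<And>B. B \<in> ?S \<Longrightarrow> \<bar>det B\<bar> \<le> \<bar>det A\<bar>"
    using continuous_attains_sup[of ?S "\<lambda>A. \<bar>det A\<bar>"] by auto
  have "\<bar>det A\<bar> \<ge> 1"
    using max[of "mat 1"] S[of "mat 1"] by (simp add: norm_mat_1_sq)
  \<comment> \<open>Scaling \<open>B\<close> back up to the norm of \<open>A\<close> would beat the
    maximum, so no matrix of the same determinant is shorter than \<open>A\<close>.\<close>
  have short: False if B: "norm B < norm A" "det B = det A" for B :: "real^'n^'n"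
  proof -
    define s where "s = norm A / norm B"
    have "B \<noteq> 0"
      using B \<open>\<bar>det A\<bar> \<ge> 1\<close> det_0 by (metis abs_zero mat_0 not_one_le_zero)
    then have "s > 1"
      using B by (simp add: s_def)
    have "norm (s *\<^sub>R B) = norm A"
      using \<open>B \<noteq> 0\<close> by (simp add: s_def)
    then have "\<bar>det (s *\<^sub>R B)\<bar> \<le> \<bar>det A\<bar>"
      using A by (intro max) auto
    moreover have "s ^ CARD('n) > 1"
      using \<open>s > 1\<close> by (intro one_less_power) auto
    ultimately show False
      using \<open>\<bar>det A\<bar> \<ge> 1\<close> \<open>s > 1\<close> B(2) by (auto simp: det_scaleR abs_mult mult_le_cancel_right2)
  qed
  have orth: "A $ i \<bullet> A $ j = 0" if "i \<noteq> j" for i j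
  proof (rule ccontr)
    assume ne: "A $ i \<bullet> A $ j \<noteq> 0"
    \<comment> \<open>The Gram-Schmidt coefficient: adding \<open>c\<close> times row
      \<open>j\<close> projects row \<open>i\<close> onto the complement of row \<open>j\<close> and
      keeps the determinant.\<close>
    define c where "c = - (A $ i \<bullet> A $ j) / (A $ j \<bullet> A $ j)"
    define B where "B = (\<chi> k. if k = i then row i A + c *s row j A else row k A)"
    have "A $ j \<bullet> A $ j > 0"
      using ne by auto
    have "(norm (B $ i))\<^sup>2 = (norm (A $ i))\<^sup>2 - (A $ i \<bullet> A $ j)\<^sup>2 / (A $ j \<bullet> A $ j)"
      using \<open>A $ j \<bullet> A $ j > 0\<close>
      unfolding power2_norm_eq_inner
      by (simp add: B_def row_def c_def scalar_mult_eq_scaleR inner_simps inner_commute[of "A $ j" "A $ i"]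
          field_simps power2_eq_square)
    also have "\<dots> < (norm (A $ i))\<^sup>2"
      using ne \<open>A $ j \<bullet> A $ j > 0\<close> by simp
    finally have lt: "(norm (B $ i))\<^sup>2 < (norm (A $ i))\<^sup>2" .
    have "(norm B)\<^sup>2 < (norm A)\<^sup>2"
      unfolding norm_matrix_sq
    proof (rule sum_strict_mono_ex1)
      show "\<forall>k\<in>UNIV. (norm (B $ k))\<^sup>2 \<le> (norm (A $ k))\<^sup>2"
      proof
        fix k show "(norm (B $ k))\<^sup>2 \<le> (norm (A $ k))\<^sup>2"
        proof (cases "k = i")
          case True
          then show ?thesis
            using less_imp_le[OF lt] by (simp only:)
        qed (simp add: B_def row_def)
      qed
    qed (use lt in auto)
    moreover have "det B = det A"
      unfolding B_def using that by (rule det_row_operation)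
    ultimately show False
      using short[of B] power2_less_imp_less[OF _ norm_ge_zero] by blast
  qed
  \<comment> \<open>With orthogonal rows the Gram matrix is diagonal, so the squared determinant is
    the product of the squared row lengths. Their arithmetic mean is at most 1, hence so is their
    geometric mean.\<close>
  have "(det A)\<^sup>2 = det (A ** transpose A)"
    by (simp add: det_mul power2_eq_square)
  also have "\<dots> = (\<Prod>i\<in>UNIV. (norm (A $ i))\<^sup>2)"
  proof -
    have "(A ** transpose A) $ i $ j = A $ i \<bullet> A $ j" for i j
      by (simp add: matrix_matrix_mult_def transpose_def inner_vec_def)
    then show ?thesis
      by (subst det_diagonal) (auto simp: orth power2_norm_eq_inner)
  qed
  also have "\<dots> \<le> 1"
  proof -
    have "(\<Prod>i\<in>UNIV. (norm (A $ i))\<^sup>2) powr (1 / ?N) \<le> (\<Sum>i\<in>UNIV. (norm (A $ i))\<^sup>2 / ?N)"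
      by (intro arith_geom_mean) auto
    also have "\<dots> = (norm A)\<^sup>2 / ?N"
      by (simp add: norm_matrix_sq sum_divide_distrib)
    also have "\<dots> \<le> 1"
      using A S by simp
    finally have "((\<Prod>i\<in>UNIV. (norm (A $ i))\<^sup>2) powr (1 / ?N)) powr ?N \<le> 1 powr ?N"
      by (intro powr_mono2) auto
    then show ?thesis
      by (simp add: powr_powr prod_nonneg)
  qed
  finally have "\<bar>det A\<bar> \<le> 1"
    by (simp add: abs_square_le_1)
  then show ?thesis
    using max[of T] assms S by fastforce
qed


subsection \<open>Compactness of sets of lattices\<close>

lemma norm_matrix_le_entries:
  fixes A :: "real^'n^'m"
  assumes "\<And>i j. \<bar>A $ i $ j\<bar> \<le> (c :: real)"
  shows "norm A \<le> real CARD('m) * real CARD('n) * c"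
proof -
  have "norm A \<le> (\<Sum>i\<in>UNIV. norm (A $ i))"
    unfolding norm_vec_def[of A] by (intro L2_set_le_sum) auto
  also have "\<dots> \<le> (\<Sum>i\<in>UNIV. \<Sum>j\<in>UNIV. \<bar>A $ i $ j\<bar>)"
    by (intro sum_mono norm_le_l1_cart)
  also have "\<dots> \<le> (\<Sum>i\<in>(UNIV :: 'm set). \<Sum>j\<in>(UNIV :: 'n set). (c :: real))"
    by (intro sum_mono assms)
  finally show ?thesis
    by (simp add: mult.assoc)
qed

lemma lattice_of_mult_integer_subset:
  fixes T U :: "real^'n^'n"
  assumes "\<And>i j. U $ i $ j \<in> \<int>"
  shows "lattice_of (T ** U) \<subseteq> lattice_of T"
proof
  fix x assume "x \<in> lattice_of (T ** U)"
  then obtain z where z: "\<forall>i. z $ i \<in> \<int>" "x = T *v (U *v z)"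
    unfolding lattice_of_def by (auto simp: matrix_vector_mul_assoc)
  have "(U *v z) $ i \<in> \<int>" for i
    unfolding matrix_vector_mult_def using z assms by (auto intro!: Ints_sum Ints_mult)
  then show "x \<in> lattice_of T"
    using z lattice_ofI by metis
qed

text \<open>Lattice points near large multiples of the unit vectors span a sublattice.\<close>

lemma bounded_sublattice:
  fixes \<rho> :: real
  assumes "\<rho> \<ge> 0"
  obtains C where "\<And>\<Lambda> :: (real^'n) set. is_lattice \<Lambda> \<Longrightarrow> (\<And>x. \<exists>l\<in>\<Lambda>. norm (x - l) \<le> \<rho>) \<Longrightarrow>
    \<exists>V. invertible V \<and> lattice_of V \<subseteq> \<Lambda> \<and> norm V \<le> C"
proof -
  let ?N = "real CARD('n)"
  \<comment> \<open>If column \<open>j\<close> is within \<open>\<rho>\<close> of \<open>r\<close>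
    times the unit vector \<open>j\<close>, then \<open>V *v x\<close> differs from
    \<open>r *\<^sub>R x\<close> by at most \<open>CARD('n) * \<rho> * norm x\<close>; the extra 1
    makes \<open>V\<close> injective.\<close>
  define r where "r = ?N * \<rho> + 1"
  have "\<exists>V. invertible V \<and> lattice_of V \<subseteq> \<Lambda> \<and> norm V \<le> ?N * ?N * (r + \<rho>)"
    if \<Lambda>: "is_lattice \<Lambda>" "\<And>x. \<exists>l\<in>\<Lambda>. norm (x - l) \<le> \<rho>" for \<Lambda> :: "(real^'n) set"
  proof -
    obtain T where T: "invertible T" "\<Lambda> = lattice_of T"
      using \<Lambda> unfolding is_lattice_def by auto
    have "\<exists>u. (\<forall>i. u $ i \<in> \<int>) \<and> norm (r *\<^sub>R axis j 1 - T *v u) \<le> \<rho>" for j :: 'n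
      using \<Lambda>(2)[of "r *\<^sub>R axis j 1"] T unfolding lattice_of_def by blast
    then obtain u where u: "\<And>i j. u j $ i \<in> \<int>" "\<And>j. norm (r *\<^sub>R axis j 1 - T *v u j) \<le> \<rho>"
      by metis
    define U where "U = (\<chi> i j. u j $ i)"
    define V where "V = T ** U"
    have col: "V *v axis j 1 = T *v u j" for j
    proof -
      have "U *v axis j 1 = u j"
        unfolding matrix_vector_mult_basis by (simp add: column_def U_def vec_eq_iff)
      then show ?thesis
        by (simp add: V_def flip: matrix_vector_mul_assoc)
    qed
    have ker: "x = 0" if "V *v x = 0" for x
    proof -
      have x: "x = (\<Sum>j\<in>UNIV. x $ j *\<^sub>R axis j 1)"
        by (simp add: basis_expansion flip: scalar_mult_eq_scaleR)
      have "r * norm x = norm (r *\<^sub>R x - V *v x)"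
        using that by (simp add: r_def assms)
      also have "r *\<^sub>R x - V *v x = (\<Sum>j\<in>UNIV. x $ j *\<^sub>R (r *\<^sub>R axis j 1 - V *v axis j 1))"
        by (subst (1 2) x)
          (simp add: scaleR_sum_right linear_sum[OF matrix_vector_mul_linear] matrix_vector_mult_scaleR
            scaleR_diff_right sum_subtractf mult.commute)
      also have "norm \<dots> \<le> (\<Sum>j\<in>(UNIV :: 'n set). norm x * \<rho>)"
        using u(2) unfolding col
        by (intro order_trans[OF norm_sum] sum_mono) (auto intro!: mult_mono component_le_norm_cart)
      finally have "norm x \<le> 0"
        by (simp add: r_def algebra_simps)
      then show "x = 0"
        by simp
    qed
    then have "invertible V"
      using invertible_left_inverse matrix_left_invertible_ker by blast
    moreover have "lattice_of V \<subseteq> \<Lambda>"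
      unfolding V_def T by (intro lattice_of_mult_integer_subset) (simp add: U_def u)
    moreover have "norm V \<le> ?N * ?N * (r + \<rho>)"
    proof (rule norm_matrix_le_entries)
      fix i j
      have "\<bar>V $ i $ j\<bar> = \<bar>(V *v axis j 1) $ i\<bar>"
        unfolding matrix_vector_mult_basis by (simp add: column_def)
      also have "\<dots> \<le> norm (T *v u j)"
        unfolding col by (rule component_le_norm_cart)
      also have "\<dots> \<le> norm (r *\<^sub>R axis j (1::real) :: real^'n) + \<rho>"
        using u(2)[of j] norm_triangle_ineq4[of "r *\<^sub>R axis j 1" "r *\<^sub>R axis j 1 - T *v u j"] by simp
      finally show "\<bar>V $ i $ j\<bar> \<le> r + \<rho>"
        using assms by (simp add: r_def)
    qed
    ultimately show ?thesis
      by blast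
  qed
  then show thesis
    by (rule that)
qed

lemma det_bounded_cball:
  obtains D where "\<And>V :: real^'n^'n. norm V \<le> C \<Longrightarrow> \<bar>det V\<bar> \<le> D"
proof -
  have "bounded (det ` (cball 0 C :: (real^'n^'n) set))"
    by (intro compact_imp_bounded compact_continuous_image continuous_on_det) auto
  then obtain D where "\<And>V. V \<in> (cball 0 C :: (real^'n^'n) set) \<Longrightarrow> norm (det V) \<le> D"
    unfolding bounded_iff by blast
  then show thesis
    by (intro that[of D]) simp
qed

text \<open>A sublattice with a bounded basis has bounded determinant, and the determinant of the
  full lattice is no larger.\<close>

lemma lattice_det_bounded:
  fixes \<rho> :: real
  assumes "\<rho> \<ge> 0"
  obtains D where "\<And>\<Lambda> :: (real^'n) set. is_lattice \<Lambda> \<Longrightarrow> (\<And>x. \<exists>l\<in>\<Lambda>. norm (x - l) \<le> \<rho>) \<Longrightarrow> lattice_det \<Lambda> \<le> D"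
proof -
  obtain C where C: "\<And>\<Lambda> :: (real^'n) set. is_lattice \<Lambda> \<Longrightarrow> (\<And>x. \<exists>l\<in>\<Lambda>. norm (x - l) \<le> \<rho>) \<Longrightarrow>
    \<exists>V. invertible V \<and> lattice_of V \<subseteq> \<Lambda> \<and> norm V \<le> C"
    using bounded_sublattice[OF assms, where 'n = 'n] by metis
  obtain D where D: "\<And>V :: real^'n^'n. norm V \<le> C \<Longrightarrow> \<bar>det V\<bar> \<le> D"
    using det_bounded_cball by metis
  have "lattice_det \<Lambda> \<le> D" if \<Lambda>: "is_lattice \<Lambda>" "\<And>x. \<exists>l\<in>\<Lambda>. norm (x - l) \<le> \<rho>" for \<Lambda> :: "(real^'n) set"
  proof -
    obtain T where T: "invertible T" "\<Lambda> = lattice_of T"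
      using \<Lambda> unfolding is_lattice_def by auto
    obtain V where V: "invertible V" "lattice_of V \<subseteq> \<Lambda>" "norm V \<le> C"
      using C[OF \<Lambda>] by auto
    show ?thesis
      using abs_det_sublattice_ge[of V T] V T D[OF V(3)] by (simp add: lattice_det_lattice_of)
  qed
  then show thesis
    by (rule that)
qed

text \<open>Inside such a lattice coordinates can be reduced modulo \<open>q\<close>, so it is
  determined by its points in one bounded, hence finite, set of integer vectors.\<close>

lemma finite_superlattices:
  fixes q :: real
  assumes "q > 0" "q \<in> \<int>"
  shows "finite {L :: (real^'n) set. is_lattice L \<and> L \<subseteq> integer_vectors \<and> (\<forall>z\<in>integer_vectors. q *\<^sub>R z \<in> L)}"
    (is "finite ?F")
proof (rule finite_imageD)
  let ?B = "{z \<in> integer_vectors :: (real^'n) set. norm z \<le> CARD('n) * q}"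
  show "finite ((\<lambda>L. L \<inter> ?B) ` ?F)"
    by (rule finite_subset[of _ "Pow ?B"]) (auto simp: finite_integer_vectors_bounded)
  have sub: "L \<subseteq> L'" if L: "L \<in> ?F" "L' \<in> ?F" "L \<inter> ?B = L' \<inter> ?B" for L L'
  proof
    fix x assume x: "x \<in> L"
    define w where "w = (\<chi> i. real_of_int \<lfloor>x $ i / q\<rfloor>)"
    have w: "w \<in> integer_vectors"
      by (simp add: w_def integer_vectors_def)
    then have "q *\<^sub>R w \<in> L" "q *\<^sub>R w \<in> L'"
      using L by auto
    then have "x - q *\<^sub>R w \<in> L"
      using x L lattice_diff by blast
    moreover have "norm (x - q *\<^sub>R w) \<le> CARD('n) * q"
    proof -
      have "\<bar>(x - q *\<^sub>R w) $ i\<bar> \<le> q" for i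
      proof -
        have "q * real_of_int \<lfloor>x $ i / q\<rfloor> \<le> q * (x $ i / q)"
          using assms by (intro mult_left_mono) linarith+
        moreover have "q * (x $ i / q) \<le> q * (real_of_int \<lfloor>x $ i / q\<rfloor> + 1)"
          using assms by (intro mult_left_mono) linarith+
        ultimately show ?thesis
          using assms by (simp add: w_def algebra_simps abs_le_iff)
      qed
      then have "(\<Sum>i\<in>UNIV. \<bar>(x - q *\<^sub>R w) $ i\<bar>) \<le> (\<Sum>i\<in>(UNIV::'n set). q)"
        by (intro sum_mono)
      then show ?thesis
        using norm_le_l1_cart[of "x - q *\<^sub>R w"] by simp
    qed
    ultimately have "x - q *\<^sub>R w \<in> L'"
      using L by blast
    then have "(x - q *\<^sub>R w) + q *\<^sub>R w \<in> L'"
      using \<open>q *\<^sub>R w \<in> L'\<close> L lattice_add by blast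
    then show "x \<in> L'"
      by simp
  qed
  show "inj_on (\<lambda>L. L \<inter> ?B) ?F"
  proof (rule inj_onI)
    fix L L' assume "L \<in> ?F" "L' \<in> ?F" "L \<inter> ?B = L' \<inter> ?B"
    then show "L = L'"
      using sub[of L L'] sub[of L' L] by (metis subset_antisym)
  qed
qed

text \<open>Cramer's rule: up to the factor \<open>det U\<close>, each coordinate of the solution is
  the determinant of an integer matrix.\<close>

lemma det_mult_inverse_integer:
  fixes U :: "real^'n^'n"
  assumes U: "\<And>i j. U $ i $ j \<in> \<int>" and "invertible U" and z: "z \<in> integer_vectors"
  shows "det U *\<^sub>R (matrix_inv U *v z) \<in> integer_vectors"
proof -
  define x where "x = matrix_inv U *v z"
  have "U *v x = z"
    using assms by (simp add: x_def matrix_inv_vector_mult)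
  have "x $ k * det U \<in> \<int>" for k
  proof -
    have "x $ k * det U = det (\<chi> i j. if j = k then z $ i else U $ i $ j)"
      using cramer_lemma[of k U x] unfolding \<open>U *v x = z\<close> by (rule sym)
    also have "\<dots> \<in> \<int>"
      by (rule det_integer) (use U z in \<open>auto simp: integer_vectors_def\<close>)
    finally show ?thesis .
  qed
  then show ?thesis
    unfolding x_def[symmetric] by (simp add: integer_vectors_def mult.commute)
qed

text \<open>All lattices in question lie between \<open>lattice_of V\<close> and \<open>lattice_of V\<close> scaled by \<open>1/q\<close>, with
  bounded \<open>V\<close> and a common \<open>q\<close>; hence up to \<open>V\<close> there are only finitely many of them.\<close>

lemma bounded_basis:
  fixes \<rho> d :: real
  assumes "\<rho> \<ge> 0" "d > 0"
  obtains C where "\<And>\<Lambda> :: (real^'n) set. is_lattice \<Lambda> \<Longrightarrow> (\<And>x. \<exists>l\<in>\<Lambda>. norm (x - l) \<le> \<rho>) \<Longrightarrow>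
    lattice_det \<Lambda> \<ge> d \<Longrightarrow> \<exists>T. invertible T \<and> \<Lambda> = lattice_of T \<and> norm T \<le> C"
proof -
  obtain C where C: "\<And>\<Lambda> :: (real^'n) set. is_lattice \<Lambda> \<Longrightarrow> (\<And>x. \<exists>l\<in>\<Lambda>. norm (x - l) \<le> \<rho>) \<Longrightarrow>
    \<exists>V. invertible V \<and> lattice_of V \<subseteq> \<Lambda> \<and> norm V \<le> C"
    using bounded_sublattice[OF assms(1), where 'n = 'n] by metis
  obtain D where D: "\<And>V :: real^'n^'n. norm V \<le> C \<Longrightarrow> \<bar>det V\<bar> \<le> D"
    using det_bounded_cball by metis
  \<comment> \<open>The index of \<open>lattice_of V\<close> in the given lattice is an integer of
    size at most \<open>D / d\<close>. The factorial is a multiple of all candidates, so one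
    \<open>q\<close> serves every lattice.\<close>
  define q where "q = (fact (nat \<lceil>D / d\<rceil>) :: real)"
  have q: "q > 0" "q \<in> \<int>"
    unfolding q_def by (simp, metis Ints_of_nat of_nat_fact)
  define F where "F = {L :: (real^'n) set. is_lattice L \<and> L \<subseteq> integer_vectors \<and> (\<forall>z\<in>integer_vectors. q *\<^sub>R z \<in> L)}"
  have "finite F"
    unfolding F_def using finite_superlattices[OF q] .
  \<comment> \<open>One basis is fixed for each of the finitely many \<open>L\<close>. The bases
    sought are the products of \<open>(1/q) *\<^sub>R V\<close> with these, so a single constant
    bounds them.\<close>
  have "\<forall>L\<in>F. \<exists>B. invertible B \<and> L = lattice_of B"
    by (auto simp: F_def is_lattice_def)
  then obtain B where B: "\<And>L. L \<in> F \<Longrightarrow> invertible (B L)" "\<And>L. L \<in> F \<Longrightarrow> L = lattice_of (B L)"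
    by metis
  have "\<exists>K. \<forall>V :: real^'n^'n. norm (((1/q) *\<^sub>R V) ** B L) \<le> K * norm V" for L
    by (rule linear_bounded, rule linearI)
      (simp_all add: vec_eq_iff matrix_matrix_mult_def algebra_simps sum.distrib sum_distrib_left sum_divide_distrib)
  then obtain K where K: "\<And>L (V :: real^'n^'n). norm (((1/q) *\<^sub>R V) ** B L) \<le> K L * norm V"
    by metis
  define K' where "K' = (\<Sum>L\<in>F. \<bar>K L\<bar>)"
  have "\<exists>T. invertible T \<and> \<Lambda> = lattice_of T \<and> norm T \<le> K' * C"
    if \<Lambda>: "is_lattice \<Lambda>" "\<And>x. \<exists>l\<in>\<Lambda>. norm (x - l) \<le> \<rho>" "lattice_det \<Lambda> \<ge> d" for \<Lambda> :: "(real^'n) set"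
  proof -
    obtain T where T: "invertible T" "\<Lambda> = lattice_of T"
      using \<Lambda> unfolding is_lattice_def by auto
    obtain V where V: "invertible V" "lattice_of V \<subseteq> \<Lambda>" "norm V \<le> C"
      using C[OF \<Lambda>(1,2)] by auto
    obtain U where U: "\<And>i j. U $ i $ j \<in> \<int>" "V = T ** U"
      using matrix_eq_mult_integer V(2) T(2) by metis
    have "invertible U"
      using V U by (simp add: invertible_matrix_mult)
    have "det U \<in> \<int>"
      using det_integer U(1) by blast
    then obtain m where m: "det U = of_int m"
      by (auto elim: Ints_cases)
    have "m \<noteq> 0"
      using \<open>invertible U\<close> m by (auto simp: invertible_det_nz)
    have "\<bar>det T\<bar> \<ge> d"
      using \<Lambda>(3) T by (simp add: lattice_det_lattice_of)
    have "d * \<bar>det U\<bar> \<le> \<bar>det T\<bar> * \<bar>det U\<bar>"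
      using \<open>\<bar>det T\<bar> \<ge> d\<close> by (intro mult_right_mono) auto
    also have "\<dots> \<le> D"
      using D[OF V(3)] U(2) by (simp add: det_mul abs_mult)
    finally have "\<bar>det U\<bar> \<le> D / d"
      using assms(2) by (simp add: field_simps)
    then have "nat \<bar>m\<bar> \<le> nat \<lceil>D / d\<rceil>"
      unfolding m by (intro nat_mono) linarith
    then have "nat \<bar>m\<bar> dvd fact (nat \<lceil>D / d\<rceil>)"
      using \<open>m \<noteq> 0\<close> by (intro dvd_fact) auto
    then obtain p where p: "fact (nat \<lceil>D / d\<rceil>) = nat \<bar>m\<bar> * p"
      by blast
    have "q = real (fact (nat \<lceil>D / d\<rceil>))"
      by (simp add: q_def)
    then have "q = real (nat \<bar>m\<bar>) * real p"
      unfolding p by simp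
    then have "q = \<bar>det U\<bar> * real p"
      by (simp add: m)
    then have s: "q = (sgn (det U) * real p) * det U"
      by (simp add: abs_sgn ac_simps)
    \<comment> \<open>This is \<open>\<Lambda>\<close> in the coordinates of \<open>V\<close>,
      scaled by \<open>q\<close>: since \<open>V = T ** U\<close>, the preimage of
      \<open>\<Lambda>\<close> under \<open>V\<close> is
      \<open>lattice_of (matrix_inv U)\<close>.\<close>
    define L where "L = lattice_of (q *\<^sub>R matrix_inv U)"
    have inv: "invertible (q *\<^sub>R matrix_inv U)"
      using \<open>invertible U\<close> q by (intro invertible_scaleR invertible_matrix_inv) auto
    have Lmem: "q *\<^sub>R (matrix_inv U *v z) \<in> integer_vectors" if "z \<in> integer_vectors" for z
    proof -
      have "q * x = (sgn (det U) * real p) * (det U * x)" for x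
        by (subst s) simp
      moreover have "sgn (det U) * real p \<in> \<int>"
        by (intro Ints_mult) (auto simp: sgn_if)
      ultimately show ?thesis
        using det_mult_inverse_integer[OF U(1) \<open>invertible U\<close> that]
        unfolding integer_vectors_def mem_Collect_eq vector_scaleR_component real_scaleR_def
        by (metis Ints_mult)
    qed
    have "L \<in> F"
      unfolding F_def
    proof (intro CollectI conjI ballI)
      show "is_lattice L"
        using inv by (auto simp: is_lattice_def L_def)
      show "L \<subseteq> integer_vectors"
        using Lmem by (auto simp: L_def lattice_of_eq_image simp flip: scaleR_matrix_vector_assoc)
      fix z :: "real^'n" assume z: "z \<in> integer_vectors"
      have "U *v z \<in> integer_vectors"
        unfolding matrix_vector_mult_def using z U(1)
        by (auto intro!: Ints_sum Ints_mult simp: integer_vectors_def)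
      moreover have "q *\<^sub>R z = (q *\<^sub>R matrix_inv U) *v (U *v z)"
        using \<open>invertible U\<close> by (simp add: matrix_inv_vector_mult flip: scaleR_matrix_vector_assoc)
      ultimately show "q *\<^sub>R z \<in> L"
        unfolding L_def lattice_of_eq_image by blast
    qed
    define T' where "T' = ((1/q) *\<^sub>R V) ** B L"
    have "lattice_of T' = (*v) ((1/q) *\<^sub>R V) ` L"
      unfolding T'_def lattice_of_matrix_mult using B(2)[OF \<open>L \<in> F\<close>] by simp
    also have "\<dots> = (\<lambda>z. T *v z) ` integer_vectors"
      unfolding L_def lattice_of_eq_image image_image U(2)
      using q \<open>invertible U\<close>
      by (simp add: matrix_inv_vector_mult matrix_vector_mult_scaleR flip: scaleR_matrix_vector_assoc matrix_vector_mul_assoc)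
    finally have "\<Lambda> = lattice_of T'"
      by (simp add: T lattice_of_eq_image)
    moreover have "invertible T'"
      using V(1) B(1)[OF \<open>L \<in> F\<close>] q by (simp add: T'_def invertible_matrix_mult invertible_scaleR)
    moreover have "norm T' \<le> K' * C"
    proof -
      have "norm T' \<le> K L * norm V"
        unfolding T'_def by (rule K)
      also have "\<dots> \<le> K' * norm V"
        using member_le_sum[of L F "\<lambda>L. \<bar>K L\<bar>"] \<open>finite F\<close> \<open>L \<in> F\<close>
        by (intro mult_right_mono) (auto simp: K'_def)
      also have "\<dots> \<le> K' * C"
        using V(3) by (intro mult_left_mono) (auto simp: K'_def intro: sum_nonneg)
      finally show ?thesis .
    qed
    ultimately show ?thesis
      by blast
  qed
  then show thesis
    by (rule that)
qed

text \<open>A form of Mahler's selection theorem, controlled by covering radius and determinant. The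
  lower bound on the determinant passes to the limit, which is therefore nonsingular.\<close>

lemma lattice_sequence_compact:
  fixes \<rho> d :: real and \<Lambda> :: "nat \<Rightarrow> (real^'n) set"
  assumes "\<rho> \<ge> 0" "d > 0" and "\<And>k. is_lattice (\<Lambda> k)" "\<And>k x. \<exists>l\<in>\<Lambda> k. norm (x - l) \<le> \<rho>"
    "\<And>k. lattice_det (\<Lambda> k) \<ge> d"
  obtains r T T\<^sub>0 where "strict_mono r" "\<And>k. invertible (T k)" "\<And>k. \<Lambda> (r k) = lattice_of (T k)"
    "T \<longlonglongrightarrow> T\<^sub>0" "\<bar>det T\<^sub>0\<bar> \<ge> d"
proof -
  obtain C where C: "\<And>\<Lambda> :: (real^'n) set. is_lattice \<Lambda> \<Longrightarrow> (\<And>x. \<exists>l\<in>\<Lambda>. norm (x - l) \<le> \<rho>) \<Longrightarrow>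
    lattice_det \<Lambda> \<ge> d \<Longrightarrow> \<exists>T. invertible T \<and> \<Lambda> = lattice_of T \<and> norm T \<le> C"
    using bounded_basis[OF assms(1,2), where 'n = 'n] by metis
  have "\<forall>k. \<exists>T. invertible T \<and> \<Lambda> k = lattice_of T \<and> norm T \<le> C"
    using C assms by blast
  then obtain T where T: "\<And>k. invertible (T k)" "\<And>k. \<Lambda> k = lattice_of (T k)" "\<And>k. norm (T k) \<le> C"
    by metis
  have "compact (cball 0 C :: (real^'n^'n) set)"
    by simp
  then obtain T\<^sub>0 r where r: "strict_mono r" "(T \<circ> r) \<longlonglongrightarrow> T\<^sub>0"
    unfolding compact_def using T(3) by (metis mem_cball_0)
  have "(\<lambda>k. \<bar>det ((T \<circ> r) k)\<bar>) \<longlonglongrightarrow> \<bar>det T\<^sub>0\<bar>"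
    using r by (intro tendsto_intros tendsto_det)
  moreover have "d \<le> \<bar>det ((T \<circ> r) k)\<bar>" for k
    using assms(5)[of "r k"] T(1,2) by (simp add: lattice_det_lattice_of)
  ultimately have "d \<le> \<bar>det T\<^sub>0\<bar>"
    by (intro tendsto_lowerbound[where F = sequentially]) auto
  then show thesis
    using r T that[of r "T \<circ> r" T\<^sub>0] by simp
qed

subsection \<open>Sequences of linear maps converging to the identity\<close>

lemma eventually_matrix_near_identity:
  fixes M :: "nat \<Rightarrow> real^'n^'n"
  assumes "M \<longlonglongrightarrow> mat 1" "e > 0"
  shows "\<forall>\<^sub>F k in sequentially. \<forall>x. norm (M k *v x - x) \<le> e * norm x"
proof -
  have "\<forall>\<^sub>F k in sequentially. dist (M k) (mat 1) < e"
    using assms by (rule tendstoD)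
  then show ?thesis
  proof eventually_elim
    case (elim k)
    show ?case
    proof
      fix x
      have "M k *v x - x = (M k - mat 1) *v x"
        by (simp add: matrix_vector_mult_diff_rdistrib)
      then have "norm (M k *v x - x) \<le> norm (M k - mat 1) * norm x"
        by (simp only: matrix_vector_mult_le_norm)
      also have "\<dots> \<le> e * norm x"
        using elim by (intro mult_right_mono) (auto simp: dist_norm)
      finally show "norm (M k *v x - x) \<le> e * norm x" .
    qed
  qed
qed

lemma eventually_matrix_norm_bounds:
  fixes M :: "nat \<Rightarrow> real^'n^'n"
  assumes "M \<longlonglongrightarrow> mat 1"
  shows "\<forall>\<^sub>F k in sequentially. \<forall>x. norm x \<le> 2 * norm (M k *v x) \<and> norm (M k *v x) \<le> 2 * norm x"
proof -
  have "\<forall>\<^sub>F k in sequentially. \<forall>x. norm (M k *v x - x) \<le> 1/2 * norm x"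
    by (rule eventually_matrix_near_identity[OF assms]) simp
  then show ?thesis
  proof eventually_elim
    case (elim k)
    show ?case
    proof
      fix x
      have "norm (M k *v x - x) \<le> 1/2 * norm x"
        using elim by blast
      then show "norm x \<le> 2 * norm (M k *v x) \<and> norm (M k *v x) \<le> 2 * norm x"
        using norm_triangle_ineq2[of x "M k *v x"] norm_triangle_ineq2[of "M k *v x" x]
          norm_minus_commute[of x "M k *v x"] norm_ge_zero[of x] by linarith
    qed
  qed
qed

text \<open>Boundedness of \<open>M k *v l k\<close> confines almost all \<open>l k\<close> to a
  finite set, so one value recurs. In the limit arguments this allows the lattice vector that covers
  a moving point to be held fixed.\<close>

lemma constant_lattice_subsequence:
  fixes M :: "nat \<Rightarrow> real^'n^'n"
  assumes "is_lattice \<Lambda>" "M \<longlonglongrightarrow> mat 1" "\<And>k. l k \<in> \<Lambda>" "\<And>k. norm (M k *v l k) \<le> c"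
  obtains l\<^sub>0 r where "l\<^sub>0 \<in> \<Lambda>" "strict_mono (r :: nat \<Rightarrow> nat)" "\<And>k. l (r k) = l\<^sub>0"
proof -
  obtain K where K: "\<And>k x. k \<ge> K \<Longrightarrow> norm x \<le> 2 * norm (M k *v x)"
    using eventually_matrix_norm_bounds[OF assms(2)] unfolding eventually_sequentially by blast
  have "l ` {K..} \<subseteq> {l \<in> \<Lambda>. norm l \<le> 2 * c}"
  proof safe
    fix k assume "k \<ge> K"
    show "l k \<in> \<Lambda>" by fact
    show "norm (l k) \<le> 2 * c"
      using K[OF \<open>k \<ge> K\<close>, of "l k"] assms(4)[of k] by linarith
  qed
  then have "finite (l ` {K..})"
    using lattice_finite_ball[OF assms(1)] by (rule finite_subset)
  then obtain y where "infinite (l -` {y} \<inter> {K..})"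
    using inf_img_fin_dom'[of l "{K..}"] infinite_Ici[of K] by blast
  then obtain r :: "nat \<Rightarrow> nat" where r: "strict_mono r" "\<And>k. r k \<in> l -` {y} \<inter> {K..}"
    using infinite_enumerate by metis
  have "l (r k) = y" for k
    using r(2)[of k] by simp
  then show thesis
    using that[of y r] r(1) assms(3)[of "r 0"] by simp
qed


subsection \<open>Voronoi polytopes\<close>

lemma voronoi_ineq_iff:
  fixes x l :: "'a::real_inner"
  shows "norm x \<le> norm (x - l) \<longleftrightarrow> 2 * (x \<bullet> l) \<le> l \<bullet> l"
  by (simp add: norm_le inner_diff inner_commute)

lemma voronoi_eq_iff:
  fixes x l :: "'a::real_inner"
  shows "norm (x - l) = norm x \<longleftrightarrow> 2 * (x \<bullet> l) = l \<bullet> l"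
  by (auto simp: norm_eq inner_diff inner_commute)

lemma mem_voronoi_polytope: "x \<in> voronoi_polytope \<Lambda> \<longleftrightarrow> (\<forall>l\<in>\<Lambda>. 2 * (x \<bullet> l) \<le> l \<bullet> l)"
  by (simp add: voronoi_polytope_def voronoi_ineq_iff)

lemma voronoi_polytope_eq_Inter: "voronoi_polytope \<Lambda> = (\<Inter>l\<in>\<Lambda>. {x. l \<bullet> x \<le> (l \<bullet> l) / 2})"
  by (auto simp: mem_voronoi_polytope inner_commute mult.commute)

lemma closed_voronoi_polytope: "closed (voronoi_polytope \<Lambda>)"
  unfolding voronoi_polytope_eq_Inter by (intro closed_INT ballI closed_halfspace_le)

lemma convex_voronoi_polytope: "convex (voronoi_polytope \<Lambda>)"
  unfolding voronoi_polytope_eq_Inter by (intro convex_INT convex_halfspace_le)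

lemma zero_in_voronoi_polytope: "0 \<in> voronoi_polytope \<Lambda>"
  by (simp add: mem_voronoi_polytope)

lemma voronoi_polytope_nearest:
  assumes "is_lattice \<Lambda>"
  obtains l where "l \<in> \<Lambda>" "x - l \<in> voronoi_polytope \<Lambda>"
proof -
  \<comment> \<open>Lattice points of norm above \<open>2 * norm x\<close> are no closer to
    \<open>x\<close> than the origin is, so a minimum over this finite set is global.\<close>
  let ?F = "{l \<in> \<Lambda>. norm l \<le> 2 * norm x}"
  have "finite ?F" "?F \<noteq> {}"
    using lattice_finite_ball[OF assms] lattice_zero[OF assms] by auto
  then obtain l where l: "l \<in> ?F" and min: "\<And>l'. l' \<in> ?F \<Longrightarrow> norm (x - l) \<le> norm (x - l')"
    using ex_is_arg_min_if_finite[of ?F "\<lambda>l. norm (x - l)"] by (auto simp: is_arg_min_linorder)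
  have min': "norm (x - l) \<le> norm (x - l')" if "l' \<in> \<Lambda>" for l'
  proof (cases "l' \<in> ?F")
    case False
    then have "norm l' > 2 * norm x"
      using that by auto
    then have "norm x \<le> norm (x - l')"
      using norm_triangle_ineq2[of l' x] norm_minus_commute[of x l'] by linarith
    moreover have "norm (x - l) \<le> norm x"
      using min[of 0] lattice_zero[OF assms] by simp
    ultimately show ?thesis
      by linarith
  qed (use min in auto)
  have "norm (x - l) \<le> norm (x - l - l')" if "l' \<in> \<Lambda>" for l'
    using min'[OF lattice_add[OF assms _ that, of l]] l by (simp add: diff_diff_eq)
  then show thesis
    using l by (intro that[of l]) (auto simp: voronoi_polytope_def)
qed

text \<open>Every point can be translated by the lattice into the Voronoi polytope, where the origin
  is a nearest lattice point. Covering by balls thus becomes a bound on this one set.\<close>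

lemma voronoi_polytope_subset_cball_iff:
  assumes "is_lattice \<Lambda>"
  shows "voronoi_polytope \<Lambda> \<subseteq> cball 0 \<rho> \<longleftrightarrow> (\<forall>x. \<exists>l\<in>\<Lambda>. norm (x - l) \<le> \<rho>)"
proof
  assume *: "voronoi_polytope \<Lambda> \<subseteq> cball 0 \<rho>"
  show "\<forall>x. \<exists>l\<in>\<Lambda>. norm (x - l) \<le> \<rho>"
  proof
    fix x
    obtain l where "l \<in> \<Lambda>" "x - l \<in> voronoi_polytope \<Lambda>"
      using voronoi_polytope_nearest[OF assms] .
    then show "\<exists>l\<in>\<Lambda>. norm (x - l) \<le> \<rho>"
      using subsetD[OF *, of "x - l"] by (intro bexI[of _ l]) simp_all
  qed
next
  assume *: "\<forall>x. \<exists>l\<in>\<Lambda>. norm (x - l) \<le> \<rho>"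
  show "voronoi_polytope \<Lambda> \<subseteq> cball 0 \<rho>"
  proof
    fix x assume x: "x \<in> voronoi_polytope \<Lambda>"
    obtain l where "l \<in> \<Lambda>" "norm (x - l) \<le> \<rho>"
      using * by blast
    then show "x \<in> cball 0 \<rho>"
      using x by (auto simp: voronoi_polytope_def)
  qed
qed

lemma voronoi_polytope_uminus:
  assumes "is_lattice \<Lambda>" "x \<in> voronoi_polytope \<Lambda>"
  shows "- x \<in> voronoi_polytope \<Lambda>"
  unfolding mem_voronoi_polytope
proof
  fix l assume "l \<in> \<Lambda>"
  then have "2 * (x \<bullet> - l) \<le> - l \<bullet> - l"
    using assms lattice_uminus unfolding mem_voronoi_polytope by blast
  then show "2 * (- x \<bullet> l) \<le> l \<bullet> l"
    by simp
qed

lemma voronoi_polytope_limit: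
  fixes M :: "nat \<Rightarrow> real^'n^'n"
  assumes "M \<longlonglongrightarrow> mat 1" "x \<longlonglongrightarrow> v" "\<And>k. x k \<in> voronoi_polytope ((*v) (M k) ` \<Lambda>)"
  shows "v \<in> voronoi_polytope \<Lambda>"
  unfolding mem_voronoi_polytope
proof
  fix l assume "l \<in> \<Lambda>"
  have M: "(\<lambda>k. M k *v l) \<longlonglongrightarrow> l"
    using tendsto_matrix_vector_mult[OF assms(1) tendsto_const[of l]] by simp
  show "2 * (v \<bullet> l) \<le> l \<bullet> l"
  proof (rule LIMSEQ_le)
    show "(\<lambda>k. 2 * (x k \<bullet> (M k *v l))) \<longlonglongrightarrow> 2 * (v \<bullet> l)"
      "(\<lambda>k. (M k *v l) \<bullet> (M k *v l)) \<longlonglongrightarrow> l \<bullet> l"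
      by (intro tendsto_intros M assms)+
    show "\<exists>N. \<forall>n\<ge>N. 2 * (x n \<bullet> (M n *v l)) \<le> (M n *v l) \<bullet> (M n *v l)"
      using assms(3) \<open>l \<in> \<Lambda>\<close> unfolding mem_voronoi_polytope by blast
  qed
qed

text \<open>The point is uniformity over infinitely many lattice vectors: long ones satisfy the
  strict inequality by Cauchy-Schwarz, and the finitely many others by continuity.\<close>

lemma voronoi_eventually_strict:
  fixes M :: "nat \<Rightarrow> real^'n^'n"
  assumes "is_lattice \<Lambda>" "M \<longlonglongrightarrow> mat 1" "x \<longlonglongrightarrow> v"
  shows "\<forall>\<^sub>F k in sequentially. \<forall>l\<in>\<Lambda>. 2 * (v \<bullet> l) < l \<bullet> l \<longrightarrow> 2 * (x k \<bullet> (M k *v l)) < (M k *v l) \<bullet> (M k *v l)"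
proof -
  let ?c = "norm v + 1"
  \<comment> \<open>The factor 4 absorbs two halvings: \<open>M k\<close> may halve the length of
    \<open>l\<close>, and Cauchy-Schwarz needs \<open>M k *v l\<close> to be longer than
    \<open>2 * norm (x k)\<close>.\<close>
  let ?F = "{l \<in> \<Lambda>. norm l \<le> 4 * ?c}"
  have "\<forall>\<^sub>F k in sequentially. norm (x k) < ?c"
    using assms(3) by (intro order_tendstoD(2)[of _ "norm v"] tendsto_norm) auto
  moreover have "\<forall>\<^sub>F k in sequentially. \<forall>x. norm x \<le> 2 * norm (M k *v x) \<and> norm (M k *v x) \<le> 2 * norm x"
    by (rule eventually_matrix_norm_bounds[OF assms(2)])
  moreover have "\<forall>\<^sub>F k in sequentially. \<forall>l\<in>?F. 2 * (v \<bullet> l) < l \<bullet> l \<longrightarrow> 2 * (x k \<bullet> (M k *v l)) < (M k *v l) \<bullet> (M k *v l)"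
  proof (rule eventually_ball_finite)
    show "finite ?F"
      by (rule lattice_finite_ball[OF assms(1)])
    show "\<forall>l\<in>?F. \<forall>\<^sub>F k in sequentially. 2 * (v \<bullet> l) < l \<bullet> l \<longrightarrow> 2 * (x k \<bullet> (M k *v l)) < (M k *v l) \<bullet> (M k *v l)"
    proof
      fix l assume "l \<in> ?F"
      show "\<forall>\<^sub>F k in sequentially. 2 * (v \<bullet> l) < l \<bullet> l \<longrightarrow> 2 * (x k \<bullet> (M k *v l)) < (M k *v l) \<bullet> (M k *v l)"
      proof (cases "2 * (v \<bullet> l) < l \<bullet> l")
        case True
        have M: "(\<lambda>k. M k *v l) \<longlonglongrightarrow> l"
          using tendsto_matrix_vector_mult[OF assms(2) tendsto_const[of l]] by simp
        have "(\<lambda>k. (M k *v l) \<bullet> (M k *v l) - 2 * (x k \<bullet> (M k *v l))) \<longlonglongrightarrow> l \<bullet> l - 2 * (v \<bullet> l)"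
          by (intro tendsto_intros M assms)
        then have "\<forall>\<^sub>F k in sequentially. (M k *v l) \<bullet> (M k *v l) - 2 * (x k \<bullet> (M k *v l)) > 0"
          by (rule order_tendstoD) (use True in simp)
        then show ?thesis
          by eventually_elim simp
      qed simp
    qed
  qed
  ultimately show ?thesis
  proof eventually_elim
    case (elim k)
    show ?case
    proof (intro ballI impI)
      fix l assume l: "l \<in> \<Lambda>" "2 * (v \<bullet> l) < l \<bullet> l"
      show "2 * (x k \<bullet> (M k *v l)) < (M k *v l) \<bullet> (M k *v l)"
      proof (cases "norm l \<le> 4 * ?c")
        case True
        then show ?thesis
          using elim l by blast
      next
        case False
        have "4 * ?c < norm l"
          using False by simp
        also have "\<dots> \<le> 2 * norm (M k *v l)"
          using elim by blast
        finally have *: "2 * norm (x k) < norm (M k *v l)"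
          using elim(1) by argo
        have "2 * (x k \<bullet> (M k *v l)) \<le> 2 * norm (x k) * norm (M k *v l)"
          using norm_cauchy_schwarz[of "x k" "M k *v l"] by simp
        also have "\<dots> < norm (M k *v l) * norm (M k *v l)"
          using * norm_ge_zero[of "x k"] by (intro mult_strict_right_mono) linarith+
        finally show ?thesis
          by (simp add: dot_square_norm power2_eq_square)
      qed
    qed
  qed
qed


subsection \<open>Vertices of the Voronoi polytope\<close>

text \<open>For \<open>v\<close> in the Voronoi polytope these are the lattice points nearest to
  \<open>v\<close>, always including the origin.\<close>

definition contacts :: "(real^'n) set \<Rightarrow> real^'n \<Rightarrow> (real^'n) set" where
  "contacts \<Lambda> v = {l \<in> \<Lambda>. 2 * (v \<bullet> l) = l \<bullet> l}"

definition vertex_class :: "(real^'n) set \<Rightarrow> real^'n \<Rightarrow> (real^'n) set" where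
  "vertex_class \<Lambda> v = (\<lambda>l. v - l) ` contacts \<Lambda> v"

lemma zero_in_contacts: "is_lattice \<Lambda> \<Longrightarrow> 0 \<in> contacts \<Lambda> v"
  by (simp add: contacts_def lattice_zero)

lemma vertex_class_self: "is_lattice \<Lambda> \<Longrightarrow> v \<in> vertex_class \<Lambda> v"
  unfolding vertex_class_def by (rule image_eqI[OF _ zero_in_contacts]) simp

lemma contacts_subset: "contacts \<Lambda> v \<subseteq> {l \<in> \<Lambda>. norm l \<le> 2 * norm v}"
proof
  fix l assume l: "l \<in> contacts \<Lambda> v"
  then have "norm l * norm l = 2 * (v \<bullet> l)"
    by (simp add: contacts_def flip: dot_square_norm power2_eq_square)
  also have "\<dots> \<le> 2 * norm v * norm l"
    using norm_cauchy_schwarz[of v l] by simp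
  finally have "norm l \<le> 2 * norm v"
    by (cases "l = 0") auto
  then show "l \<in> {l \<in> \<Lambda>. norm l \<le> 2 * norm v}"
    using l by (simp add: contacts_def)
qed

lemma finite_contacts: "is_lattice \<Lambda> \<Longrightarrow> finite (contacts \<Lambda> v)"
  using contacts_subset lattice_finite_ball by (rule finite_subset)

lemma finite_vertex_class: "is_lattice \<Lambda> \<Longrightarrow> finite (vertex_class \<Lambda> v)"
  by (simp add: vertex_class_def finite_contacts)

lemma norm_vertex_class: "w \<in> vertex_class \<Lambda> v \<Longrightarrow> norm w = norm v"
  by (auto simp: vertex_class_def contacts_def voronoi_eq_iff)

lemma vertex_class_memI:
  assumes "v - w \<in> \<Lambda>" "norm w = norm v"
  shows "w \<in> vertex_class \<Lambda> v"
proof -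
  have "v - w \<in> contacts \<Lambda> v"
    using assms by (simp add: contacts_def flip: voronoi_eq_iff)
  then show ?thesis
    unfolding vertex_class_def by (rule image_eqI[rotated]) simp
qed

lemma vertex_class_memD: "w \<in> vertex_class \<Lambda> v \<Longrightarrow> v - w \<in> \<Lambda>"
  by (auto simp: vertex_class_def contacts_def)

text \<open>Differing by a lattice vector and having equal norm are both equivalence relations.
  Consequently two classes are equal or disjoint.\<close>

lemma vertex_class_eq:
  assumes "is_lattice \<Lambda>" "w \<in> vertex_class \<Lambda> v"
  shows "vertex_class \<Lambda> w = vertex_class \<Lambda> v"
proof -
  have vw: "v - w \<in> \<Lambda>" "w - v \<in> \<Lambda>" "norm w = norm v"
    using vertex_class_memD[OF assms(2)] lattice_uminus[OF assms(1), of "v - w"] norm_vertex_class[OF assms(2)]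
    by simp_all
  have "x \<in> vertex_class \<Lambda> w \<longleftrightarrow> x \<in> vertex_class \<Lambda> v" for x
  proof
    assume x: "x \<in> vertex_class \<Lambda> w"
    show "x \<in> vertex_class \<Lambda> v"
      using lattice_add[OF assms(1) vw(1) vertex_class_memD[OF x]] norm_vertex_class[OF x] vw(3)
      by (intro vertex_class_memI) simp_all
  next
    assume x: "x \<in> vertex_class \<Lambda> v"
    show "x \<in> vertex_class \<Lambda> w"
      using lattice_add[OF assms(1) vw(2) vertex_class_memD[OF x]] norm_vertex_class[OF x] vw(3)
      by (intro vertex_class_memI) simp_all
  qed
  then show ?thesis
    by blast
qed

lemma vertex_class_uminus:
  assumes "is_lattice \<Lambda>"
  shows "vertex_class \<Lambda> (- v) = uminus ` vertex_class \<Lambda> v"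
proof -
  have sub: "- w \<in> vertex_class \<Lambda> (- v)" if "w \<in> vertex_class \<Lambda> v" for v w
    using lattice_uminus[OF assms vertex_class_memD[OF that]] norm_vertex_class[OF that]
    by (intro vertex_class_memI) simp_all
  show ?thesis
  proof
    show "uminus ` vertex_class \<Lambda> v \<subseteq> vertex_class \<Lambda> (- v)"
      using sub by blast
    show "vertex_class \<Lambda> (- v) \<subseteq> uminus ` vertex_class \<Lambda> v"
    proof
      fix w assume "w \<in> vertex_class \<Lambda> (- v)"
      then have "- w \<in> vertex_class \<Lambda> v"
        using sub[of w "- v"] by simp
      then show "w \<in> uminus ` vertex_class \<Lambda> v"
        by (rule image_eqI[rotated]) simp
    qed
  qed
qed

lemma vertex_class_subset_voronoi:
  assumes "is_lattice \<Lambda>" "v \<in> voronoi_polytope \<Lambda>" "w \<in> vertex_class \<Lambda> v"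
  shows "w \<in> voronoi_polytope \<Lambda>"
  unfolding voronoi_polytope_def
proof (intro CollectI ballI)
  fix l assume "l \<in> \<Lambda>"
  then have "norm v \<le> norm (v - ((v - w) + l))"
    using lattice_add[OF assms(1) vertex_class_memD[OF assms(3)]] assms(2) unfolding voronoi_polytope_def by blast
  also have "v - ((v - w) + l) = w - l"
    by simp
  finally show "norm w \<le> norm (w - l)"
    using norm_vertex_class[OF assms(3)] by simp
qed

text \<open>The contacts (apart from 0) are the active constraints at \<open>v\<close>; a direction
  orthogonal to all of them is one in which \<open>v\<close> can move both ways within the
  polytope.\<close>

lemma vertex_iff_contacts:
  assumes "is_lattice \<Lambda>"
  shows "v \<in> vertices (voronoi_polytope \<Lambda>) \<longleftrightarrow>
    v \<in> voronoi_polytope \<Lambda> \<and> (\<forall>y. (\<forall>l\<in>contacts \<Lambda> v. y \<bullet> l = 0) \<longrightarrow> y = 0)"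
proof (intro iffI conjI allI impI)
  assume v: "v \<in> vertices (voronoi_polytope \<Lambda>)"
  then show vP: "v \<in> voronoi_polytope \<Lambda>"
    by (simp add: vertices_def extreme_point_of_def)
  fix y assume y: "\<forall>l\<in>contacts \<Lambda> v. y \<bullet> l = 0"
  \<comment> \<open>A small step along \<open>z\<close> leaves the contact equations intact, and all
    other inequalities are strict at \<open>v\<close>.\<close>
  have ev: "\<forall>\<^sub>F k in sequentially. v + inverse (real (Suc k)) *\<^sub>R z \<in> voronoi_polytope \<Lambda>"
    if z: "\<forall>l\<in>contacts \<Lambda> v. z \<bullet> l = 0" for z
  proof -
    have "(\<lambda>k. v + inverse (real (Suc k)) *\<^sub>R z) \<longlonglongrightarrow> v + 0 *\<^sub>R z"
      by (intro tendsto_intros LIMSEQ_inverse_real_of_nat)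
    then have "\<forall>\<^sub>F k in sequentially. \<forall>l\<in>\<Lambda>. 2 * (v \<bullet> l) < l \<bullet> l \<longrightarrow>
        2 * ((v + inverse (real (Suc k)) *\<^sub>R z) \<bullet> (mat 1 *v l)) < (mat 1 *v l) \<bullet> (mat 1 *v l)"
      using assms by (intro voronoi_eventually_strict[where M = "\<lambda>_. mat 1"]) auto
    then show ?thesis
    proof eventually_elim
      case (elim k)
      show ?case
        unfolding mem_voronoi_polytope
      proof
        fix l assume l: "l \<in> \<Lambda>"
        show "2 * ((v + inverse (real (Suc k)) *\<^sub>R z) \<bullet> l) \<le> l \<bullet> l"
        proof (cases "l \<in> contacts \<Lambda> v")
          case True
          then show ?thesis
            using z by (simp add: contacts_def inner_add_left)
        next
          case False
          then have "2 * (v \<bullet> l) < l \<bullet> l"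
            using vP l by (force simp: contacts_def mem_voronoi_polytope)
          then show ?thesis
            using elim l by force
        qed
      qed
    qed
  qed
  have "\<forall>\<^sub>F k in sequentially. v + inverse (real (Suc k)) *\<^sub>R y \<in> voronoi_polytope \<Lambda> \<and>
      v + inverse (real (Suc k)) *\<^sub>R (- y) \<in> voronoi_polytope \<Lambda>"
    by (intro eventually_conj ev) (use y in auto)
  then obtain k where k: "v + inverse (real (Suc k)) *\<^sub>R y \<in> voronoi_polytope \<Lambda>"
      "v + inverse (real (Suc k)) *\<^sub>R (- y) \<in> voronoi_polytope \<Lambda>"
    unfolding eventually_sequentially by blast
  define s where "s = inverse (real (Suc k))"
  have "s > 0" by (simp add: s_def)
  have "v = midpoint (v + s *\<^sub>R y) (v + s *\<^sub>R (- y))"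
    by (simp add: midpoint_def algebra_simps flip: scaleR_2)
  then have "v \<in> open_segment (v + s *\<^sub>R y) (v + s *\<^sub>R (- y))" if "v + s *\<^sub>R y \<noteq> v + s *\<^sub>R (- y)"
    using that midpoint_in_open_segment by metis
  then have "v + s *\<^sub>R y = v + s *\<^sub>R (- y)"
    using v k unfolding vertices_def extreme_point_of_def s_def by blast
  then have "(2 * s) *\<^sub>R y = 0"
    by (simp add: eq_neg_iff_add_eq_0 flip: scaleR_2)
  then show "y = 0"
    using \<open>s > 0\<close> by simp
next
  assume *: "v \<in> voronoi_polytope \<Lambda> \<and> (\<forall>y. (\<forall>l\<in>contacts \<Lambda> v. y \<bullet> l = 0) \<longrightarrow> y = 0)"
  show "v \<in> vertices (voronoi_polytope \<Lambda>)"
    unfolding vertices_def extreme_point_of_def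
  proof (intro CollectI conjI ballI)
    show "v \<in> voronoi_polytope \<Lambda>"
      using * by blast
    fix a b assume ab: "a \<in> voronoi_polytope \<Lambda>" "b \<in> voronoi_polytope \<Lambda>"
    show "v \<notin> open_segment a b"
    proof
      assume "v \<in> open_segment a b"
      then obtain u where u: "0 < u" "u < 1" "v = (1 - u) *\<^sub>R a + u *\<^sub>R b" "a \<noteq> b"
        by (auto simp: in_segment)
      have "(b - a) \<bullet> l = 0" if l: "l \<in> contacts \<Lambda> v" for l
      proof -
        \<comment> \<open>The slack of a contact at \<open>v\<close> is zero and is a proper convex
          combination of the nonnegative slacks at \<open>a\<close> and \<open>b\<close>, so both of
          these vanish.\<close>
        have "(1 - u) * (l \<bullet> l - 2 * (a \<bullet> l)) + u * (l \<bullet> l - 2 * (b \<bullet> l)) = 0"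
          using l u(3) by (simp add: contacts_def inner_add_left algebra_simps)
        moreover have "l \<bullet> l - 2 * (a \<bullet> l) \<ge> 0" "l \<bullet> l - 2 * (b \<bullet> l) \<ge> 0"
          using ab l by (auto simp: contacts_def mem_voronoi_polytope)
        ultimately have "l \<bullet> l - 2 * (a \<bullet> l) = 0" "l \<bullet> l - 2 * (b \<bullet> l) = 0"
          using u(1,2) by (smt (verit) mult_nonneg_nonneg mult_pos_pos)+
        then show ?thesis
          by (simp add: inner_diff_left)
      qed
      then have "b - a = 0"
        using * by blast
      then show False
        using u by simp
    qed
  qed
qed

lemma span_contacts:
  assumes "is_lattice \<Lambda>" "v \<in> vertices (voronoi_polytope \<Lambda>)"
  shows "span (contacts \<Lambda> v) = UNIV"
proof (rule ccontr)
  assume "span (contacts \<Lambda> v) \<noteq> UNIV"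
  then obtain a where "a \<noteq> 0" "\<forall>x\<in>span (contacts \<Lambda> v). a \<bullet> x = 0"
    using span_not_UNIV_orthogonal by blast
  then show False
    using assms vertex_iff_contacts span_base by metis
qed

lemma vertex_class_subset_vertices:
  assumes "is_lattice \<Lambda>" "v \<in> vertices (voronoi_polytope \<Lambda>)" "w \<in> vertex_class \<Lambda> v"
  shows "w \<in> vertices (voronoi_polytope \<Lambda>)"
  unfolding vertex_iff_contacts[OF assms(1)]
proof (intro conjI allI impI)
  have v: "v \<in> voronoi_polytope \<Lambda>" "\<And>y. \<forall>l\<in>contacts \<Lambda> v. y \<bullet> l = 0 \<Longrightarrow> y = 0"
    using assms vertex_iff_contacts by blast+
  show "w \<in> voronoi_polytope \<Lambda>"
    using vertex_class_subset_voronoi assms v by blast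
  fix y assume y: "\<forall>l\<in>contacts \<Lambda> w. y \<bullet> l = 0"
  have wl: "y \<bullet> w = y \<bullet> x" if "x \<in> vertex_class \<Lambda> v" for x
  proof -
    have "x \<in> vertex_class \<Lambda> w"
      using that vertex_class_eq[OF assms(1,3)] by simp
    then show ?thesis
      using y by (auto simp: vertex_class_def inner_diff_right)
  qed
  have "y \<bullet> l = 0" if "l \<in> contacts \<Lambda> v" for l
  proof -
    have "v - l \<in> vertex_class \<Lambda> v"
      using that by (simp add: vertex_class_def)
    then show ?thesis
      using wl[of "v - l"] wl[of v] vertex_class_self[OF assms(1)] by (simp add: inner_diff_right)
  qed
  then show "y = 0"
    using v(2) by blast
qed

text \<open>Equivalent vertices have equal norm: testing each against the lattice vector that leads
  to the other gives both inequalities.\<close>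

lemma vertex_equiv_image:
  assumes "is_lattice \<Lambda>" "v \<in> vertices (voronoi_polytope \<Lambda>)"
  shows "vertex_equiv \<Lambda> `` {v} = vertex_class \<Lambda> v"
proof (intro subset_antisym subsetI)
  fix w assume "w \<in> vertex_equiv \<Lambda> `` {v}"
  then have w: "w \<in> voronoi_polytope \<Lambda>" "v \<in> voronoi_polytope \<Lambda>" "v - w \<in> \<Lambda>"
    by (auto simp: vertex_equiv_def vertices_def extreme_point_of_def)
  have "norm v \<le> norm (v - (v - w))" "norm w \<le> norm (w - - (v - w))"
    using w lattice_uminus[OF assms(1) w(3)] unfolding voronoi_polytope_def by blast+
  then show "w \<in> vertex_class \<Lambda> v"
    using w by (intro vertex_class_memI) auto
next
  fix w assume w: "w \<in> vertex_class \<Lambda> v"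
  then show "w \<in> vertex_equiv \<Lambda> `` {v}"
    using assms vertex_class_subset_vertices[OF assms w] vertex_class_memD[OF w]
    by (simp add: vertex_equiv_def)
qed

lemma primitive_simplices_eq:
  assumes "is_lattice \<Lambda>"
  shows "primitive_simplices \<Lambda> = (\<lambda>v. convex hull vertex_class \<Lambda> v) ` vertices (voronoi_polytope \<Lambda>)"
proof -
  have "vertices (voronoi_polytope \<Lambda>) // vertex_equiv \<Lambda> = vertex_class \<Lambda> ` vertices (voronoi_polytope \<Lambda>)"
    by (auto simp: quotient_def vertex_equiv_image[OF assms] image_iff)
  then show ?thesis
    unfolding primitive_simplices_def by auto
qed

lemma norm_eq_imp_extreme_point_cball:
  fixes w :: "'a::euclidean_space"
  assumes "norm w = r"
  shows "w extreme_point_of cball 0 r"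
  unfolding extreme_point_of_def
proof (intro conjI ballI notI)
  show "w \<in> cball 0 r"
    using assms by simp
  fix a b assume ab: "a \<in> cball 0 r" "b \<in> cball 0 r" "w \<in> open_segment a b"
  show False
    using dist_decreases_open_segment[OF ab(3), of 0] ab(1,2) assms by auto
qed

lemma extreme_point_of_subset:
  "x extreme_point_of T \<Longrightarrow> x \<in> S \<Longrightarrow> S \<subseteq> T \<Longrightarrow> x extreme_point_of S"
  unfolding extreme_point_of_def by blast

text \<open>A class lies on a sphere about the origin, and points of a sphere are extreme in the
  ball it bounds. So the vertices are known before affine independence is.\<close>

lemma vertices_convex_hull_vertex_class:
  "vertices (convex hull vertex_class \<Lambda> v) = vertex_class \<Lambda> v"
proof
  show "vertices (convex hull vertex_class \<Lambda> v) \<subseteq> vertex_class \<Lambda> v"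
    using extreme_point_of_convex_hull by (auto simp: vertices_def)
  have "convex hull vertex_class \<Lambda> v \<subseteq> cball 0 (norm v)"
    by (intro hull_minimal) (auto simp: norm_vertex_class)
  then show "vertex_class \<Lambda> v \<subseteq> vertices (convex hull vertex_class \<Lambda> v)"
    unfolding vertices_def
    using extreme_point_of_subset[OF norm_eq_imp_extreme_point_cball[OF norm_vertex_class] hull_inc] by blast
qed

lemma affine_hull_vertex_class:
  assumes "is_lattice \<Lambda>" "v \<in> vertices (voronoi_polytope \<Lambda>)"
  shows "affine hull vertex_class \<Lambda> v = UNIV"
proof -
  have "UNIV = span (contacts \<Lambda> v)"
    using span_contacts[OF assms] by simp
  also have "\<dots> \<subseteq> span ((\<lambda>x. - v + x) ` vertex_class \<Lambda> v)"
  proof (intro span_minimal subspace_span subsetI)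
    fix l assume "l \<in> contacts \<Lambda> v"
    then have "- v + (v - l) \<in> (\<lambda>x. - v + x) ` vertex_class \<Lambda> v"
      unfolding vertex_class_def by blast
    then have "- l \<in> span ((\<lambda>x. - v + x) ` vertex_class \<Lambda> v)"
      by (auto intro: span_base)
    then show "l \<in> span ((\<lambda>x. - v + x) ` vertex_class \<Lambda> v)"
      using span_neg by force
  qed
  finally have "span ((\<lambda>x. - v + x) ` vertex_class \<Lambda> v) = UNIV"
    by blast
  moreover have "affine hull vertex_class \<Lambda> v = (\<lambda>x. v + x) ` span ((\<lambda>x. - v + x) ` vertex_class \<Lambda> v)"
    using hull_inc[OF vertex_class_self[OF assms(1)]] by (rule affine_hull_span_gen)
  ultimately show ?thesis
    by (simp add: surj_plus)
qed

text \<open>The origin is equidistant from the class. Any other equidistant \<open>c\<close> would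
  be orthogonal to all contacts, hence zero at a vertex; so the \<open>THE\<close> in
  \<open>circumradius\<close> is well defined.\<close>

lemma circumradius_vertex_class:
  assumes "is_lattice \<Lambda>" "v \<in> vertices (voronoi_polytope \<Lambda>)"
  shows "circumradius (convex hull vertex_class \<Lambda> v) = norm v"
  unfolding circumradius_def vertices_convex_hull_vertex_class
proof (rule the_equality)
  show "\<exists>c\<in>affine hull (convex hull vertex_class \<Lambda> v). \<forall>w\<in>vertex_class \<Lambda> v. dist c w = norm v"
    using affine_hull_vertex_class[OF assms] norm_vertex_class by (intro bexI[of _ 0]) auto
  fix r assume "\<exists>c\<in>affine hull (convex hull vertex_class \<Lambda> v). \<forall>w\<in>vertex_class \<Lambda> v. dist c w = r"
  then obtain c where c: "\<And>w. w \<in> vertex_class \<Lambda> v \<Longrightarrow> dist c w = r"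
    by blast
  have "c \<bullet> l = 0" if l: "l \<in> contacts \<Lambda> v" for l
  proof -
    have "v - l \<in> vertex_class \<Lambda> v"
      using l by (simp add: vertex_class_def)
    then have "norm (c - (v - l)) = norm (c - v)" "norm (v - l) = norm v"
      using c[of "v - l"] c[of v] vertex_class_self[OF assms(1)] norm_vertex_class[of "v - l"] by (simp_all add: dist_norm)
    then show ?thesis
      by (simp add: norm_eq inner_diff inner_commute)
  qed
  then have "c = 0"
    using assms vertex_iff_contacts by blast
  then show "r = norm v"
    using c[OF vertex_class_self[OF assms(1)]] by simp
qed

text \<open>A vertex is determined by its contacts, which form a subset of a fixed finite
  set.\<close>

lemma finite_vertices_voronoi:
  assumes "is_lattice \<Lambda>" "voronoi_polytope \<Lambda> \<subseteq> cball 0 \<rho>"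
  shows "finite (vertices (voronoi_polytope \<Lambda>))"
proof (rule finite_imageD)
  let ?V = "vertices (voronoi_polytope \<Lambda>)"
  have "contacts \<Lambda> ` ?V \<subseteq> Pow {l \<in> \<Lambda>. norm l \<le> 2 * \<rho>}"
  proof (intro image_subsetI PowI)
    fix v assume "v \<in> ?V"
    then have "norm v \<le> \<rho>"
      using assms(2) by (auto simp: vertices_def extreme_point_of_def)
    then show "contacts \<Lambda> v \<subseteq> {l \<in> \<Lambda>. norm l \<le> 2 * \<rho>}"
      using contacts_subset[of \<Lambda> v] by fastforce
  qed
  then show "finite (contacts \<Lambda> ` ?V)"
    by (rule finite_subset) (simp add: lattice_finite_ball[OF assms(1)])
  show "inj_on (contacts \<Lambda>) ?V"
  proof (rule inj_onI)
    fix v w assume vw: "v \<in> ?V" "w \<in> ?V" "contacts \<Lambda> v = contacts \<Lambda> w"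
    have "\<forall>l\<in>contacts \<Lambda> v. (v - w) \<bullet> l = 0"
    proof
      fix l assume "l \<in> contacts \<Lambda> v"
      then have "2 * (v \<bullet> l) = l \<bullet> l" "2 * (w \<bullet> l) = l \<bullet> l"
        using vw(3) by (auto simp: contacts_def)
      then show "(v - w) \<bullet> l = 0"
        by (simp add: inner_diff_left)
    qed
    then have "v - w = 0"
      using vw(1) vertex_iff_contacts[OF assms(1)] by blast
    then show "v = w"
      by simp
  qed
qed

subsection \<open>Critical covering lattices of the ball\<close>

text \<open>Boundedness of \<open>K\<close> bounds the covering radius, hence the determinants, so
  that the \<open>Sup\<close> is a genuine upper bound.\<close>

lemma lattice_det_le_critical_det:
  assumes "bounded K" "covering_lattice K \<Lambda>"
  shows "lattice_det \<Lambda> \<le> critical_det K"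
proof -
  obtain \<rho> where \<rho>: "\<rho> > 0" "\<And>x. x \<in> K \<Longrightarrow> norm x \<le> \<rho>"
    using assms(1) unfolding bounded_pos by blast
  obtain D where D: "\<And>\<Lambda> :: (real^'a) set. is_lattice \<Lambda> \<Longrightarrow> (\<And>x. \<exists>l\<in>\<Lambda>. norm (x - l) \<le> \<rho>) \<Longrightarrow> lattice_det \<Lambda> \<le> D"
    using lattice_det_bounded[of \<rho>] \<rho>(1) by (metis less_imp_le)
  have "lattice_det \<Lambda>' \<le> D" if "covering_lattice K \<Lambda>'" for \<Lambda>'
  proof (rule D)
    show "is_lattice \<Lambda>'"
      using that by (simp add: covering_lattice_def)
    show "\<exists>l\<in>\<Lambda>'. norm (x - l) \<le> \<rho>" for x
      using that \<rho>(2) unfolding covering_lattice_iff by meson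
  qed
  then have "bdd_above {lattice_det \<Lambda> | \<Lambda>. covering_lattice K \<Lambda>}"
    by (intro bdd_aboveI[of _ D]) auto
  then show ?thesis
    unfolding critical_det_def using assms(2) by (intro cSup_upper) auto
qed

lemma covering_lattice_mono:
  "covering_lattice K \<Lambda> \<Longrightarrow> K \<subseteq> K' \<Longrightarrow> covering_lattice K' \<Lambda>"
  unfolding covering_lattice_iff by (meson subsetD)

lemma covering_cball_iff:
  "covering_lattice (cball 0 1) \<Lambda> \<longleftrightarrow> is_lattice \<Lambda> \<and> voronoi_polytope \<Lambda> \<subseteq> cball 0 1"
  unfolding covering_lattice_iff using voronoi_polytope_subset_cball_iff[of \<Lambda> 1] by auto

text \<open>If all of the Voronoi polytope had norm below 1, a slight dilation of the lattice would
  still cover and have larger determinant.\<close>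

lemma critical_lattice_unit_vertex:
  fixes \<Lambda> :: "(real^'n) set"
  assumes "critical_covering_lattice (cball 0 1) \<Lambda>"
  obtains v where "v \<in> voronoi_polytope \<Lambda>" "norm v = 1"
proof -
  let ?P = "voronoi_polytope \<Lambda>"
  have \<Lambda>: "is_lattice \<Lambda>" "?P \<subseteq> cball 0 1"
    using assms by (auto simp: critical_covering_lattice_def covering_cball_iff)
  have "compact ?P"
    using \<Lambda>(2) closed_voronoi_polytope compact_eq_bounded_closed bounded_cball bounded_subset by blast
  then obtain v where v: "v \<in> ?P" "\<And>x. x \<in> ?P \<Longrightarrow> norm x \<le> norm v"
    using continuous_attains_sup[of ?P norm] zero_in_voronoi_polytope[of \<Lambda>] continuous_on_norm_id by blast
  have "norm v = 1"
  proof (rule ccontr)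
    assume "norm v \<noteq> 1"
    then have lt: "norm v < 1"
      using v(1) \<Lambda>(2) by force
    \<comment> \<open>A factor above 1 that still keeps \<open>s * norm v\<close> at most 1.\<close>
    define s where "s = 2 / (1 + norm v)"
    have s: "s > 1" "s * norm v \<le> 1"
      using lt norm_ge_zero[of v] by (auto simp: s_def field_simps add_pos_nonneg)
    let ?M = "s *\<^sub>R mat 1 :: real^'n^'n"
    have M: "?M *v x = s *\<^sub>R x" for x
      by (simp flip: scaleR_matrix_vector_assoc)
    have inv: "invertible ?M"
      using s by (intro invertible_scaleR) (auto simp: invertible_det_nz)
    have lat: "is_lattice ((*v) ?M ` \<Lambda>)"
      using \<Lambda>(1) inv by (rule is_lattice_matrix_image)
    have "covering_lattice (cball 0 1) ((*v) ?M ` \<Lambda>)"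
      unfolding covering_lattice_iff
    proof (intro conjI lat allI)
      fix x
      obtain l where l: "l \<in> \<Lambda>" "(1 / s) *\<^sub>R x - l \<in> ?P"
        using voronoi_polytope_nearest[OF \<Lambda>(1)] .
      have "x - s *\<^sub>R l = s *\<^sub>R ((1 / s) *\<^sub>R x - l)"
        using s by (simp add: algebra_simps)
      then have "norm (x - s *\<^sub>R l) = s * norm ((1 / s) *\<^sub>R x - l)"
        using s by (metis abs_of_pos less_trans norm_scaleR zero_less_one)
      also have "\<dots> \<le> s * norm v"
        using v(2)[OF l(2)] s by (intro mult_left_mono) auto
      finally show "\<exists>l\<in>(*v) ?M ` \<Lambda>. x - l \<in> cball 0 1"
        using s l(1) by (intro bexI[of _ "s *\<^sub>R l"]) (auto simp flip: M)
    qed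
    then have "lattice_det ((*v) ?M ` \<Lambda>) \<le> lattice_det \<Lambda>"
      using lattice_det_le_critical_det[of "cball 0 1"] assms by (simp add: critical_covering_lattice_def)
    moreover have "lattice_det ((*v) ?M ` \<Lambda>) = s ^ CARD('n) * lattice_det \<Lambda>"
      using s by (simp add: lattice_det_matrix_image[OF \<Lambda>(1) inv] det_scaleR)
    moreover have "s ^ CARD('n) > 1"
      using s by (intro one_less_power) auto
    ultimately show False
      using lattice_det_pos[OF \<Lambda>(1)] by (simp add: mult_le_cancel_right2)
  qed
  then show thesis
    using v that by blast
qed

lemma unit_norm_imp_vertex:
  assumes "voronoi_polytope \<Lambda> \<subseteq> cball 0 1" "v \<in> voronoi_polytope \<Lambda>" "norm v = 1"
  shows "v \<in> vertices (voronoi_polytope \<Lambda>)"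
  unfolding vertices_def
  using extreme_point_of_subset[OF norm_eq_imp_extreme_point_cball[OF assms(3)] assms(2,1)] by simp

text \<open>The largest vertex norm is exactly 1, and points of norm 1 in the polytope are
  automatically vertices. Maximality of the circumradius thus becomes
  \<open>norm v = 1\<close>.\<close>

lemma maximal_primitive_simplices_eq:
  assumes "critical_covering_lattice (cball 0 1) \<Lambda>"
  shows "maximal_primitive_simplices \<Lambda> =
    (\<lambda>v. convex hull vertex_class \<Lambda> v) ` {v \<in> voronoi_polytope \<Lambda>. norm v = 1}"
proof -
  have \<Lambda>: "is_lattice \<Lambda>" "voronoi_polytope \<Lambda> \<subseteq> cball 0 1"
    using assms by (auto simp: critical_covering_lattice_def covering_cball_iff)
  obtain u where u: "u \<in> voronoi_polytope \<Lambda>" "norm u = 1"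
    using critical_lattice_unit_vertex[OF assms] .
  let ?V = "vertices (voronoi_polytope \<Lambda>)" and ?S = "\<lambda>v. convex hull vertex_class \<Lambda> v"
  have V: "v \<in> voronoi_polytope \<Lambda>" "norm v \<le> 1" if "v \<in> ?V" for v
    using that \<Lambda>(2) by (auto simp: vertices_def extreme_point_of_def)
  have uV: "v \<in> ?V" if "v \<in> voronoi_polytope \<Lambda>" "norm v = 1" for v
    using unit_norm_imp_vertex[OF \<Lambda>(2) that] .
  have "maximal_primitive_simplices \<Lambda> = {S \<in> ?S ` ?V. \<forall>S'\<in>?S ` ?V. circumradius S' \<le> circumradius S}"
    unfolding maximal_primitive_simplices_def primitive_simplices_eq[OF \<Lambda>(1)] ..
  also have "\<dots> = ?S ` {v \<in> ?V. \<forall>w\<in>?V. norm w \<le> norm v}"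
  proof -
    have "(\<forall>w\<in>?V. circumradius (?S w) \<le> circumradius (?S v)) \<longleftrightarrow> (\<forall>w\<in>?V. norm w \<le> norm v)" if "v \<in> ?V" for v
      using that by (simp add: circumradius_vertex_class[OF \<Lambda>(1)])
    then show ?thesis
      by auto
  qed
  also have "{v \<in> ?V. \<forall>w\<in>?V. norm w \<le> norm v} = {v \<in> voronoi_polytope \<Lambda>. norm v = 1}"
  proof (intro subset_antisym subsetI CollectI conjI)
    fix v assume v: "v \<in> {v \<in> ?V. \<forall>w\<in>?V. norm w \<le> norm v}"
    show "v \<in> voronoi_polytope \<Lambda>"
      using v V by simp
    have "norm u \<le> norm v" "norm v \<le> 1"
      using v uV[OF u] V by blast+
    then show "norm v = 1"
      using u by simp
  next
    fix v assume v: "v \<in> {v \<in> voronoi_polytope \<Lambda>. norm v = 1}"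
    show "v \<in> ?V"
      using v uV by simp
    show "\<forall>w\<in>?V. norm w \<le> norm v"
      using v V(2) by simp
  qed
  finally show ?thesis .
qed

lemma finite_maximal_primitive_simplices:
  assumes "critical_covering_lattice (cball 0 1) \<Lambda>"
  shows "finite (maximal_primitive_simplices \<Lambda>)"
proof -
  have \<Lambda>: "is_lattice \<Lambda>" "voronoi_polytope \<Lambda> \<subseteq> cball 0 1"
    using assms by (auto simp: critical_covering_lattice_def covering_cball_iff)
  have "{v \<in> voronoi_polytope \<Lambda>. norm v = 1} \<subseteq> vertices (voronoi_polytope \<Lambda>)"
    using unit_norm_imp_vertex[OF \<Lambda>(2)] by blast
  then show ?thesis
    unfolding maximal_primitive_simplices_eq[OF assms]
    using finite_vertices_voronoi[OF \<Lambda>] finite_subset by blast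
qed

section \<open>Symmetry of the family and positivity at unit vertices\<close>

lemma uminus_convex_hull: "uminus ` (convex hull S) = convex hull (uminus ` S)"
  for S :: "'a::real_vector set"
  by (rule convex_hull_linear_image) (simp add: linear_uminus)

lemma symmetric_maximal_primitive_simplices:
  assumes "critical_covering_lattice (cball 0 1) \<Lambda>"
  shows "symmetric_family (maximal_primitive_simplices \<Lambda>)"
proof -
  have \<Lambda>: "is_lattice \<Lambda>"
    using assms by (auto simp: critical_covering_lattice_def covering_cball_iff)
  let ?X = "maximal_primitive_simplices \<Lambda>"
  have sub: "uminus ` S \<in> ?X" if S: "S \<in> ?X" for S
  proof -
    obtain v where v: "v \<in> voronoi_polytope \<Lambda>" "norm v = 1" "S = convex hull vertex_class \<Lambda> v"
      using S unfolding maximal_primitive_simplices_eq[OF assms] by blast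
    have "uminus ` S = convex hull vertex_class \<Lambda> (- v)"
      unfolding v(3) uminus_convex_hull vertex_class_uminus[OF \<Lambda>] ..
    then show ?thesis
      unfolding maximal_primitive_simplices_eq[OF assms]
      using v voronoi_polytope_uminus[OF \<Lambda>] by (auto intro!: image_eqI[where x = "- v"])
  qed
  have "S \<in> ?X" if "uminus ` S \<in> ?X" for S
    using sub[OF that] by (simp add: image_image)
  then show ?thesis
    unfolding symmetric_family_def using sub by blast
qed

lemma uminus_image_involutive: "uminus ` uminus ` A = A" for A :: "'a::ab_group_add set"
  by (simp add: image_image)

lemma symmetric_family_remove:
  assumes "symmetric_family X"
  shows "symmetric_family (X - {S, uminus ` S})"
  unfolding symmetric_family_def
proof
  fix A
  have "A \<in> X \<longleftrightarrow> uminus ` A \<in> X"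
    using assms by (simp only: symmetric_family_def)
  moreover have "A = S \<longleftrightarrow> uminus ` A = uminus ` S" "A = uminus ` S \<longleftrightarrow> uminus ` A = S"
    using uminus_image_involutive[of A] uminus_image_involutive[of S] by metis+
  ultimately show "A \<in> X - {S, uminus ` S} \<longleftrightarrow> uminus ` A \<in> X - {S, uminus ` S}"
    by blast
qed

lemma norm_add_scaleR_sq:
  fixes a y :: "'a::real_inner"
  shows "(norm (a + s *\<^sub>R y))\<^sup>2 = (norm a)\<^sup>2 + 2 * s * (y \<bullet> a) + s\<^sup>2 * (norm y)\<^sup>2"
  unfolding power2_norm_eq_inner by (simp add: inner_simps inner_commute algebra_simps power2_eq_square)

text \<open>A point of norm 1 is farthest from the lattice, so no direction leads away from all its
  nearest lattice points.\<close>

lemma unit_vertex_positivity: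
  fixes \<Lambda> :: "(real^'n) set"
  assumes "is_lattice \<Lambda>" "voronoi_polytope \<Lambda> \<subseteq> cball 0 1" "v \<in> voronoi_polytope \<Lambda>" "norm v = 1"
    and y: "\<And>w. w \<in> vertex_class \<Lambda> v \<Longrightarrow> y \<bullet> w \<ge> 0"
  shows "y = 0"
proof (rule ccontr)
  assume "y \<noteq> 0"
  define x where "x = (\<lambda>k. v + inverse (real (Suc k)) *\<^sub>R y)"
  have x: "x \<longlonglongrightarrow> v"
    unfolding x_def by (rule tendsto_eq_intros LIMSEQ_inverse_real_of_nat refl | simp)+
  have "\<forall>k. \<exists>l\<in>\<Lambda>. norm (x k - l) \<le> 1"
    using assms(1,2) voronoi_polytope_subset_cball_iff by blast
  then obtain l where l: "\<And>k. l k \<in> \<Lambda>" "\<And>k. norm (x k - l k) \<le> 1"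
    by metis
  obtain C where C: "\<And>k. norm (x k) \<le> C"
    using convergent_imp_Bseq[OF convergentI[OF x]] unfolding Bseq_def by blast
  have bd: "norm ((mat 1 :: real^'n^'n) *v l k) \<le> C + 1" for k
    using norm_triangle_ineq4[of "x k" "x k - l k"] l(2)[of k] C[of k] by simp
  obtain l\<^sub>0 and r :: "nat \<Rightarrow> nat" where l0: "l\<^sub>0 \<in> \<Lambda>" "strict_mono r" "\<And>k. l (r k) = l\<^sub>0"
    using constant_lattice_subsequence[where l = l, OF assms(1) tendsto_const l(1) bd] that by metis
  have "(\<lambda>k. norm (x (r k) - l\<^sub>0)) \<longlonglongrightarrow> norm (v - l\<^sub>0)"
    using LIMSEQ_subseq_LIMSEQ[OF x l0(2)] by (intro tendsto_intros) (simp add: o_def)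
  moreover have le: "norm (x (r k) - l\<^sub>0) \<le> 1" for k
    using l(2)[of "r k"] l0(3) by simp
  ultimately have "norm (v - l\<^sub>0) \<le> 1"
    by (intro tendsto_upperbound) auto
  moreover have "norm v \<le> norm (v - l\<^sub>0)"
    using assms(3) l0(1) by (simp add: voronoi_polytope_def)
  ultimately have n: "norm (v - l\<^sub>0) = 1"
    using assms(4) by simp
  then have "v - l\<^sub>0 \<in> vertex_class \<Lambda> v"
    using l0(1) assms(4) by (intro vertex_class_memI) simp_all
  then have "y \<bullet> (v - l\<^sub>0) \<ge> 0"
    by (rule y)
  define s where "s = inverse (real (Suc (r 0)))"
  have "s > 0"
    by (simp add: s_def)
  have "x (r 0) - l\<^sub>0 = (v - l\<^sub>0) + s *\<^sub>R y"
    by (simp add: x_def s_def)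
  \<comment> \<open>To first order the step along \<open>y\<close> does not shorten the distance,
    and the second-order term lengthens it strictly; yet the point is still within distance
    1.\<close>
  then have "(norm (x (r 0) - l\<^sub>0))\<^sup>2 = 1 + 2 * s * (y \<bullet> (v - l\<^sub>0)) + s\<^sup>2 * (norm y)\<^sup>2"
    using n by (simp only: norm_add_scaleR_sq) simp
  moreover have "s\<^sup>2 * (norm y)\<^sup>2 > 0" "2 * s * (y \<bullet> (v - l\<^sub>0)) \<ge> 0"
    using \<open>y \<bullet> (v - l\<^sub>0) \<ge> 0\<close> \<open>s > 0\<close> \<open>y \<noteq> 0\<close> by simp_all
  moreover have "(norm (x (r 0) - l\<^sub>0))\<^sup>2 \<le> 1"
    using le[of 0] by (simp add: power_le_one)
  ultimately show False
    by linarith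
qed

text \<open>A hyperplane separating 0 from the hull would have a normal excluded by
  \<open>unit_vertex_positivity\<close>. This is the source of the nonnegative barycentric
  weights.\<close>

lemma zero_in_convex_hull_vertex_class:
  assumes "is_lattice \<Lambda>" "voronoi_polytope \<Lambda> \<subseteq> cball 0 1" "v \<in> voronoi_polytope \<Lambda>" "norm v = 1"
  shows "0 \<in> convex hull vertex_class \<Lambda> v"
proof (rule ccontr)
  assume *: "0 \<notin> convex hull vertex_class \<Lambda> v"
  have "closed (convex hull vertex_class \<Lambda> v)"
    using finite_vertex_class[OF assms(1)] by (intro compact_imp_closed compact_convex_hull finite_imp_compact)
  then obtain a b where ab: "b > 0" "\<And>x. x \<in> convex hull vertex_class \<Lambda> v \<Longrightarrow> a \<bullet> x > b"
    using separating_hyperplane_closed_0[OF convex_convex_hull _ *] by metis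
  have "a = 0"
  proof (rule unit_vertex_positivity[OF assms])
    fix w assume "w \<in> vertex_class \<Lambda> v"
    then show "a \<bullet> w \<ge> 0"
      using ab(1) ab(2)[OF hull_inc, of w] by simp
  qed
  then show False
    using ab(1) ab(2)[OF hull_inc[OF vertex_class_self[OF assms(1)]]] by simp
qed

subsection \<open>Stability of vertices\<close>

text \<open>The face of \<open>P\<close> that corresponds to a vertex \<open>w\<close> of
  \<open>Q\<close> is compact and has an extreme point \<open>v\<close>. Monotonicity squeezes the
  image of \<open>{v}\<close> between the empty face and \<open>{w}\<close>, so the vertices of
  \<open>P\<close> map onto those of \<open>Q\<close>.\<close>

lemma card_vertices_le:
  assumes "compact P" "convex P" "finite (vertices P)" "same_combinatorial_type P Q"
  shows "finite (vertices Q)" "card (vertices Q) \<le> card (vertices P)"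
proof -
  obtain \<phi> where \<phi>: "bij_betw \<phi> {F. F face_of P} {G. G face_of Q}"
    and mono: "\<And>F F'. F face_of P \<Longrightarrow> F' face_of P \<Longrightarrow> \<phi> F \<subseteq> \<phi> F' \<longleftrightarrow> F \<subseteq> F'"
    using assms(4) unfolding same_combinatorial_type_def by blast
  have inv: "\<exists>F. F face_of P \<and> \<phi> F = G" if "G face_of Q" for G
    using \<phi> that unfolding bij_betw_def by (metis (mono_tags, lifting) imageE mem_Collect_eq)
  have "vertices Q \<subseteq> (\<lambda>v. the_elem (\<phi> {v})) ` vertices P"
  proof
    fix w assume w: "w \<in> vertices Q"
    then obtain F where F: "F face_of P" "\<phi> F = {w}"
      using inv face_of_singleton by (metis mem_Collect_eq vertices_def)
    obtain E where E: "E face_of P" "\<phi> E = {}"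
      using inv empty_face_of by metis
    have "F \<noteq> {}"
      using mono[of F E] E F by auto
    moreover have "compact F" "convex F"
      using F(1) assms(1,2) face_of_imp_compact face_of_imp_convex by auto
    ultimately obtain v where v: "v extreme_point_of F"
      using extreme_point_exists_convex by blast
    then have vP: "v extreme_point_of P" "v \<in> F"
      using extreme_point_of_face[OF F(1)] by auto
    then have vf: "{v} face_of P"
      by (simp add: face_of_singleton)
    have "\<phi> {v} \<subseteq> {w}"
      using mono[OF vf F(1)] F(2) vP(2) by simp
    \<comment> \<open>The face sent to the empty set lies below every face, hence is itself
      empty.\<close>
    moreover have "\<phi> {v} \<noteq> {}"
      using mono[OF vf E(1)] mono[OF empty_face_of vf] mono[OF empty_face_of E(1)] mono[OF E(1) empty_face_of] E(2) by auto
    ultimately have "\<phi> {v} = {w}"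
      by blast
    then have "the_elem (\<phi> {v}) = w"
      by simp
    then show "w \<in> (\<lambda>v. the_elem (\<phi> {v})) ` vertices P"
      using vP(1) by (force simp: vertices_def)
  qed
  then show "finite (vertices Q)" "card (vertices Q) \<le> card (vertices P)"
    using assms(3) by (auto intro: finite_surj surj_card_le)
qed

lemma frequently_subsequence:
  assumes "\<exists>\<^sub>F k in sequentially. Q k"
  obtains r :: "nat \<Rightarrow> nat" where "strict_mono r" "\<And>k. Q (r k)"
proof -
  have "infinite {k. Q k}"
    using assms unfolding frequently_cofinite[symmetric] cofinite_eq_sequentially .
  from infinite_enumerate[OF this] obtain r :: "nat \<Rightarrow> nat" where "strict_mono r" "\<forall>k. r k \<in> {k. Q k}"
    by auto
  then show thesis
    by (intro that[of r]) auto
qed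

text \<open>The maximisers form a face, and an extreme point of a face is extreme in the whole
  set.\<close>

lemma extreme_point_maximizer:
  fixes F :: "'a::euclidean_space set"
  assumes "compact F" "convex F" "F \<noteq> {}"
  obtains w where "w extreme_point_of F" "\<And>x. x \<in> F \<Longrightarrow> a \<bullet> x \<le> a \<bullet> w"
proof -
  have "continuous_on F (\<lambda>x. a \<bullet> x)"
    by (intro continuous_intros)
  from continuous_attains_sup[OF assms(1,3) this]
  obtain z where z: "z \<in> F" "\<And>x. x \<in> F \<Longrightarrow> a \<bullet> x \<le> a \<bullet> z"
    by blast
  let ?G = "F \<inter> {x. a \<bullet> x = a \<bullet> z}"
  have G: "?G face_of F"
    using assms(2) z(2) by (rule face_of_Int_supporting_hyperplane_le)
  then have "compact ?G" "convex ?G"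
    using assms face_of_imp_compact face_of_imp_convex by blast+
  moreover have "?G \<noteq> {}"
    using z by blast
  ultimately obtain w where "w extreme_point_of ?G"
    using extreme_point_exists_convex by blast
  then have "w extreme_point_of F" "w \<in> ?G"
    using extreme_point_of_face[OF G] by auto
  then show thesis
    using z by (intro that[of w]) auto
qed

lemma voronoi_matrix_image_subset:
  fixes M :: "real^'n^'n"
  assumes "is_lattice \<Lambda>" "voronoi_polytope \<Lambda> \<subseteq> cball 0 1" "invertible M" "\<And>x. norm (M *v x) \<le> 2 * norm x"
  shows "voronoi_polytope ((*v) M ` \<Lambda>) \<subseteq> cball 0 2"
  unfolding voronoi_polytope_subset_cball_iff[OF is_lattice_matrix_image[OF assms(1,3)]]
proof
  fix x
  obtain l where l: "l \<in> \<Lambda>" "norm (matrix_inv M *v x - l) \<le> 1"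
    using assms(1,2) voronoi_polytope_subset_cball_iff by blast
  have "x - M *v l = M *v (matrix_inv M *v x - l)"
    using assms(3) by (simp add: matrix_vector_mult_diff_distrib matrix_inv_vector_mult)
  then have "norm (x - M *v l) \<le> 2"
    using assms(4)[of "matrix_inv M *v x - l"] l(2) by simp
  then show "\<exists>l\<in>(*v) M ` \<Lambda>. norm (x - l) \<le> 2"
    using l(1) by blast
qed

text \<open>The functional \<open>\<Sum>l\<in>contacts \<Lambda> v. l\<close> attains its maximum over the Voronoi polytope only
  at the vertex \<open>v\<close>.\<close>

lemma vertex_near:
  fixes M :: "nat \<Rightarrow> real^'n^'n"
  assumes \<Lambda>: "is_lattice \<Lambda>" "voronoi_polytope \<Lambda> \<subseteq> cball 0 1"
    and M: "M \<longlonglongrightarrow> mat 1" "\<And>k. invertible (M k)"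
    and v: "v \<in> vertices (voronoi_polytope \<Lambda>)"
    and face: "\<And>k. F k face_of voronoi_polytope ((*v) (M k) ` \<Lambda>)"
    and near: "\<And>\<delta>. \<delta> > 0 \<Longrightarrow> \<forall>\<^sub>F k in sequentially. \<exists>z\<in>F k. dist z v < \<delta>"
    and "\<delta> > 0"
  shows "\<forall>\<^sub>F k in sequentially. \<exists>w\<in>vertices (voronoi_polytope ((*v) (M k) ` \<Lambda>)) \<inter> F k. dist w v < \<delta>"
proof -
  let ?P = "\<lambda>k. voronoi_polytope ((*v) (M k) ` \<Lambda>)"
  define a where "a = (\<Sum>l\<in>contacts \<Lambda> v. l)"
  have a: "a \<bullet> x = (\<Sum>l\<in>contacts \<Lambda> v. x \<bullet> l)" for x
    unfolding a_def inner_sum_left by (rule sum.cong[OF refl inner_commute])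
  define E where "E k \<longleftrightarrow> (\<forall>x. norm (M k *v x) \<le> 2 * norm x) \<and> F k \<noteq> {}" for k
  have "\<forall>\<^sub>F k in sequentially. E k"
    using eventually_matrix_norm_bounds[OF M(1)] near[of 1] unfolding E_def
    by (auto elim: eventually_elim2)
  have "\<exists>w. w extreme_point_of F k \<and> (\<forall>x\<in>F k. a \<bullet> x \<le> a \<bullet> w)" if "E k" for k
  proof -
    have "?P k \<subseteq> cball 0 2"
      using that unfolding E_def by (intro voronoi_matrix_image_subset \<Lambda> M) auto
    then have "compact (?P k)"
      using closed_voronoi_polytope compact_eq_bounded_closed bounded_cball bounded_subset by blast
    then have "compact (F k)" "convex (F k)" "F k \<noteq> {}"
      using face[of k] face_of_imp_compact face_of_imp_convex convex_voronoi_polytope that E_def by blast+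
    then show ?thesis
      using extreme_point_maximizer by metis
  qed
  then obtain w where w: "\<And>k. E k \<Longrightarrow> w k extreme_point_of F k" "\<And>k x. E k \<Longrightarrow> x \<in> F k \<Longrightarrow> a \<bullet> x \<le> a \<bullet> w k"
    by metis
  have wP: "w k \<in> vertices (?P k) \<inter> F k" if "E k" for k
    using w(1)[OF that] extreme_point_of_face[OF face[of k]] by (simp add: vertices_def)
  have "\<forall>\<^sub>F k in sequentially. dist (w k) v < \<delta>"
  proof (rule ccontr)
    assume "\<not> ?thesis"
    then have "\<exists>\<^sub>F k in sequentially. \<not> dist (w k) v < \<delta>"
      by (simp add: not_eventually)
    then have "\<exists>\<^sub>F k in sequentially. \<not> dist (w k) v < \<delta> \<and> E k"
      by (rule frequently_rev_mp) (rule eventually_mono[OF \<open>\<forall>\<^sub>F k in sequentially. E k\<close>], simp)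
    then obtain r :: "nat \<Rightarrow> nat" where r: "strict_mono r" "\<And>k. \<not> dist (w (r k)) v < \<delta>" "\<And>k. E (r k)"
      using frequently_subsequence by (metis (no_types, lifting))
    have "w (r k) \<in> cball 0 2" for k
    proof -
      have "?P (r k) \<subseteq> cball 0 2"
        using r(3)[of k] unfolding E_def by (intro voronoi_matrix_image_subset \<Lambda> M) auto
      then show ?thesis
        using wP[OF r(3)[of k]] by (auto simp: vertices_def extreme_point_of_def)
    qed
    then obtain x and s :: "nat \<Rightarrow> nat" where x: "strict_mono s" "(w \<circ> r \<circ> s) \<longlonglongrightarrow> x"
      using compact_cball[of 0 2] unfolding compact_def by (metis (no_types, lifting) comp_apply)
    have rs: "strict_mono (r \<circ> s)"
      using r(1) x(1) by (rule strict_mono_o)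
    have lim: "(\<lambda>k. w (r (s k))) \<longlonglongrightarrow> x"
      using x(2) by (simp add: o_def)
    have "x \<in> voronoi_polytope \<Lambda>"
    proof (rule voronoi_polytope_limit[OF _ lim])
      show "(\<lambda>k. M (r (s k))) \<longlonglongrightarrow> mat 1"
        using LIMSEQ_subseq_LIMSEQ[OF M(1) rs] by (simp add: o_def)
      show "w (r (s k)) \<in> voronoi_polytope ((*v) (M (r (s k))) ` \<Lambda>)" for k
        using wP[OF r(3)[of "s k"]] by (auto simp: vertices_def extreme_point_of_def)
    qed
    \<comment> \<open>\<open>F k\<close> contains points close to \<open>v\<close>, so the maximum
      of \<open>a\<close> on \<open>F k\<close> is almost \<open>a \<bullet> v\<close>. In the limit
      \<open>x\<close> does at least as well as \<open>v\<close>.\<close>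
    have "a \<bullet> v - norm a * e \<le> a \<bullet> x" if "e > 0" for e
    proof (rule tendsto_lowerbound)
      show "(\<lambda>k. a \<bullet> w (r (s k))) \<longlonglongrightarrow> a \<bullet> x"
        by (intro tendsto_intros lim)
      have "\<forall>\<^sub>F k in sequentially. \<exists>z\<in>F (r (s k)). dist z v < e"
        using eventually_subseq[OF rs near[OF that]] by simp
      then show "\<forall>\<^sub>F k in sequentially. a \<bullet> v - norm a * e \<le> a \<bullet> w (r (s k))"
      proof eventually_elim
        case (elim k)
        then obtain z where z: "z \<in> F (r (s k))" "dist z v < e"
          by blast
        have "a \<bullet> v - a \<bullet> z \<le> norm a * norm (v - z)"
          using norm_cauchy_schwarz[of a "v - z"] by (simp add: inner_diff_right)
        also have "\<dots> \<le> norm a * e"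
          using z(2) by (intro mult_left_mono) (auto simp: dist_norm norm_minus_commute)
        finally show ?case
          using w(2)[OF r(3) z(1)] by simp
      qed
    qed simp
    then have le: "a \<bullet> v - norm a * e \<le> a \<bullet> x" if "e > 0" for e
      using that by blast
    have "a \<bullet> v \<le> a \<bullet> x"
    proof (rule field_le_epsilon)
      fix e :: real assume "e > 0"
      then have "e / (norm a + 1) > 0"
        by (simp add: add_nonneg_pos)
      moreover have "norm a * (e / (norm a + 1)) \<le> e"
      proof -
        have "norm a + 1 > 0"
          by (simp add: add_nonneg_pos)
        then show ?thesis
          using \<open>e > 0\<close> by (simp add: pos_divide_le_eq algebra_simps)
      qed
      ultimately show "a \<bullet> v \<le> a \<bullet> x + e"
        using le[of "e / (norm a + 1)"] by linarith
    qed
    have cl: "x \<bullet> l \<le> v \<bullet> l" if "l \<in> contacts \<Lambda> v" for l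
      using \<open>x \<in> voronoi_polytope \<Lambda>\<close> that by (auto simp: contacts_def mem_voronoi_polytope)
    \<comment> \<open>No contact functional is larger at \<open>x\<close> than at \<open>v\<close>,
      so equality of the sums forces equality of every term.\<close>
    have "(v - x) \<bullet> l = 0" if l: "l \<in> contacts \<Lambda> v" for l
    proof -
      have "(\<Sum>l\<in>contacts \<Lambda> v. (v - x) \<bullet> l) = a \<bullet> v - a \<bullet> x"
        by (simp add: a inner_diff_left sum_subtractf)
      then have "(\<Sum>l\<in>contacts \<Lambda> v. (v - x) \<bullet> l) = 0"
        using \<open>a \<bullet> v \<le> a \<bullet> x\<close> sum_nonneg[of "contacts \<Lambda> v" "\<lambda>l. (v - x) \<bullet> l"] cl
        by (force simp: inner_diff_left)
      then show ?thesis
        using l cl sum_nonneg_eq_0_iff[OF finite_contacts[OF \<Lambda>(1), of v], of "\<lambda>l. (v - x) \<bullet> l"]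
        by (simp add: inner_diff_left)
    qed
    then have "v - x = 0"
      using v vertex_iff_contacts[OF \<Lambda>(1)] by blast
    then have "(\<lambda>k. dist (w (r (s k))) v) \<longlonglongrightarrow> 0"
      using lim by (simp add: tendsto_dist_iff[symmetric])
    then have "\<forall>\<^sub>F k in sequentially. dist (w (r (s k))) v < \<delta>"
      using \<open>\<delta> > 0\<close> by (rule order_tendstoD)
    then show False
      using r(2) by simp
  qed
  then show ?thesis
    using \<open>\<forall>\<^sub>F k in sequentially. E k\<close> by eventually_elim (use wP in blast)
qed

text \<open>Shrinking \<open>v\<close> towards the origin makes the inequalities for all nonzero
  lattice vectors strict, and strict inequalities survive the perturbation.\<close>

lemma voronoi_point_near:
  fixes M :: "nat \<Rightarrow> real^'n^'n"
  assumes \<Lambda>: "is_lattice \<Lambda>" and M: "M \<longlonglongrightarrow> mat 1" and v: "v \<in> voronoi_polytope \<Lambda>" and "\<delta> > 0"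
  shows "\<forall>\<^sub>F k in sequentially. \<exists>z\<in>voronoi_polytope ((*v) (M k) ` \<Lambda>). dist z v < \<delta>"
proof -
  \<comment> \<open>With this factor the distance moved is
    \<open>\<delta> * norm v / (\<delta> + norm v)\<close>, which is below \<open>\<delta>\<close>
    even for \<open>v = 0\<close>.\<close>
  define s where "s = 1 - \<delta> / (\<delta> + norm v)"
  have "\<delta> / (\<delta> + norm v) > 0" "\<delta> / (\<delta> + norm v) \<le> 1"
    using \<open>\<delta> > 0\<close> norm_ge_zero[of v] by (simp_all add: add_pos_nonneg)
  then have s: "0 \<le> s" "s < 1"
    by (simp_all add: s_def)
  have "s *\<^sub>R v - v = - ((\<delta> / (\<delta> + norm v)) *\<^sub>R v)"
    by (simp add: s_def algebra_simps)
  then have "dist (s *\<^sub>R v) v = \<delta> / (\<delta> + norm v) * norm v"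
    using \<open>\<delta> / (\<delta> + norm v) > 0\<close> by (simp only: dist_norm norm_minus_cancel norm_scaleR abs_of_pos)
  also have "\<dots> < \<delta>"
    using \<open>\<delta> > 0\<close> norm_ge_zero[of v] by (simp add: divide_less_eq add_pos_nonneg algebra_simps)
  finally have d: "dist (s *\<^sub>R v) v < \<delta>" .
  have strict: "2 * (s *\<^sub>R v \<bullet> l) < l \<bullet> l" if "l \<in> \<Lambda>" "l \<noteq> 0" for l
  proof (cases "v \<bullet> l > 0")
    case True
    have "2 * (s *\<^sub>R v \<bullet> l) = s * (2 * (v \<bullet> l))"
      by simp
    also have "\<dots> < 1 * (2 * (v \<bullet> l))"
      using True s by (intro mult_strict_right_mono) auto
    also have "\<dots> \<le> l \<bullet> l"
      using v that by (simp add: mem_voronoi_polytope)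
    finally show ?thesis .
  next
    case False
    then have "2 * (s *\<^sub>R v \<bullet> l) \<le> 0"
      using s by (simp add: mult_nonneg_nonpos)
    also have "0 < l \<bullet> l"
      using that by simp
    finally show ?thesis .
  qed
  have "\<forall>\<^sub>F k in sequentially. \<forall>l\<in>\<Lambda>. 2 * (s *\<^sub>R v \<bullet> l) < l \<bullet> l \<longrightarrow> 2 * (s *\<^sub>R v \<bullet> (M k *v l)) < (M k *v l) \<bullet> (M k *v l)"
    by (rule voronoi_eventually_strict[OF \<Lambda> M]) simp
  then show ?thesis
  proof eventually_elim
    case (elim k)
    have "s *\<^sub>R v \<in> voronoi_polytope ((*v) (M k) ` \<Lambda>)"
      unfolding mem_voronoi_polytope
    proof (intro ballI, elim imageE)
      fix x l assume l: "x = M k *v l" "l \<in> \<Lambda>"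
      show "2 * (s *\<^sub>R v \<bullet> x) \<le> x \<bullet> x"
        using elim strict l by (cases "l = 0") (force simp: less_imp_le)+
    qed
    then show ?case
      using d by blast
  qed
qed

text \<open>A short step from \<open>v\<close> along \<open>y\<close> reaches a point on the
  hyperplane of \<open>e\<close> where every other nonzero constraint is strict. A small correction
  puts it on the perturbed hyperplane without spoiling the strict inequalities.\<close>

lemma facet_point_near:
  fixes M :: "nat \<Rightarrow> real^'n^'n"
  assumes \<Lambda>: "is_lattice \<Lambda>" and M: "M \<longlonglongrightarrow> mat 1" "\<And>k. invertible (M k)"
    and v: "v \<in> voronoi_polytope \<Lambda>" and "\<delta> > 0"
    and e: "e \<in> contacts \<Lambda> v" "e \<noteq> 0"
    and y: "y \<bullet> e = 0" "\<And>l. l \<in> contacts \<Lambda> v \<Longrightarrow> l \<noteq> 0 \<Longrightarrow> l \<noteq> e \<Longrightarrow> y \<bullet> l < 0"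
  shows "\<forall>\<^sub>F k in sequentially. \<exists>z\<in>voronoi_polytope ((*v) (M k) ` \<Lambda>) \<inter> {x. (M k *v e) \<bullet> x = ((M k *v e) \<bullet> (M k *v e)) / 2}. dist z v < \<delta>"
proof -
  have lim: "(\<lambda>k. v + inverse (real (Suc k)) *\<^sub>R y) \<longlonglongrightarrow> v"
    by (rule tendsto_eq_intros LIMSEQ_inverse_real_of_nat refl | simp)+
  have "\<forall>\<^sub>F k in sequentially. \<forall>l\<in>\<Lambda>. 2 * (v \<bullet> l) < l \<bullet> l \<longrightarrow>
      2 * ((v + inverse (real (Suc k)) *\<^sub>R y) \<bullet> (mat 1 *v l)) < (mat 1 *v l) \<bullet> (mat 1 *v l)"
    by (rule voronoi_eventually_strict[OF \<Lambda> tendsto_const lim])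
  moreover have "\<forall>\<^sub>F k in sequentially. dist (v + inverse (real (Suc k)) *\<^sub>R y) v < \<delta>"
    using lim \<open>\<delta> > 0\<close> by (rule tendstoD)
  ultimately have "\<forall>\<^sub>F k in sequentially. (\<forall>l\<in>\<Lambda>. 2 * (v \<bullet> l) < l \<bullet> l \<longrightarrow>
      2 * ((v + inverse (real (Suc k)) *\<^sub>R y) \<bullet> (mat 1 *v l)) < (mat 1 *v l) \<bullet> (mat 1 *v l)) \<and>
      dist (v + inverse (real (Suc k)) *\<^sub>R y) v < \<delta>"
    by (rule eventually_conj)
  then obtain k0 where k0: "\<forall>l\<in>\<Lambda>. 2 * (v \<bullet> l) < l \<bullet> l \<longrightarrow>
      2 * ((v + inverse (real (Suc k0)) *\<^sub>R y) \<bullet> (mat 1 *v l)) < (mat 1 *v l) \<bullet> (mat 1 *v l)"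
      "dist (v + inverse (real (Suc k0)) *\<^sub>R y) v < \<delta>"
    unfolding eventually_sequentially by blast
  define s where "s = inverse (real (Suc k0))"
  define u where "u = v + s *\<^sub>R y"
  have "s > 0"
    by (simp add: s_def)
  have ue: "2 * (u \<bullet> e) = e \<bullet> e"
    using e y(1) by (simp add: u_def inner_add_left contacts_def)
  have ul: "2 * (u \<bullet> l) < l \<bullet> l" if l: "l \<in> \<Lambda>" "l \<noteq> 0" "l \<noteq> e" for l
  proof (cases "l \<in> contacts \<Lambda> v")
    case True
    have "s * (y \<bullet> l) < 0"
      using y(2)[OF True l(2,3)] \<open>s > 0\<close> by (simp add: mult_pos_neg)
    moreover have "2 * (v \<bullet> l) = l \<bullet> l"
      using True by (simp add: contacts_def)
    ultimately show ?thesis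
      by (simp add: u_def inner_add_left)
  next
    case False
    then have "2 * (v \<bullet> l) < l \<bullet> l"
      using v l by (force simp: contacts_def mem_voronoi_polytope)
    then show ?thesis
      using k0(1) l by (simp add: u_def s_def)
  qed
  \<comment> \<open>The multiple of \<open>M k *v e\<close> that restores the contact equation for
    the perturbed \<open>e\<close>; it tends to 0 because \<open>u\<close> satisfies the unperturbed
    one.\<close>
  define \<beta> where "\<beta> k = (((M k *v e) \<bullet> (M k *v e)) / 2 - u \<bullet> (M k *v e)) / ((M k *v e) \<bullet> (M k *v e))" for k
  define x where "x k = u + \<beta> k *\<^sub>R (M k *v e)" for k
  have Me: "(\<lambda>k. M k *v e) \<longlonglongrightarrow> e"
    using tendsto_matrix_vector_mult[OF M(1) tendsto_const[of e]] by simp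
  have "\<beta> \<longlonglongrightarrow> ((e \<bullet> e) / 2 - u \<bullet> e) / (e \<bullet> e)"
    unfolding \<beta>_def by (intro tendsto_intros Me) (use e in auto)
  moreover have "(e \<bullet> e) / 2 - u \<bullet> e = 0"
    using ue by simp
  ultimately have "\<beta> \<longlonglongrightarrow> 0"
    by (simp only: div_0)
  then have "x \<longlonglongrightarrow> u + 0 *\<^sub>R e"
    unfolding x_def by (intro tendsto_intros Me)
  then have xu: "x \<longlonglongrightarrow> u"
    by simp
  have "\<forall>\<^sub>F k in sequentially. dist (x k) u < \<delta> - dist u v"
    using xu k0(2) by (intro tendstoD) (simp_all add: u_def s_def)
  moreover have "\<forall>\<^sub>F k in sequentially. \<forall>l\<in>\<Lambda>. 2 * (u \<bullet> l) < l \<bullet> l \<longrightarrow> 2 * (x k \<bullet> (M k *v l)) < (M k *v l) \<bullet> (M k *v l)"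
    by (rule voronoi_eventually_strict[OF \<Lambda> M(1) xu])
  ultimately show ?thesis
  proof eventually_elim
    case (elim k)
    have "M k *v e \<noteq> 0"
      using matrix_inv_vector_mult(1)[OF M(2), of k e] e(2) by auto
    then have xe: "2 * (x k \<bullet> (M k *v e)) = (M k *v e) \<bullet> (M k *v e)"
      by (simp add: x_def \<beta>_def inner_add_left)
    have "x k \<in> voronoi_polytope ((*v) (M k) ` \<Lambda>)"
      unfolding mem_voronoi_polytope
    proof (intro ballI, elim imageE)
      fix z l assume l: "z = M k *v l" "l \<in> \<Lambda>"
      consider "l = 0" | "l = e" | "l \<noteq> 0" "l \<noteq> e"
        by blast
      then show "2 * (x k \<bullet> z) \<le> z \<bullet> z"
      proof cases
        case 3
        then have "2 * (x k \<bullet> (M k *v l)) < (M k *v l) \<bullet> (M k *v l)"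
          using elim(2) ul l by blast
        then show ?thesis
          using l by simp
      qed (use l xe in simp_all)
    qed
    moreover have "(M k *v e) \<bullet> x k = ((M k *v e) \<bullet> (M k *v e)) / 2"
      using xe by (simp add: inner_commute)
    moreover have "dist (x k) v < \<delta>"
      using elim(1) dist_triangle[of "x k" v u] by simp
    ultimately show ?case
      by blast
  qed
qed

text \<open>Pigeonhole: every old vertex has a new one nearby, these are distinct, and the common
  combinatorial type permits no further ones.\<close>

lemma simple_lattice_unique_vertex_near:
  fixes M :: "nat \<Rightarrow> real^'n^'n"
  assumes \<Lambda>: "is_lattice \<Lambda>" "voronoi_polytope \<Lambda> \<subseteq> cball 0 1" "simple_lattice \<Lambda>"
    and M: "M \<longlonglongrightarrow> mat 1" "\<And>k. invertible (M k)"
    and v: "v \<in> vertices (voronoi_polytope \<Lambda>)"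
  obtains \<delta> where "\<delta> > 0" "\<forall>\<^sub>F k in sequentially. \<forall>w\<in>vertices (voronoi_polytope ((*v) (M k) ` \<Lambda>)).
    \<forall>w'\<in>vertices (voronoi_polytope ((*v) (M k) ` \<Lambda>)). dist w v < \<delta> \<longrightarrow> dist w' v < \<delta> \<longrightarrow> w = w'"
proof -
  let ?V = "vertices (voronoi_polytope \<Lambda>)" and ?P = "\<lambda>k. voronoi_polytope ((*v) (M k) ` \<Lambda>)"
  have fin: "finite ?V"
    using finite_vertices_voronoi[OF \<Lambda>(1,2)] .
  have "\<forall>u\<in>?V. \<exists>d>0. \<forall>x\<in>?V. x \<noteq> u \<longrightarrow> d \<le> dist u x"
    using finite_set_avoid[OF fin] by blast
  then obtain d where d: "\<And>u. u \<in> ?V \<Longrightarrow> d u > 0" "\<And>u x. u \<in> ?V \<Longrightarrow> x \<in> ?V \<Longrightarrow> x \<noteq> u \<Longrightarrow> d u \<le> dist u x"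
    by metis
  \<comment> \<open>Half the minimal separation, so that one point cannot be within
    \<open>\<delta>\<close> of two old vertices.\<close>
  define \<delta> where "\<delta> = Min (d ` ?V) / 2"
  have "Min (d ` ?V) > 0"
    using fin v d by (subst Min_gr_iff) auto
  then have "\<delta> > 0"
    by (simp add: \<delta>_def)
  have sep: "u = x" if "u \<in> ?V" "x \<in> ?V" "dist u x < 2 * \<delta>" for u x
  proof (rule ccontr)
    assume "u \<noteq> x"
    then have "d u \<le> dist u x"
      using d(2)[OF that(1,2)] by simp
    moreover have "Min (d ` ?V) \<le> d u"
      using fin that(1) by (intro Min_le) auto
    ultimately show False
      using that(3) by (simp add: \<delta>_def)
  qed
  obtain T \<epsilon> where T: "\<epsilon> > 0" "\<Lambda> = lattice_of T"
    "\<And>T'. invertible T' \<Longrightarrow> norm (T - T') < \<epsilon> \<Longrightarrow> same_combinatorial_type (voronoi_polytope \<Lambda>) (voronoi_polytope (lattice_of T'))"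
    and "invertible T"
    using \<Lambda>(3) unfolding simple_lattice_def by blast
  have "(\<lambda>k. M k ** T) \<longlonglongrightarrow> mat 1 ** T"
    by (rule tendsto_matrix_matrix_mult_right[OF M(1)])
  then have "\<forall>\<^sub>F k in sequentially. dist (M k ** T) T < \<epsilon>"
    using T(1) by (intro tendstoD) simp_all
  then have type: "\<forall>\<^sub>F k in sequentially. same_combinatorial_type (voronoi_polytope \<Lambda>) (?P k)"
  proof eventually_elim
    case (elim k)
    have "same_combinatorial_type (voronoi_polytope \<Lambda>) (voronoi_polytope (lattice_of (M k ** T)))"
      using elim M(2) \<open>invertible T\<close>
      by (intro T(3)) (simp_all add: invertible_matrix_mult dist_norm norm_minus_commute)
    then show ?case
      by (simp add: lattice_of_matrix_mult T(2))
  qed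
  have ex: "\<forall>\<^sub>F k in sequentially. \<forall>u\<in>?V. \<exists>w\<in>vertices (?P k). dist w u < \<delta>"
  proof (rule eventually_ball_finite[OF fin], rule ballI)
    fix u assume u: "u \<in> ?V"
    have "\<forall>\<^sub>F k in sequentially. \<exists>w\<in>vertices (?P k) \<inter> ?P k. dist w u < \<delta>"
    proof (rule vertex_near[OF \<Lambda>(1,2) M u _ _ \<open>\<delta> > 0\<close>])
      show "?P k face_of ?P k" for k
        by (simp add: face_of_refl convex_voronoi_polytope)
      show "\<forall>\<^sub>F k in sequentially. \<exists>z\<in>?P k. dist z u < \<delta>'" if "\<delta>' > 0" for \<delta>'
        using voronoi_point_near[OF \<Lambda>(1) M(1) _ that] u by (simp add: vertices_def extreme_point_of_def)
    qed
    then show "\<forall>\<^sub>F k in sequentially. \<exists>w\<in>vertices (?P k). dist w u < \<delta>"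
      by eventually_elim blast
  qed
  have cP: "compact (voronoi_polytope \<Lambda>)"
    using \<Lambda>(2) closed_voronoi_polytope compact_eq_bounded_closed bounded_cball bounded_subset by blast
  have "\<forall>\<^sub>F k in sequentially. \<forall>w\<in>vertices (?P k). \<forall>w'\<in>vertices (?P k). dist w v < \<delta> \<longrightarrow> dist w' v < \<delta> \<longrightarrow> w = w'"
    using type ex
  proof eventually_elim
    case (elim k)
    obtain f where f: "\<And>u. u \<in> ?V \<Longrightarrow> f u \<in> vertices (?P k)" "\<And>u. u \<in> ?V \<Longrightarrow> dist (f u) u < \<delta>"
      using elim(2) by metis
    note card = card_vertices_le[OF cP convex_voronoi_polytope fin elim(1)]
    have "inj_on f ?V"
    proof (rule inj_onI)
      fix u x assume ux: "u \<in> ?V" "x \<in> ?V" "f u = f x"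
      then show "u = x"
        using f(2)[of u] f(2)[of x] dist_triangle2[of u x "f u"] sep[of u x] by (simp add: dist_commute)
    qed
    then have "card (f ` ?V) = card ?V"
      by (rule card_image)
    moreover have "f ` ?V \<subseteq> vertices (?P k)"
      using f by blast
    ultimately have surj: "f ` ?V = vertices (?P k)"
      using card by (intro card_seteq) auto
    have fv: "w = f v" if w: "w \<in> vertices (?P k)" "dist w v < \<delta>" for w
    proof -
      obtain u where u: "u \<in> ?V" "w = f u"
        using w surj by blast
      then have "dist u v < 2 * \<delta>"
        using f(2)[of u] w(2) dist_triangle2[of u v "f u"] by (simp add: dist_commute)
      then show ?thesis
        using sep[OF u(1) v] u by simp
    qed
    show ?case
      using fv by blast
  qed
  then show thesis
    by (rule that[OF \<open>\<delta> > 0\<close>])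
qed

subsection \<open>The contact vectors at a vertex of a simple lattice\<close>

text \<open>The contacts whose bisecting hyperplanes carry facets through \<open>v\<close>;
  \<open>y\<close> points from \<open>v\<close> into the relative interior of the facet.\<close>

definition facet_contacts :: "(real^'n) set \<Rightarrow> real^'n \<Rightarrow> (real^'n) set" where
  "facet_contacts \<Lambda> v = {e \<in> contacts \<Lambda> v - {0}. \<exists>y. y \<bullet> e = 0 \<and> (\<forall>l\<in>contacts \<Lambda> v - {0, e}. y \<bullet> l < 0)}"

lemma facet_contacts_subset: "facet_contacts \<Lambda> v \<subseteq> contacts \<Lambda> v - {0}"
  by (auto simp: facet_contacts_def)

text \<open>The facet of each facet contact keeps a vertex near \<open>v\<close> under small perturbations, and by
  simplicity all these vertices coincide.\<close>

lemma simple_lattice_tight_point: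
  fixes M :: "nat \<Rightarrow> real^'n^'n"
  assumes \<Lambda>: "is_lattice \<Lambda>" "voronoi_polytope \<Lambda> \<subseteq> cball 0 1" "simple_lattice \<Lambda>"
    and M: "M \<longlonglongrightarrow> mat 1" "\<And>k. invertible (M k)"
    and v: "v \<in> vertices (voronoi_polytope \<Lambda>)"
  shows "\<forall>\<^sub>F k in sequentially. \<exists>w\<in>voronoi_polytope ((*v) (M k) ` \<Lambda>).
    \<forall>e\<in>facet_contacts \<Lambda> v. 2 * (w \<bullet> (M k *v e)) = (M k *v e) \<bullet> (M k *v e)"
proof -
  let ?P = "\<lambda>k. voronoi_polytope ((*v) (M k) ` \<Lambda>)"
  let ?H = "\<lambda>k e. {x. (M k *v e) \<bullet> x = ((M k *v e) \<bullet> (M k *v e)) / 2}"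
  have vP: "v \<in> voronoi_polytope \<Lambda>"
    using v by (simp add: vertices_def extreme_point_of_def)
  obtain \<delta> where \<delta>: "\<delta> > 0" and uniq: "\<forall>\<^sub>F k in sequentially. \<forall>w\<in>vertices (?P k). \<forall>w'\<in>vertices (?P k).
      dist w v < \<delta> \<longrightarrow> dist w' v < \<delta> \<longrightarrow> w = w'"
    using simple_lattice_unique_vertex_near[OF \<Lambda> M v] by blast
  have ex: "\<forall>\<^sub>F k in sequentially. \<exists>w\<in>vertices (?P k) \<inter> ?P k. dist w v < \<delta>"
  proof (rule vertex_near[OF \<Lambda>(1,2) M v _ _ \<delta>])
    show "?P k face_of ?P k" for k
      by (simp add: face_of_refl convex_voronoi_polytope)
    show "\<forall>\<^sub>F k in sequentially. \<exists>z\<in>?P k. dist z v < \<delta>'" if "\<delta>' > 0" for \<delta>'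
      by (rule voronoi_point_near[OF \<Lambda>(1) M(1) vP that])
  qed
  have facet: "\<forall>\<^sub>F k in sequentially. \<forall>e\<in>facet_contacts \<Lambda> v. \<exists>w\<in>vertices (?P k) \<inter> (?P k \<inter> ?H k e). dist w v < \<delta>"
  proof (rule eventually_ball_finite)
    show "finite (facet_contacts \<Lambda> v)"
      using finite_contacts[OF \<Lambda>(1)] facet_contacts_subset by (meson finite_Diff finite_subset)
    show "\<forall>e\<in>facet_contacts \<Lambda> v. \<forall>\<^sub>F k in sequentially. \<exists>w\<in>vertices (?P k) \<inter> (?P k \<inter> ?H k e). dist w v < \<delta>"
    proof
      fix e assume e: "e \<in> facet_contacts \<Lambda> v"
      then obtain y where y: "y \<bullet> e = 0" "\<And>l. l \<in> contacts \<Lambda> v \<Longrightarrow> l \<noteq> 0 \<Longrightarrow> l \<noteq> e \<Longrightarrow> y \<bullet> l < 0"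
        and e': "e \<in> contacts \<Lambda> v" "e \<noteq> 0"
        unfolding facet_contacts_def by blast
      show "\<forall>\<^sub>F k in sequentially. \<exists>w\<in>vertices (?P k) \<inter> (?P k \<inter> ?H k e). dist w v < \<delta>"
      proof (rule vertex_near[OF \<Lambda>(1,2) M v _ _ \<delta>])
        show "?P k \<inter> ?H k e face_of ?P k" for k
        proof (rule face_of_Int_supporting_hyperplane_le[OF convex_voronoi_polytope])
          fix x assume "x \<in> ?P k"
          moreover have "M k *v e \<in> (*v) (M k) ` \<Lambda>"
            using e' by (simp add: contacts_def)
          ultimately have "2 * (x \<bullet> (M k *v e)) \<le> (M k *v e) \<bullet> (M k *v e)"
            unfolding mem_voronoi_polytope by blast
          then show "(M k *v e) \<bullet> x \<le> ((M k *v e) \<bullet> (M k *v e)) / 2"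
            by (simp add: inner_commute)
        qed
        show "\<forall>\<^sub>F k in sequentially. \<exists>z\<in>?P k \<inter> ?H k e. dist z v < \<delta>'" if "\<delta>' > 0" for \<delta>'
          by (rule facet_point_near[OF \<Lambda>(1) M vP that e' y])
      qed
    qed
  qed
  show ?thesis
    using uniq ex facet
  proof eventually_elim
    case (elim k)
    obtain w where w: "w \<in> vertices (?P k)" "w \<in> ?P k" "dist w v < \<delta>"
      using elim(2) by blast
    have "2 * (w \<bullet> (M k *v e)) = (M k *v e) \<bullet> (M k *v e)" if "e \<in> facet_contacts \<Lambda> v" for e
    proof -
      from bspec[OF elim(3) that]
      obtain w' where w': "w' \<in> vertices (?P k)" "w' \<in> ?H k e" "dist w' v < \<delta>"
        by (elim bexE IntE)
      have "w' = w"
        using bspec[OF bspec[OF elim(1) w'(1)] w(1)] w(3) w'(3) by simp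
      then show ?thesis
        using w'(2) by (simp add: inner_commute)
    qed
    then show ?case
      using w(2) by (intro bexI[of _ w]) simp_all
  qed
qed

lemma eventually_invertible_near_identity:
  fixes M :: "nat \<Rightarrow> real^'n^'n"
  assumes "M \<longlonglongrightarrow> mat 1"
  shows "\<forall>\<^sub>F k in sequentially. invertible (M k)"
proof -
  have "(\<lambda>k. det (M k)) \<longlonglongrightarrow> det (mat 1 :: real^'n^'n)"
    by (rule tendsto_det[OF assms])
  then have "\<forall>\<^sub>F k in sequentially. det (M k) > 0"
    by (rule order_tendstoD) simp
  then show ?thesis
    by eventually_elim (simp add: invertible_det_nz)
qed

lemma identity_plus_mult:
  fixes N :: "real^'n^'n"
  shows "(mat 1 + t *\<^sub>R N) *v x = x + t *\<^sub>R (N *v x)"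
  by (simp add: matrix_vector_mult_add_rdistrib flip: scaleR_matrix_vector_assoc)

lemma inner_add_scaleR_self:
  fixes a y :: "'a::real_inner"
  shows "(a + s *\<^sub>R y) \<bullet> (a + s *\<^sub>R y) = a \<bullet> a + s * (2 * (y \<bullet> a) + s * (y \<bullet> y))"
  by (simp add: inner_simps inner_commute algebra_simps)

text \<open>The tight point turns the equations for \<open>B\<close> into a value for
  \<open>d\<close>, by linearity, and the Voronoi inequality for \<open>d\<close> bounds this value.
  Zeroth-order terms cancel; dividing by \<open>t k\<close> and letting it vanish leaves the claim.
  Its strength lies in the freedom of \<open>N\<close>.\<close>

lemma simple_lattice_first_order:
  fixes N :: "real^'n^'n"
  assumes \<Lambda>: "is_lattice \<Lambda>" "voronoi_polytope \<Lambda> \<subseteq> cball 0 1" "simple_lattice \<Lambda>"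
    and v: "v \<in> vertices (voronoi_polytope \<Lambda>)"
    and d: "d \<in> contacts \<Lambda> v" "d = (\<Sum>b\<in>B. c b *\<^sub>R b)" "B \<subseteq> facet_contacts \<Lambda> v"
  shows "(\<Sum>b\<in>B. c b * ((N *v b) \<bullet> b)) \<le> (N *v d) \<bullet> d"
proof -
  define M0 where "M0 k = mat 1 + inverse (real (Suc k)) *\<^sub>R N" for k
  have M0: "M0 \<longlonglongrightarrow> mat 1"
    unfolding M0_def by (rule tendsto_eq_intros LIMSEQ_inverse_real_of_nat refl | simp)+
  obtain K where K: "\<And>k. k \<ge> K \<Longrightarrow> invertible (M0 k)"
    using eventually_invertible_near_identity[OF M0] unfolding eventually_sequentially by blast
  \<comment> \<open>The shift by \<open>K\<close> makes every \<open>M k\<close> invertible, not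
    only almost every one.\<close>
  define t where "t k = inverse (real (Suc (k + K)))" for k
  define M where "M k = mat 1 + t k *\<^sub>R N" for k
  have M_eq: "M k = M0 (k + K)" for k
    by (simp add: M_def M0_def t_def)
  have M: "M \<longlonglongrightarrow> mat 1" "\<And>k. invertible (M k)"
    unfolding M_eq using LIMSEQ_ignore_initial_segment[OF M0] K by auto
  have t: "t \<longlonglongrightarrow> 0"
    unfolding t_def by (rule LIMSEQ_ignore_initial_segment[OF LIMSEQ_inverse_real_of_nat])
  have Mx: "(M k *v x) \<bullet> (M k *v x) = x \<bullet> x + t k * (2 * ((N *v x) \<bullet> x) + t k * ((N *v x) \<bullet> (N *v x)))" for k x
    by (simp only: M_def identity_plus_mult inner_add_scaleR_self)
  have Bc: "2 * (v \<bullet> b) = b \<bullet> b" if "b \<in> B" for b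
    using that d(3) by (auto simp: facet_contacts_def contacts_def)
  \<comment> \<open>\<open>v\<close> solves the unperturbed equations for \<open>d\<close> and for
    \<open>B\<close>, which is why the zeroth-order terms cancel below.\<close>
  have dd: "d \<bullet> d = (\<Sum>b\<in>B. c b * (b \<bullet> b))"
  proof -
    have "d \<bullet> d = 2 * (v \<bullet> d)"
      using d(1) by (simp add: contacts_def)
    also have "\<dots> = (\<Sum>b\<in>B. c b * (2 * (v \<bullet> b)))"
      unfolding d(2) by (simp add: inner_sum_right sum_distrib_left mult_ac)
    finally show ?thesis
      by (simp add: Bc)
  qed
  have "\<forall>\<^sub>F k in sequentially. (\<Sum>b\<in>B. c b * (2 * ((N *v b) \<bullet> b) + t k * ((N *v b) \<bullet> (N *v b))))
      \<le> 2 * ((N *v d) \<bullet> d) + t k * ((N *v d) \<bullet> (N *v d))"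
    using simple_lattice_tight_point[OF \<Lambda> M v]
  proof eventually_elim
    case (elim k)
    then obtain w where w: "w \<in> voronoi_polytope ((*v) (M k) ` \<Lambda>)"
      "\<And>b. b \<in> B \<Longrightarrow> 2 * (w \<bullet> (M k *v b)) = (M k *v b) \<bullet> (M k *v b)"
      using d(3) by blast
    have "M k *v d = (\<Sum>b\<in>B. c b *\<^sub>R (M k *v b))"
      unfolding d(2) linear_sum[OF matrix_vector_mul_linear] matrix_vector_mult_scaleR ..
    then have "2 * (w \<bullet> (M k *v d)) = (\<Sum>b\<in>B. c b * (2 * (w \<bullet> (M k *v b))))"
      by (simp add: inner_sum_right sum_distrib_left mult_ac)
    also have "\<dots> = (\<Sum>b\<in>B. c b * ((M k *v b) \<bullet> (M k *v b)))"
      by (simp add: w(2))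
    also have "\<dots> = (\<Sum>b\<in>B. c b * (b \<bullet> b)) + t k * (\<Sum>b\<in>B. c b * (2 * ((N *v b) \<bullet> b) + t k * ((N *v b) \<bullet> (N *v b))))"
      by (simp only: Mx ring_distribs sum.distrib sum_distrib_left mult_ac)
    finally have "2 * (w \<bullet> (M k *v d)) = d \<bullet> d + t k * (\<Sum>b\<in>B. c b * (2 * ((N *v b) \<bullet> b) + t k * ((N *v b) \<bullet> (N *v b))))"
      by (simp only: dd)
    moreover have "M k *v d \<in> (*v) (M k) ` \<Lambda>"
      using d(1) by (simp add: contacts_def)
    then have "2 * (w \<bullet> (M k *v d)) \<le> (M k *v d) \<bullet> (M k *v d)"
      using w(1) unfolding mem_voronoi_polytope by blast
    ultimately have "t k * (\<Sum>b\<in>B. c b * (2 * ((N *v b) \<bullet> b) + t k * ((N *v b) \<bullet> (N *v b))))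
        \<le> t k * (2 * ((N *v d) \<bullet> d) + t k * ((N *v d) \<bullet> (N *v d)))"
      by (simp only: Mx)
    then show ?case
      by (simp only: mult_le_cancel_left_pos t_def) (simp add: t_def)
  qed
  moreover have "(\<lambda>k. \<Sum>b\<in>B. c b * (2 * ((N *v b) \<bullet> b) + t k * ((N *v b) \<bullet> (N *v b))))
      \<longlonglongrightarrow> (\<Sum>b\<in>B. c b * (2 * ((N *v b) \<bullet> b) + 0 * ((N *v b) \<bullet> (N *v b))))"
    by (intro tendsto_intros t)
  moreover have "(\<lambda>k. 2 * ((N *v d) \<bullet> d) + t k * ((N *v d) \<bullet> (N *v d))) \<longlonglongrightarrow> 2 * ((N *v d) \<bullet> d) + 0 * ((N *v d) \<bullet> (N *v d))"
    by (intro tendsto_intros t)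
  ultimately have "(\<Sum>b\<in>B. c b * (2 * ((N *v b) \<bullet> b) + 0 * ((N *v b) \<bullet> (N *v b))))
      \<le> 2 * ((N *v d) \<bullet> d) + 0 * ((N *v d) \<bullet> (N *v d))"
    by (intro tendsto_le[OF sequentially_bot])
  then have "2 * (\<Sum>b\<in>B. c b * ((N *v b) \<bullet> b)) \<le> 2 * ((N *v d) \<bullet> d)"
    by (simp add: sum_distrib_left mult_ac)
  then show ?thesis
    by simp
qed

text \<open>The contact equation equates a linear with a quadratic function of the vector, so it
  holds on a line for only one nonzero multiple.\<close>

lemma contacts_not_parallel:
  assumes "a \<in> contacts \<Lambda> v" "b \<in> contacts \<Lambda> v" "a \<noteq> 0" "b \<noteq> 0" "a = s *\<^sub>R b"
  shows "a = b"
proof -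
  have "s \<noteq> 0"
    using assms by auto
  have "s * (b \<bullet> b) = 2 * (v \<bullet> a)"
    using assms by (simp add: contacts_def)
  also have "\<dots> = s * (s * (b \<bullet> b))"
    using assms by (simp add: contacts_def)
  finally have "s = 1"
    using \<open>s \<noteq> 0\<close> assms(4) by simp
  then show ?thesis
    using assms(5) by simp
qed

lemma exists_orthogonal_vector:
  fixes a b :: "'a::real_inner"
  assumes "b \<noteq> 0" "\<And>s. a \<noteq> s *\<^sub>R b"
  obtains z where "z \<bullet> b = 0" "z \<bullet> a > 0"
proof -
  define z where "z = a - ((a \<bullet> b) / (b \<bullet> b)) *\<^sub>R b"
  have zb: "z \<bullet> b = 0"
    using assms(1) by (simp add: z_def inner_diff_left)
  have "z \<noteq> 0"
    using assms(2)[of "(a \<bullet> b) / (b \<bullet> b)"] by (simp add: z_def)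
  then have "z \<bullet> z > 0"
    by simp
  moreover have "z \<bullet> z = z \<bullet> a - ((a \<bullet> b) / (b \<bullet> b)) * (z \<bullet> b)"
    by (subst (2) z_def) (simp add: inner_diff_right)
  ultimately have "z \<bullet> a > 0"
    by (simp add: zb)
  then show thesis
    using zb that by blast
qed

text \<open>The points \<open>d / (v \<bullet> d)\<close> span a polytope in a hyperplane, whose vertices come from the facet
  contacts.\<close>

lemma contacts_subset_cone_facet_contacts:
  assumes "is_lattice \<Lambda>" and d: "d \<in> contacts \<Lambda> v" "d \<noteq> 0"
  obtains c where "\<And>e. e \<in> facet_contacts \<Lambda> v \<Longrightarrow> c e \<ge> 0" "d = (\<Sum>e\<in>facet_contacts \<Lambda> v. c e *\<^sub>R e)"
proof -
  let ?D = "contacts \<Lambda> v - {0}" and ?E = "facet_contacts \<Lambda> v"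
  define h where "h x = (1 / (v \<bullet> x)) *\<^sub>R x" for x
  have fin: "finite ?D" "finite ?E"
    using finite_contacts[OF assms(1)] facet_contacts_subset by (meson finite_Diff finite_subset)+
  have pos: "v \<bullet> x > 0" if "x \<in> ?D" for x
  proof -
    have "2 * (v \<bullet> x) = x \<bullet> x" "x \<bullet> x > 0"
      using that by (auto simp: contacts_def)
    then show ?thesis
      by linarith
  qed
  have hinj: "x = y" if "x \<in> ?D" "y \<in> ?D" "h x = h y" for x y
  proof (rule contacts_not_parallel)
    have "x = (v \<bullet> x) *\<^sub>R h x"
      using pos[OF that(1)] by (simp add: h_def)
    then show "x = (v \<bullet> x * (1 / (v \<bullet> y))) *\<^sub>R y"
      unfolding that(3) by (simp add: h_def)
  qed (use that in auto)
  let ?H = "convex hull (h ` ?D)"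
  have compact: "compact ?H"
    using fin by (intro compact_convex_hull finite_imp_compact) auto
  have poly: "polyhedron ?H"
    using fin by (intro polyhedron_convex_hull) auto
  have ext: "x \<in> h ` ?E" if x: "x extreme_point_of ?H" for x
  proof -
    obtain e where e: "e \<in> ?D" "x = h e"
      using extreme_point_of_convex_hull[OF x] by blast
    \<comment> \<open>Extreme points of a polyhedron are exposed; an exposing functional is strict
      at all other points \<open>h l\<close>.\<close>
    have "{x} exposed_face_of ?H"
      unfolding exposed_face_of_polyhedron[OF poly] using x by (simp add: face_of_singleton)
    then obtain a b where ab: "?H \<subseteq> {z. a \<bullet> z \<le> b}" "{x} = ?H \<inter> {z. a \<bullet> z = b}"
      unfolding exposed_face_of_def by blast
    have le: "a \<bullet> h l < b" if "l \<in> ?D" "l \<noteq> e" for l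
    proof -
      have "h l \<in> ?H"
        using that by (intro hull_inc) auto
      moreover have "h l \<noteq> x"
        using hinj[OF that(1) e(1)] that(2) e(2) by auto
      ultimately show ?thesis
        using ab by (auto simp: less_le)
    qed
    \<comment> \<open>On the hyperplane where \<open>v \<bullet> x = 1\<close> the constant
      \<open>b\<close> equals \<open>b * (v \<bullet> x)\<close>, so the affine functional
      \<open>a \<bullet> x - b\<close> becomes linear and can be tested on the unscaled
      contacts.\<close>
    define y where "y = a - b *\<^sub>R v"
    have yh: "y \<bullet> l = (v \<bullet> l) * (a \<bullet> h l - b)" if "l \<in> ?D" for l
      using pos[OF that] by (simp add: y_def h_def inner_diff_left field_simps)
    have "a \<bullet> x = b"
      using ab(2) by blast
    then have "y \<bullet> e = 0"
      using yh[OF e(1)] e(2) by simp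
    moreover have "y \<bullet> l < 0" if "l \<in> contacts \<Lambda> v - {0, e}" for l
      using yh[of l] le[of l] pos[of l] that by (simp add: mult_pos_neg)
    ultimately have "e \<in> ?E"
      using e(1) unfolding facet_contacts_def by blast
    then show ?thesis
      using e(2) by blast
  qed
  have "h d \<in> ?H"
    using d by (intro hull_inc) auto
  also have "?H = convex hull {x. x extreme_point_of ?H}"
    using compact convex_convex_hull by (rule Krein_Milman_Minkowski)
  also have "\<dots> \<subseteq> convex hull (h ` ?E)"
    using ext by (intro hull_mono) auto
  finally obtain u where u: "\<And>x. x \<in> h ` ?E \<Longrightarrow> 0 \<le> u x" "(\<Sum>x\<in>h ` ?E. u x *\<^sub>R x) = h d"
    using fin(2) by (auto simp: convex_hull_finite)
  define c where "c e = (v \<bullet> d) * u (h e) / (v \<bullet> e)" for e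
  have "inj_on h ?E"
    using hinj facet_contacts_subset by (intro inj_onI) blast
  then have hd: "h d = (\<Sum>e\<in>?E. u (h e) *\<^sub>R h e)"
    using u(2) by (simp add: sum.reindex)
  have "d = (v \<bullet> d) *\<^sub>R h d"
    using pos[of d] d by (simp add: h_def)
  also have "\<dots> = (\<Sum>e\<in>?E. (v \<bullet> d) *\<^sub>R (u (h e) *\<^sub>R h e))"
    unfolding hd by (rule scaleR_sum_right)
  also have "\<dots> = (\<Sum>e\<in>?E. c e *\<^sub>R e)"
    by (rule sum.cong[OF refl]) (simp add: c_def h_def)
  finally have "d = (\<Sum>e\<in>?E. c e *\<^sub>R e)" .
  moreover have "c e \<ge> 0" if "e \<in> ?E" for e
  proof -
    have "v \<bullet> e > 0" "v \<bullet> d > 0" "u (h e) \<ge> 0"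
      using pos[of e] pos[of d] facet_contacts_subset d that u(1) by auto
    then show ?thesis
      by (simp add: c_def)
  qed
  ultimately show thesis
    by (intro that[of c]) auto
qed

lemma matrix_rank_one:
  fixes f :: "real^'n \<Rightarrow> real"
  assumes "linear f"
  shows "matrix (\<lambda>x. f x *\<^sub>R z) *v x = f x *\<^sub>R z"
proof -
  have "linear (\<lambda>x. f x *\<^sub>R z)"
    using assms by (intro linearI) (simp_all add: linear_add linear_scale scaleR_add_left)
  then show ?thesis
    by (intro matrix_works) (simp add: linear_matrix_vector_mul_eq)
qed

text \<open>\<open>simple_lattice_first_order\<close> is used with two rank-one matrices: a positive
  semidefinite one shows that every nonzero contact is a facet contact; then any vector outside a
  basis of contacts can be contradicted, whatever the signs of its coefficients.\<close>

proposition simple_lattice_independent_contacts: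
  assumes \<Lambda>: "is_lattice \<Lambda>" "voronoi_polytope \<Lambda> \<subseteq> cball 0 1" "simple_lattice \<Lambda>"
    and v: "v \<in> vertices (voronoi_polytope \<Lambda>)"
  shows "independent (contacts \<Lambda> v - {0})"
proof (rule ccontr)
  let ?D = "contacts \<Lambda> v - {0}" and ?E = "facet_contacts \<Lambda> v"
  note first_order = simple_lattice_first_order[OF \<Lambda> v]
  have finE: "finite ?E"
    using finite_contacts[OF \<Lambda>(1)] facet_contacts_subset by (meson finite_Diff finite_subset)
  have DE: "?D \<subseteq> ?E"
  proof (rule ccontr)
    assume "\<not> ?D \<subseteq> ?E"
    then obtain d where d: "d \<in> contacts \<Lambda> v" "d \<noteq> 0" "d \<notin> ?E"
      by blast
    obtain c where c: "\<And>e. e \<in> ?E \<Longrightarrow> c e \<ge> 0" "d = (\<Sum>e\<in>?E. c e *\<^sub>R e)"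
      using contacts_subset_cone_facet_contacts[OF \<Lambda>(1) d(1,2)] by metis
    have "\<exists>e\<in>?E. c e \<noteq> 0"
      using c(2) d(2) by (metis (no_types, lifting) scaleR_eq_0_iff sum.neutral)
    then obtain e where e: "e \<in> ?E" "c e > 0"
      using c(1) by force
    have "e \<noteq> s *\<^sub>R d" for s
    proof -
      have "e \<in> contacts \<Lambda> v" "e \<noteq> 0"
        using e(1) by (simp_all add: facet_contacts_def)
      then show ?thesis
        using contacts_not_parallel[of e \<Lambda> v d s] e(1) d by metis
    qed
    then obtain z where z: "z \<bullet> d = 0" "z \<bullet> e > 0"
      using exists_orthogonal_vector[OF d(2)] by metis
    \<comment> \<open>The quadratic form \<open>(z \<bullet> x)^2\<close> vanishes at
      \<open>d\<close> but not at \<open>e\<close>, while all coefficients are nonnegative.\<close>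
    define N where "N = matrix (\<lambda>x. (z \<bullet> x) *\<^sub>R z)"
    have N: "(N *v x) \<bullet> x = (z \<bullet> x)\<^sup>2" for x
      unfolding N_def by (subst matrix_rank_one) (auto simp: power2_eq_square intro: bounded_linear.linear bounded_linear_inner_right)
    have "(\<Sum>b\<in>?E. c b * (z \<bullet> b)\<^sup>2) \<le> 0"
      using first_order[OF d(1) c(2) order_refl, of N] by (simp add: N z)
    moreover have "(\<Sum>b\<in>?E. c b * (z \<bullet> b)\<^sup>2) \<ge> c e * (z \<bullet> e)\<^sup>2"
      using finE e(1) c(1) by (intro member_le_sum) auto
    moreover have "c e * (z \<bullet> e)\<^sup>2 > 0"
      using e z by simp
    ultimately show False
      by linarith
  qed
  assume dep: "\<not> independent ?D"
  obtain B where B: "B \<subseteq> ?D" "independent B" "?D \<subseteq> span B"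
    using maximal_independent_subset by blast
  then have "B \<noteq> ?D"
    using dep by blast
  then obtain d where d: "d \<in> contacts \<Lambda> v" "d \<noteq> 0" "d \<notin> B"
    using B(1) by blast
  have finB: "finite B"
    using B(1) finite_contacts[OF \<Lambda>(1)] by (meson finite_Diff finite_subset)
  have "d \<in> span B"
    using B(3) d by blast
  then obtain c where c: "d = (\<Sum>b\<in>B. c b *\<^sub>R b)"
    unfolding span_finite[OF finB] by blast
  obtain b where b: "b \<in> B" "c b \<noteq> 0"
    using c d(2) by (metis (no_types, lifting) scaleR_eq_0_iff sum.neutral)
  have b': "b \<in> contacts \<Lambda> v" "b \<noteq> 0"
    using b(1) B(1) by auto
  have "d \<noteq> s *\<^sub>R b" for s
    using contacts_not_parallel[of d \<Lambda> v b s] d b b' by metis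
  then obtain z0 where z0: "z0 \<bullet> b = 0" "z0 \<bullet> d > 0"
    using exists_orthogonal_vector[OF b'(2)] by metis
  obtain f :: "real^'a \<Rightarrow> real" where f: "linear f" "\<And>x. x \<in> B \<Longrightarrow> f x = (if x = b then 1 else 0)"
    using linear_independent_extend[OF B(2), of "\<lambda>x. if x = b then 1 else 0"] by blast
  \<comment> \<open>The functional \<open>f\<close> isolates \<open>b\<close> among the basis and
    \<open>z\<close> is orthogonal to \<open>b\<close>, so the left-hand sum vanishes. The factor
    \<open>- c b\<close> gives the right-hand side a negative sign.\<close>
  define z where "z = (- c b) *\<^sub>R z0"
  define N where "N = matrix (\<lambda>x. f x *\<^sub>R z)"
  have N: "(N *v x) \<bullet> x = f x * (z \<bullet> x)" for x
    unfolding N_def matrix_rank_one[OF f(1)] by simp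
  have "(\<Sum>x\<in>B. c x * (f x * (z \<bullet> x))) \<le> f d * (z \<bullet> d)"
    using first_order[OF d(1) c, of N] B(1) DE by (simp add: N)
  moreover have "(\<Sum>x\<in>B. c x * (f x * (z \<bullet> x))) = 0"
    by (rule sum.neutral) (use f(2) z0 in \<open>auto simp: z_def\<close>)
  moreover have "f d = c b"
  proof -
    have "f d = (\<Sum>x\<in>B. c x * f x)"
      by (subst c) (simp add: linear_sum[OF f(1)] linear_scale[OF f(1)])
    also have "\<dots> = (\<Sum>x\<in>B. if x = b then c x else 0)"
      by (rule sum.cong) (auto simp: f(2))
    also have "\<dots> = c b"
      using finB b(1) by simp
    finally show ?thesis .
  qed
  moreover have "f d * (z \<bullet> d) < 0"
  proof -
    have "f d * (z \<bullet> d) = - ((c b * c b) * (z0 \<bullet> d))"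
      by (simp add: \<open>f d = c b\<close> z_def)
    moreover have "c b * c b > 0"
      using b(2) by (simp flip: power2_eq_square)
    then have "(c b * c b) * (z0 \<bullet> d) > 0"
      using z0(2) by (rule mult_pos_pos)
    ultimately show ?thesis
      by linarith
  qed
  ultimately show False
    by linarith
qed

text \<open>The class is the image of the contacts, 0 included, under reflection and translation, so
  independence transfers. As its affine hull is the whole space, its size follows.\<close>

lemma simple_lattice_vertex_class:
  fixes \<Lambda> :: "(real^'n) set"
  assumes \<Lambda>: "is_lattice \<Lambda>" "voronoi_polytope \<Lambda> \<subseteq> cball 0 1" "simple_lattice \<Lambda>"
    and v: "v \<in> vertices (voronoi_polytope \<Lambda>)"
  shows "\<not> affine_dependent (vertex_class \<Lambda> v)" "card (vertex_class \<Lambda> v) = CARD('n) + 1"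
proof -
  have "contacts \<Lambda> v = insert 0 (contacts \<Lambda> v - {0})"
    using zero_in_contacts[OF \<Lambda>(1)] by blast
  then have ind: "\<not> affine_dependent (contacts \<Lambda> v)"
    using affine_dependent_imp_dependent2 simple_lattice_independent_contacts[OF assms] by metis
  have inj: "inj_on (\<lambda>l. v - l) (contacts \<Lambda> v)"
    by (simp add: inj_on_def)
  show nd: "\<not> affine_dependent (vertex_class \<Lambda> v)"
  proof
    assume "affine_dependent (vertex_class \<Lambda> v)"
    then obtain U where U: "sum U (vertex_class \<Lambda> v) = 0" "\<exists>w\<in>vertex_class \<Lambda> v. U w \<noteq> 0"
      "(\<Sum>w\<in>vertex_class \<Lambda> v. U w *\<^sub>R w) = 0"
      unfolding affine_dependent_explicit_finite[OF finite_vertex_class[OF \<Lambda>(1)]] by blast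
    have s: "(\<Sum>l\<in>contacts \<Lambda> v. U (v - l)) = 0" "(\<Sum>l\<in>contacts \<Lambda> v. U (v - l) *\<^sub>R (v - l)) = 0"
      using U(1,3) unfolding vertex_class_def sum.reindex[OF inj] by (simp_all add: o_def)
    have "(\<Sum>l\<in>contacts \<Lambda> v. U (v - l) *\<^sub>R (v - l)) = (\<Sum>l\<in>contacts \<Lambda> v. U (v - l)) *\<^sub>R v - (\<Sum>l\<in>contacts \<Lambda> v. U (v - l) *\<^sub>R l)"
      by (simp add: scaleR_diff_right sum_subtractf scaleR_sum_left)
    then have "(\<Sum>l\<in>contacts \<Lambda> v. U (v - l) *\<^sub>R l) = 0"
      using s by simp
    moreover have "\<exists>l\<in>contacts \<Lambda> v. U (v - l) \<noteq> 0"
      using U(2) by (auto simp: vertex_class_def)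
    ultimately have "affine_dependent (contacts \<Lambda> v)"
      unfolding affine_dependent_explicit_finite[OF finite_contacts[OF \<Lambda>(1)]] using s(1) by (intro exI[of _ "\<lambda>l. U (v - l)"]) auto
    then show False
      using ind by blast
  qed
  have "aff_dim (vertex_class \<Lambda> v) = int CARD('n)"
    using aff_dim_affine_hull[of "vertex_class \<Lambda> v"] affine_hull_vertex_class[OF \<Lambda>(1) v] by simp
  then show "card (vertex_class \<Lambda> v) = CARD('n) + 1"
    using aff_dim_affine_independent[OF nd] by simp
qed

lemma inscribed_maximal_primitive_simplex:
  assumes "critical_covering_lattice (cball 0 1) \<Lambda>" "simple_lattice \<Lambda>" "S \<in> maximal_primitive_simplices \<Lambda>"
  shows "inscribed_simplex S"
proof -
  have \<Lambda>: "is_lattice \<Lambda>" "voronoi_polytope \<Lambda> \<subseteq> cball 0 1"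
    using assms by (auto simp: critical_covering_lattice_def covering_cball_iff)
  obtain v where v: "v \<in> voronoi_polytope \<Lambda>" "norm v = 1" "S = convex hull vertex_class \<Lambda> v"
    using assms(3) unfolding maximal_primitive_simplices_eq[OF assms(1)] by blast
  note simplex = simple_lattice_vertex_class[OF \<Lambda> assms(2) unit_norm_imp_vertex[OF \<Lambda>(2) v(1,2)]]
  have "vertices S = vertex_class \<Lambda> v"
    unfolding v(3) by (rule vertices_convex_hull_vertex_class)
  moreover have "vertex_class \<Lambda> v \<subseteq> sphere 0 1"
    using norm_vertex_class v(2) by (force simp: dist_norm)
  ultimately show ?thesis
    unfolding inscribed_simplex_def simplex_def using simplex v(3) by auto
qed

subsection \<open>Barycentric coordinates and the maps \<open>Q_map\<close>\<close>

lemma affine_independent_coeffs_zero: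
  assumes "\<not> affine_dependent V" "finite V" "sum u V = 0" "(\<Sum>v\<in>V. u v *\<^sub>R v) = 0" "v \<in> V"
  shows "u v = 0"
proof (rule ccontr)
  assume "u v \<noteq> 0"
  then have "affine_dependent V"
    unfolding affine_dependent_explicit_finite[OF assms(2)]
    by (intro exI[of _ u] conjI bexI[of _ v] assms(3-5))
  then show False
    using assms(1) by contradiction
qed

lemma inscribed_simplex_vertices:
  fixes S :: "(real^'n) set"
  assumes "inscribed_simplex S"
  shows "finite (vertices S)" "\<not> affine_dependent (vertices S)" "affine hull (vertices S) = UNIV"
    "\<And>w. w \<in> vertices S \<Longrightarrow> norm w = 1"
proof -
  obtain C where C: "\<not> affine_dependent C" "int (card C) = int CARD('n) + 1" "S = convex hull C"
    using assms unfolding inscribed_simplex_def simplex_def by blast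
  have V: "vertices S = C"
    unfolding vertices_def C(3) using extreme_point_of_convex_hull_affine_independent[OF C(1)] by blast
  show "finite (vertices S)" "\<not> affine_dependent (vertices S)"
    unfolding V using C(1) aff_independent_finite by auto
  have "aff_dim C = int DIM(real^'n)"
    using aff_dim_affine_independent[OF C(1)] C(2) by simp
  then show "affine hull (vertices S) = UNIV"
    unfolding V by (simp only: aff_dim_eq_full)
  show "norm w = 1" if "w \<in> vertices S" for w
    using assms that unfolding inscribed_simplex_def by auto
qed

text \<open>Existence because the affine hull is everything, uniqueness by affine independence; this
  gives the \<open>THE\<close> in \<open>barycentric\<close> its meaning.\<close>

lemma barycentric_ex1:
  assumes "inscribed_simplex S"
  shows "\<exists>!\<alpha>. (\<forall>v. v \<notin> vertices S \<longrightarrow> \<alpha> v = 0) \<and> (\<Sum>v\<in>vertices S. \<alpha> v) = (1::real) \<and> (\<Sum>v\<in>vertices S. \<alpha> v *\<^sub>R v) = 0"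
proof -
  note V = inscribed_simplex_vertices[OF assms]
  have "0 \<in> affine hull (vertices S)"
    using V(3) by simp
  then obtain u where u: "sum u (vertices S) = 1" "(\<Sum>v\<in>vertices S. u v *\<^sub>R v) = 0"
    unfolding affine_hull_finite[OF V(1)] by blast
  show ?thesis
  proof (rule ex1I[of _ "\<lambda>v. if v \<in> vertices S then u v else 0"])
    show "(\<forall>v. v \<notin> vertices S \<longrightarrow> (if v \<in> vertices S then u v else 0) = 0) \<and>
      (\<Sum>v\<in>vertices S. if v \<in> vertices S then u v else 0) = 1 \<and>
      (\<Sum>v\<in>vertices S. (if v \<in> vertices S then u v else 0) *\<^sub>R v) = 0"
      using u by (simp cong: sum.cong)
  next
    fix \<alpha> assume \<alpha>: "(\<forall>v. v \<notin> vertices S \<longrightarrow> \<alpha> v = 0) \<and> (\<Sum>v\<in>vertices S. \<alpha> v) = (1::real) \<and> (\<Sum>v\<in>vertices S. \<alpha> v *\<^sub>R v) = 0"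
    have d: "sum (\<lambda>v. \<alpha> v - u v) (vertices S) = 0" "(\<Sum>v\<in>vertices S. (\<alpha> v - u v) *\<^sub>R v) = 0"
      using \<alpha> u by (simp_all add: sum_subtractf scaleR_diff_left)
    have "\<forall>v\<in>vertices S. \<alpha> v - u v = 0"
      by (rule ballI) (rule affine_independent_coeffs_zero[OF V(2,1) d])
    then show "\<alpha> = (\<lambda>v. if v \<in> vertices S then u v else 0)"
      using \<alpha> by auto
  qed
qed

lemma barycentric_sums:
  assumes "inscribed_simplex S"
  shows "(\<Sum>w\<in>vertices S. barycentric S 0 w) = 1" "(\<Sum>w\<in>vertices S. barycentric S 0 w *\<^sub>R w) = 0"
  using theI'[OF barycentric_ex1[OF assms]] unfolding barycentric_def by blast+

lemma barycentric_unique: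
  assumes "inscribed_simplex S" "(\<Sum>w\<in>vertices S. \<alpha> w) = 1" "(\<Sum>w\<in>vertices S. \<alpha> w *\<^sub>R w) = 0" "w \<in> vertices S"
  shows "barycentric S 0 w = \<alpha> w"
proof -
  note V = inscribed_simplex_vertices[OF assms(1)]
  let ?b = "barycentric S 0"
  have d: "sum (\<lambda>v. ?b v - \<alpha> v) (vertices S) = 0" "(\<Sum>v\<in>vertices S. (?b v - \<alpha> v) *\<^sub>R v) = 0"
    using barycentric_sums[OF assms(1)] assms(2,3) by (simp_all add: sum_subtractf scaleR_diff_left)
  have "\<forall>v\<in>vertices S. ?b v - \<alpha> v = 0"
    by (rule ballI) (rule affine_independent_coeffs_zero[OF V(2,1) d])
  then show ?thesis
    using assms(4) by simp
qed

lemma vertices_uminus: "vertices (uminus ` S) = uminus ` vertices S" for S :: "(real^'n) set"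
proof -
  have sub: "uminus ` vertices S \<subseteq> vertices (uminus ` S)" for S :: "(real^'n) set"
  proof (intro image_subsetI)
    fix w assume w: "w \<in> vertices S"
    show "- w \<in> vertices (uminus ` S)"
      unfolding vertices_def extreme_point_of_def
    proof (intro CollectI conjI ballI)
      show "- w \<in> uminus ` S"
        using w by (simp add: vertices_def extreme_point_of_def)
      fix a b assume "a \<in> uminus ` S" "b \<in> uminus ` S"
      then obtain a' b' where ab: "a' \<in> S" "b' \<in> S" "a = - a'" "b = - b'"
        by blast
      have "w \<notin> open_segment a' b'"
        using w ab by (simp add: vertices_def extreme_point_of_def)
      moreover have "open_segment a b = uminus ` open_segment a' b'"
        unfolding ab by (rule open_segment_linear_image) (auto simp: linear_uminus)
      ultimately show "- w \<notin> open_segment a b"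
        by auto
    qed
  qed
  show ?thesis
  proof
    have "uminus ` vertices (uminus ` S) \<subseteq> vertices (uminus ` uminus ` S)"
      by (rule sub)
    then have "uminus ` uminus ` vertices (uminus ` S) \<subseteq> uminus ` vertices S"
      unfolding uminus_image_involutive[of S] by (rule image_mono)
    then show "vertices (uminus ` S) \<subseteq> uminus ` vertices S"
      unfolding uminus_image_involutive .
  qed (rule sub)
qed

lemma barycentric_uminus:
  assumes "inscribed_simplex S" "inscribed_simplex (uminus ` S)" "w \<in> vertices S"
  shows "barycentric (uminus ` S) 0 (- w) = barycentric S 0 w"
proof -
  have inj: "inj_on uminus (vertices S)"
    by simp
  have "barycentric (uminus ` S) 0 (- w) = (\<lambda>x. barycentric S 0 (- x)) (- w)"
    using barycentric_sums[OF assms(1)] assms(3)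
    by (intro barycentric_unique[OF assms(2)])
      (simp_all add: vertices_uminus sum.reindex sum_negf)
  then show ?thesis
    by simp
qed

text \<open>The matrix of \<open>Q_map S\<close>, viewed as a point of the Euclidean space of
  matrices, where hyperplanes can separate.\<close>

definition simplex_matrix :: "(real^'n) set \<Rightarrow> real^'n^'n" where
  "simplex_matrix S = (\<chi> i j. \<Sum>w\<in>vertices S. barycentric S 0 w * (w $ i * w $ j))"

lemma simplex_matrix_vector_mult: "simplex_matrix S *v y = Q_map S y"
proof -
  have "(simplex_matrix S *v y) $ i = Q_map S y $ i" for i
  proof -
    have "(simplex_matrix S *v y) $ i = (\<Sum>j\<in>UNIV. \<Sum>w\<in>vertices S. barycentric S 0 w * (w $ i * w $ j) * y $ j)"
      by (simp add: matrix_vector_mult_def simplex_matrix_def sum_distrib_right)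
    also have "\<dots> = (\<Sum>w\<in>vertices S. \<Sum>j\<in>UNIV. barycentric S 0 w * (w $ i * w $ j) * y $ j)"
      by (rule sum.swap)
    also have "\<dots> = Q_map S y $ i"
      by (simp add: Q_map_def inner_vec_def sum_distrib_left sum_distrib_right mult_ac)
    finally show ?thesis .
  qed
  then show ?thesis
    by (simp add: vec_eq_iff)
qed

text \<open>The right-hand side is half the derivative at 0 of the weighted mean of
  \<open>norm (w + t * A w)^2\<close>; so a negative inner product means that the simplex contracts
  to first order.\<close>

lemma inner_simplex_matrix:
  "A \<bullet> simplex_matrix S = (\<Sum>w\<in>vertices S. barycentric S 0 w * (w \<bullet> (A *v w)))"
proof -
  have "A \<bullet> simplex_matrix S = (\<Sum>i\<in>UNIV. \<Sum>j\<in>UNIV. \<Sum>w\<in>vertices S. A $ i $ j * (barycentric S 0 w * (w $ i * w $ j)))"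
    by (simp add: inner_vec_def simplex_matrix_def sum_distrib_left)
  also have "\<dots> = (\<Sum>i\<in>UNIV. \<Sum>w\<in>vertices S. \<Sum>j\<in>UNIV. A $ i $ j * (barycentric S 0 w * (w $ i * w $ j)))"
    by (intro sum.cong refl sum.swap)
  also have "\<dots> = (\<Sum>w\<in>vertices S. \<Sum>i\<in>UNIV. \<Sum>j\<in>UNIV. A $ i $ j * (barycentric S 0 w * (w $ i * w $ j)))"
    by (rule sum.swap)
  also have "\<dots> = (\<Sum>w\<in>vertices S. barycentric S 0 w * (w \<bullet> (A *v w)))"
    by (simp add: inner_vec_def matrix_vector_mult_def sum_distrib_left mult_ac)
  finally show ?thesis .
qed

text \<open>The trace of \<open>Q_map S\<close> is the sum of the weights, because the vertices are
  unit vectors.\<close>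

lemma inner_mat_1_simplex_matrix:
  assumes "inscribed_simplex S"
  shows "mat 1 \<bullet> simplex_matrix S = 1"
  using barycentric_sums(1)[OF assms] inscribed_simplex_vertices(4)[OF assms]
  by (simp add: inner_simplex_matrix dot_square_norm)

lemma simplex_matrix_uminus:
  assumes "inscribed_simplex S" "inscribed_simplex (uminus ` S)"
  shows "simplex_matrix (uminus ` S) = simplex_matrix S"
  using barycentric_uminus[OF assms]
  by (simp add: simplex_matrix_def vertices_uminus sum.reindex cong: sum.cong)

lemma inner_Q_map:
  "y \<bullet> Q_map S y = (\<Sum>w\<in>vertices S. barycentric S 0 w * (w \<bullet> y)\<^sup>2)"
  by (simp add: Q_map_def inner_sum_right power2_eq_square inner_commute mult_ac)

section \<open>Eutaxy: the determinant bound and its dual, separation\<close>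

text \<open>The resolution of the identity expands \<open>y \<bullet> y\<close> for each row
  \<open>y\<close> of \<open>T\<close>; summing over the rows gives both norms.\<close>

lemma eutactic_norm_sq:
  fixes T :: "real^'n^'n"
  assumes "id = (\<lambda>y. \<Sum>S\<in>X. \<upsilon> S *\<^sub>R Q_map S (y :: real^'n))"
  shows "(norm T)\<^sup>2 = (\<Sum>S\<in>X. \<upsilon> S * (\<Sum>w\<in>vertices S. barycentric S 0 w * (norm (T *v w))\<^sup>2))"
proof -
  have row: "y \<bullet> y = (\<Sum>S\<in>X. \<upsilon> S * (\<Sum>w\<in>vertices S. barycentric S 0 w * (w \<bullet> y)\<^sup>2))" for y
  proof -
    have "y = (\<Sum>S\<in>X. \<upsilon> S *\<^sub>R Q_map S y)"
      using fun_cong[OF assms, of y] by simp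
    then have "y \<bullet> y = y \<bullet> (\<Sum>S\<in>X. \<upsilon> S *\<^sub>R Q_map S y)"
      by (rule arg_cong)
    then show ?thesis
      by (simp add: inner_sum_right inner_Q_map)
  qed
  have norm: "(norm (T *v w))\<^sup>2 = (\<Sum>i\<in>UNIV. (w \<bullet> T $ i)\<^sup>2)" for w
    unfolding power2_norm_eq_inner inner_vec_def[of "T *v w"]
    by (simp add: matrix_vector_mul_component power2_eq_square inner_commute)
  have "(norm T)\<^sup>2 = (\<Sum>i\<in>UNIV. \<Sum>S\<in>X. \<upsilon> S * (\<Sum>w\<in>vertices S. barycentric S 0 w * (w \<bullet> T $ i)\<^sup>2))"
    by (simp add: norm_matrix_sq power2_norm_eq_inner row)
  also have "\<dots> = (\<Sum>S\<in>X. \<Sum>i\<in>UNIV. \<upsilon> S * (\<Sum>w\<in>vertices S. barycentric S 0 w * (w \<bullet> T $ i)\<^sup>2))"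
    by (rule sum.swap)
  also have "\<dots> = (\<Sum>S\<in>X. \<upsilon> S * (\<Sum>i\<in>UNIV. \<Sum>w\<in>vertices S. barycentric S 0 w * (w \<bullet> T $ i)\<^sup>2))"
    by (simp add: sum_distrib_left)
  also have "\<dots> = (\<Sum>S\<in>X. \<upsilon> S * (\<Sum>w\<in>vertices S. \<Sum>i\<in>UNIV. barycentric S 0 w * (w \<bullet> T $ i)\<^sup>2))"
    by (intro sum.cong refl arg_cong2[where f = "(*)"] sum.swap)
  finally show ?thesis
    by (simp add: norm sum_distrib_left)
qed

lemma eutactic_abs_det_le_1:
  fixes T :: "real^'n^'n"
  assumes "id = (\<lambda>y. \<Sum>S\<in>X. \<upsilon> S *\<^sub>R Q_map S (y :: real^'n))"
    "\<And>S. S \<in> X \<Longrightarrow> \<upsilon> S \<ge> 0" "\<And>S. S \<in> X \<Longrightarrow> inscribed_simplex S"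
    "\<And>S. S \<in> X \<Longrightarrow> (\<Sum>w\<in>vertices S. barycentric S 0 w * (norm (T *v w))\<^sup>2) \<le> 1"
  shows "\<bar>det T\<bar> \<le> 1"
proof (rule abs_det_le_1)
  have "(norm T)\<^sup>2 \<le> (\<Sum>S\<in>X. \<upsilon> S * 1)"
    unfolding eutactic_norm_sq[OF assms(1)] using assms(2,4) by (intro sum_mono mult_left_mono)
  \<comment> \<open>The total weight is recognised as the same expression at the identity matrix,
    where every mean is 1; hence it equals the dimension.\<close>
  also have "\<dots> = (\<Sum>S\<in>X. \<upsilon> S * (\<Sum>w\<in>vertices S. barycentric S 0 w * (norm (mat 1 *v w))\<^sup>2))"
    by (rule sum.cong) (simp_all add: inscribed_simplex_vertices(4)[OF assms(3)] barycentric_sums[OF assms(3)])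
  also have "\<dots> = CARD('n)"
    using eutactic_norm_sq[OF assms(1), of "mat 1"] by (simp add: norm_mat_1_sq)
  finally show "(norm T)\<^sup>2 \<le> CARD('n)" .
qed

text \<open>All the matrices have trace 1, so the identity lies in their cone only if its multiple
  of trace 1 lies in their convex hull. That hull is compact, which makes the separation
  strict.\<close>

lemma not_semieutactic_separation:
  fixes X :: "(real^'n) set set"
  assumes "finite X" "\<And>S. S \<in> X \<Longrightarrow> inscribed_simplex S" "symmetric_family X" "\<not> semieutactic X"
  obtains N :: "real^'n^'n" where "N \<bullet> mat 1 > 0" "\<And>S. S \<in> X \<Longrightarrow> N \<bullet> simplex_matrix S < 0"
proof -
  let ?n = "real CARD('n)" and ?Q = "simplex_matrix :: (real^'n) set \<Rightarrow> _"
  have "(1 / ?n) *\<^sub>R mat 1 \<notin> convex hull (?Q ` X)"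
  proof
    assume "(1 / ?n) *\<^sub>R mat 1 \<in> convex hull (?Q ` X)"
    then obtain u where u: "\<And>q. q \<in> ?Q ` X \<Longrightarrow> 0 \<le> u q" "(\<Sum>q\<in>?Q ` X. u q *\<^sub>R q) = (1 / ?n) *\<^sub>R mat 1"
      using assms(1) by (auto simp: convex_hull_finite)
    define c where "c q = real (card {S \<in> X. ?Q S = q})" for q
    define \<upsilon> where "\<upsilon> S = ?n * u (?Q S) / c (?Q S)" for S
    have c: "c q > 0" if "q \<in> ?Q ` X" for q
      using that assms(1) by (auto simp: c_def card_gt_0_iff)
    have "(\<Sum>S\<in>X. \<upsilon> S *\<^sub>R ?Q S) = (\<Sum>q\<in>?Q ` X. \<Sum>S\<in>{S \<in> X. ?Q S = q}. \<upsilon> S *\<^sub>R ?Q S)"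
      using assms(1) by (rule sum.image_gen)
    also have "\<dots> = (\<Sum>q\<in>?Q ` X. ?n *\<^sub>R (u q *\<^sub>R q))"
    proof (rule sum.cong[OF refl])
      fix q assume q: "q \<in> ?Q ` X"
      have "(\<Sum>S\<in>{S \<in> X. ?Q S = q}. \<upsilon> S *\<^sub>R ?Q S) = (\<Sum>S\<in>{S \<in> X. ?Q S = q}. (?n * u q / c q) *\<^sub>R q)"
        by (rule sum.cong) (auto simp: \<upsilon>_def)
      also have "\<dots> = c q *\<^sub>R ((?n * u q / c q) *\<^sub>R q)"
        by (simp only: sum_constant_scaleR c_def)
      also have "\<dots> = ?n *\<^sub>R (u q *\<^sub>R q)"
        using c[OF q] by simp
      finally show "(\<Sum>S\<in>{S \<in> X. ?Q S = q}. \<upsilon> S *\<^sub>R ?Q S) = ?n *\<^sub>R (u q *\<^sub>R q)" .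
    qed
    also have "\<dots> = mat 1"
      unfolding scaleR_sum_right[symmetric] u(2) by simp
    finally have Q: "(\<Sum>S\<in>X. \<upsilon> S *\<^sub>R ?Q S) = mat 1" .
    have "id = (\<lambda>y. \<Sum>S\<in>X. \<upsilon> S *\<^sub>R Q_map S y)"
    proof
      fix y :: "real^'n"
      have "y = (\<Sum>S\<in>X. \<upsilon> S *\<^sub>R ?Q S) *v y"
        by (simp add: Q)
      also have "\<dots> = (\<Sum>S\<in>X. (\<upsilon> S *\<^sub>R ?Q S) *v y)"
        by (rule bounded_bilinear.sum_left[OF bounded_bilinear_matrix_vector_mult])
      also have "\<dots> = (\<Sum>S\<in>X. \<upsilon> S *\<^sub>R Q_map S y)"
        by (simp flip: simplex_matrix_vector_mult scaleR_matrix_vector_assoc)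
      finally show "id y = (\<Sum>S\<in>X. \<upsilon> S *\<^sub>R Q_map S y)"
        by simp
    qed
    moreover have "\<forall>S\<in>X. \<upsilon> S \<ge> 0"
      using u(1) by (simp add: \<upsilon>_def c_def)
    moreover have "\<forall>S\<in>X. \<upsilon> S = \<upsilon> (uminus ` S)"
    proof
      fix S assume S: "S \<in> X"
      then have "uminus ` S \<in> X"
        using assms(3) unfolding symmetric_family_def by blast
      then show "\<upsilon> S = \<upsilon> (uminus ` S)"
        using simplex_matrix_uminus[OF assms(2)[OF S] assms(2)] by (simp add: \<upsilon>_def)
    qed
    ultimately have "semieutactic X"
      unfolding semieutactic_def using assms(1-3) by blast
    then show False
      using assms(4) by blast
  qed
  moreover have "closed (convex hull (?Q ` X))"
    using assms(1) by (intro compact_imp_closed compact_convex_hull finite_imp_compact) auto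
  ultimately obtain a b where ab: "a \<bullet> ((1 / ?n) *\<^sub>R mat 1) < b" "\<And>x. x \<in> convex hull (?Q ` X) \<Longrightarrow> a \<bullet> x > b"
    using separating_hyperplane_closed_point[OF convex_convex_hull] by metis
  have n: "(mat 1 :: real^'n^'n) \<bullet> mat 1 = ?n"
    using norm_mat_1_sq[where 'n = 'n] by (simp add: power2_norm_eq_inner)
  show thesis
  \<comment> \<open>The multiple \<open>b\<close> of the identity shifts the threshold to 0: it
    contributes \<open>b\<close> at every matrix of trace 1.\<close>
  proof (rule that[of "b *\<^sub>R mat 1 - a"])
    show "(b *\<^sub>R mat 1 - a) \<bullet> mat 1 > 0"
      using ab(1) by (simp add: inner_diff_left n field_simps)
    fix S assume S: "S \<in> X"
    have "a \<bullet> ?Q S > b"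
      using S by (intro ab(2) hull_inc) auto
    then show "(b *\<^sub>R mat 1 - a) \<bullet> simplex_matrix S < 0"
      by (simp add: inner_diff_left inner_mat_1_simplex_matrix[OF assms(2)[OF S]])
  qed
qed

text \<open>By affine independence the coefficients of a convex combination equal to 0 are the
  barycentric coordinates.\<close>

lemma barycentric_nonneg:
  assumes "is_lattice \<Lambda>" "voronoi_polytope \<Lambda> \<subseteq> cball 0 1" "v \<in> voronoi_polytope \<Lambda>" "norm v = 1"
    "inscribed_simplex (convex hull vertex_class \<Lambda> v)" "w \<in> vertex_class \<Lambda> v"
  shows "barycentric (convex hull vertex_class \<Lambda> v) 0 w \<ge> 0"
proof -
  obtain u where u: "\<And>w. w \<in> vertex_class \<Lambda> v \<Longrightarrow> 0 \<le> u w" "sum u (vertex_class \<Lambda> v) = 1"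
    "(\<Sum>w\<in>vertex_class \<Lambda> v. u w *\<^sub>R w) = 0"
    using zero_in_convex_hull_vertex_class[OF assms(1-4)] finite_vertex_class[OF assms(1)]
    by (auto simp: convex_hull_finite)
  have "barycentric (convex hull vertex_class \<Lambda> v) 0 w = u w"
    using assms(5,6) u(2,3) by (intro barycentric_unique) (simp_all add: vertices_convex_hull_vertex_class)
  then show ?thesis
    using u(1) assms(6) by simp
qed

subsection \<open>Covering by a body slightly larger than the ball\<close>

lemma eventually_in_translate:
  fixes M :: "nat \<Rightarrow> real^'n^'n"
  assumes "M \<longlonglongrightarrow> mat 1" "x \<longlonglongrightarrow> v" "v - l \<in> interior K"
  shows "\<forall>\<^sub>F k in sequentially. x k - M k *v l \<in> K"
proof -
  have "(\<lambda>k. x k - M k *v l) \<longlonglongrightarrow> v - mat 1 *v l"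
    by (intro tendsto_intros tendsto_matrix_vector_mult assms)
  then have "\<forall>\<^sub>F k in sequentially. x k - M k *v l \<in> interior K"
    using assms(3) by (intro topological_tendstoD) auto
  then show ?thesis
    by eventually_elim (use interior_subset in blast)
qed

lemma norm_sq_three_terms:
  fixes y w n :: "'a::real_inner"
  assumes "norm w = 1"
  shows "(norm (y + (w + t *\<^sub>R n)))\<^sup>2 = (norm y)\<^sup>2 + 2 * (y \<bullet> w) + t * (2 * (y \<bullet> n) + 2 * (w \<bullet> n) + t * (n \<bullet> n)) + 1"
proof -
  have "w \<bullet> w = 1"
    using assms by (simp add: dot_square_norm)
  then show ?thesis
    unfolding power2_norm_eq_inner by (simp add: inner_simps inner_commute algebra_simps)
qed

text \<open>If points \<open>x k\<close> near \<open>v\<close> are not covered, their deviation \<open>y k\<close> from \<open>v\<close> dominates the square root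
  of the size \<open>t k\<close> of the perturbation, and a limit direction of \<open>y k\<close> leads away from all the
  contacts of \<open>v\<close>.\<close>

lemma uncovered_near_contracting_simplex:
  fixes M :: "nat \<Rightarrow> real^'n^'n" and N :: "real^'n^'n"
  assumes \<Lambda>: "is_lattice \<Lambda>" "voronoi_polytope \<Lambda> \<subseteq> cball 0 1"
    and v: "v \<in> voronoi_polytope \<Lambda>" "norm v = 1" "inscribed_simplex (convex hull vertex_class \<Lambda> v)"
    and N: "N \<bullet> simplex_matrix (convex hull vertex_class \<Lambda> v) < 0"
    and M: "M \<longlonglongrightarrow> mat 1" "\<And>k. t k > 0" "t \<longlonglongrightarrow> 0" "\<And>k x. M k *v x = x + t k *\<^sub>R (N *v (M k *v x))"
    and x: "x \<longlonglongrightarrow> v" "\<And>k l. l \<in> \<Lambda> \<Longrightarrow> norm (x k - M k *v l) > 1"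
  shows False
proof -
  let ?C = "vertex_class \<Lambda> v" and ?b = "barycentric (convex hull vertex_class \<Lambda> v) 0"
  have C: "finite ?C" "\<And>w. w \<in> ?C \<Longrightarrow> norm w = 1"
    using finite_vertex_class[OF \<Lambda>(1)] norm_vertex_class[of _ \<Lambda> v] v(2) by simp_all
  have b: "sum ?b ?C = 1" "(\<Sum>w\<in>?C. ?b w *\<^sub>R w) = 0" "\<And>w. w \<in> ?C \<Longrightarrow> ?b w \<ge> 0"
    using barycentric_sums[OF v(3)] barycentric_nonneg[OF \<Lambda> v] by (simp_all add: vertices_convex_hull_vertex_class)
  define y where "y k = x k - M k *v v" for k
  define n where "n k w = N *v (M k *v w)" for k w
  define a where "a k w = 2 * (y k \<bullet> n k w) + 2 * (w \<bullet> n k w) + t k * (n k w \<bullet> n k w)" for k w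
  have Mv: "(\<lambda>k. M k *v w) \<longlonglongrightarrow> w" for w
    using tendsto_matrix_vector_mult[OF M(1) tendsto_const[of w]] by simp
  have y: "y \<longlonglongrightarrow> 0"
    using tendsto_diff[OF x(1) Mv[of v]] by (simp add: y_def[abs_def])
  have n: "(\<lambda>k. n k w) \<longlonglongrightarrow> N *v w" for w
    unfolding n_def by (intro tendsto_matrix_vector_mult tendsto_const Mv)
  have "(\<lambda>k. a k w) \<longlonglongrightarrow> 2 * (0 \<bullet> (N *v w)) + 2 * (w \<bullet> (N *v w)) + 0 * ((N *v w) \<bullet> (N *v w))" for w
    unfolding a_def by (intro tendsto_intros y n M(3))
  then have a: "(\<lambda>k. a k w) \<longlonglongrightarrow> 2 * (w \<bullet> (N *v w))" for w
    by simp
  have I: "0 < (norm (y k))\<^sup>2 + 2 * (y k \<bullet> w) + t k * a k w" if w: "w \<in> ?C" for k w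
  proof -
    have "x k - M k *v (v - w) = y k + (w + t k *\<^sub>R n k w)"
      using M(4)[of k w] by (simp add: y_def n_def matrix_vector_mult_diff_distrib)
    then have "1 < norm (y k + (w + t k *\<^sub>R n k w))"
      using x(2)[OF vertex_class_memD[OF w], of k] by simp
    then have "1 < (norm (y k + (w + t k *\<^sub>R n k w)))\<^sup>2"
      by (simp add: one_less_power)
    then show ?thesis
      unfolding norm_sq_three_terms[OF C(2)[OF w]] a_def by simp
  qed
  \<comment> \<open>The rate of contraction; the weighted mean of the first-order terms
    \<open>a k w\<close> tends to \<open>- 2 * \<delta>\<close>.\<close>
  define \<delta> where "\<delta> = - (\<Sum>w\<in>?C. ?b w * (w \<bullet> (N *v w)))"
  have "\<delta> > 0"
    using N by (simp add: \<delta>_def inner_simplex_matrix vertices_convex_hull_vertex_class)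
  define q where "q k = - (\<Sum>w\<in>?C. ?b w * a k w)" for k
  have "q \<longlonglongrightarrow> - (\<Sum>w\<in>?C. ?b w * (2 * (w \<bullet> (N *v w))))"
    unfolding q_def by (intro tendsto_intros a)
  also have "- (\<Sum>w\<in>?C. ?b w * (2 * (w \<bullet> (N *v w)))) = 2 * \<delta>"
    by (simp add: \<delta>_def sum_distrib_left mult_ac)
  finally have "\<forall>\<^sub>F k in sequentially. q k > \<delta>"
    using \<open>\<delta> > 0\<close> by (intro order_tendstoD) auto
  then have ty: "\<forall>\<^sub>F k in sequentially. t k * \<delta> \<le> (norm (y k))\<^sup>2"
  proof eventually_elim
    case (elim k)
    \<comment> \<open>Averaging with the barycentric weights removes the terms linear in
      \<open>y k\<close>, so only its square can compensate the contraction.\<close>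
    have "0 \<le> (\<Sum>w\<in>?C. ?b w * ((norm (y k))\<^sup>2 + 2 * (y k \<bullet> w) + t k * a k w))"
      using b(3) I by (intro sum_nonneg mult_nonneg_nonneg) (auto intro: less_imp_le)
    also have "\<dots> = sum ?b ?C * (norm (y k))\<^sup>2 + 2 * (y k \<bullet> (\<Sum>w\<in>?C. ?b w *\<^sub>R w)) - t k * q k"
      by (simp add: q_def ring_distribs sum.distrib inner_sum_right sum_distrib_left sum_distrib_right mult_ac)
    finally have "t k * q k \<le> (norm (y k))\<^sup>2"
      by (simp add: b)
    moreover have "t k * \<delta> \<le> t k * q k"
      using elim M(2)[of k] by (intro mult_left_mono) auto
    ultimately show ?case
      by simp
  qed
  have "sgn (y k) \<in> cball 0 1" for k
    by (simp add: norm_sgn)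
  then obtain u and r :: "nat \<Rightarrow> nat" where r: "strict_mono r" "((\<lambda>k. sgn (y k)) \<circ> r) \<longlonglongrightarrow> u"
    using compact_cball[of 0 1] unfolding compact_def by (metis (no_types, lifting))
  have u: "(\<lambda>k. sgn (y (r k))) \<longlonglongrightarrow> u"
    using r(2) by (simp add: o_def)
  have ty': "\<forall>\<^sub>F k in sequentially. t (r k) * \<delta> \<le> (norm (y (r k)))\<^sup>2"
    using eventually_subseq[OF r(1) ty] .
  have pos: "\<forall>\<^sub>F k in sequentially. norm (y (r k)) > 0"
    using ty'
  proof eventually_elim
    case (elim k)
    have "t (r k) * \<delta> > 0"
      using M(2) \<open>\<delta> > 0\<close> by simp
    then show ?case
      using elim by (cases "y (r k) = 0") auto
  qed
  have "(\<lambda>k. norm (sgn (y (r k)))) \<longlonglongrightarrow> norm u"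
    by (intro tendsto_norm u)
  moreover have "\<forall>\<^sub>F k in sequentially. norm (sgn (y (r k))) = 1"
    using pos by eventually_elim (simp add: norm_sgn)
  then have "(\<lambda>k. norm (sgn (y (r k)))) \<longlonglongrightarrow> 1"
    by (rule tendsto_eventually)
  ultimately have "norm u = 1"
    by (rule LIMSEQ_unique)
  have "u \<bullet> w \<ge> 0" if w: "w \<in> ?C" for w
  proof -
    \<comment> \<open>After division by \<open>norm (y (r k))\<close> the perturbation contributes
      at most a multiple of that norm, as \<open>t\<close> is at most its square over
      \<open>\<delta>\<close>. Only the direction term survives in the limit.\<close>
    have "\<forall>\<^sub>F k in sequentially. 0 \<le> norm (y (r k)) + 2 * (sgn (y (r k)) \<bullet> w) + norm (y (r k)) / \<delta> * \<bar>a (r k) w\<bar>"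
      using ty' pos
    proof eventually_elim
      case (elim k)
      let ?y = "y (r k)"
      have "t (r k) * a (r k) w \<le> t (r k) * \<bar>a (r k) w\<bar>"
        using M(2)[of "r k"] by (intro mult_left_mono) auto
      also have "\<dots> \<le> ((norm ?y)\<^sup>2 / \<delta>) * \<bar>a (r k) w\<bar>"
        using elim(1) \<open>\<delta> > 0\<close> by (intro mult_right_mono) (auto simp: pos_le_divide_eq)
      finally have "t (r k) * a (r k) w \<le> ((norm ?y)\<^sup>2 / \<delta>) * \<bar>a (r k) w\<bar>" .
      then have "0 \<le> (norm ?y)\<^sup>2 + 2 * (?y \<bullet> w) + ((norm ?y)\<^sup>2 / \<delta>) * \<bar>a (r k) w\<bar>"
        using I[OF w, of "r k"] by linarith
      also have "\<dots> = norm ?y * (norm ?y + 2 * (sgn ?y \<bullet> w) + norm ?y / \<delta> * \<bar>a (r k) w\<bar>)"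
      proof -
        have "?y \<bullet> w = norm ?y * (sgn ?y \<bullet> w)"
          using elim(2) by (simp add: sgn_div_norm)
        then show ?thesis
          by (simp only: ring_distribs power2_eq_square) simp
      qed
      finally show ?case
        using elim(2) by (simp add: zero_le_mult_iff)
    qed
    moreover have "(\<lambda>k. norm (y (r k)) + 2 * (sgn (y (r k)) \<bullet> w) + norm (y (r k)) / \<delta> * \<bar>a (r k) w\<bar>)
        \<longlonglongrightarrow> norm (0 :: real^'n) + 2 * (u \<bullet> w) + norm (0 :: real^'n) / \<delta> * \<bar>2 * (w \<bullet> (N *v w))\<bar>"
      using \<open>\<delta> > 0\<close> LIMSEQ_subseq_LIMSEQ[OF y r(1)] LIMSEQ_subseq_LIMSEQ[OF a[of w] r(1)]
      by (intro tendsto_intros u) (auto simp: o_def)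
    ultimately have "0 \<le> norm (0 :: real^'n) + 2 * (u \<bullet> w) + norm (0 :: real^'n) / \<delta> * \<bar>2 * (w \<bullet> (N *v w))\<bar>"
      by (intro tendsto_lowerbound[where F = sequentially]) auto
    then show ?thesis
      by simp
  qed
  then have "u = 0"
    by (rule unit_vertex_positivity[OF \<Lambda> v(1,2)])
  then show False
    using \<open>norm u = 1\<close> by simp
qed

text \<open>Uncovered points accumulate at a unit vertex \<open>v\<close>. If the class of
  \<open>v\<close> contains one of the two points interior to \<open>K\<close>, then
  \<open>K\<close> covers them nevertheless; otherwise the contracting simplex at \<open>v\<close>
  contradicts \<open>uncovered_near_contracting_simplex\<close>.\<close>

lemma eventually_covering:
  fixes M :: "nat \<Rightarrow> real^'n^'n" and N :: "real^'n^'n"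
  assumes \<Lambda>: "is_lattice \<Lambda>" "voronoi_polytope \<Lambda> \<subseteq> cball 0 1"
    and ins: "\<And>v. v \<in> voronoi_polytope \<Lambda> \<Longrightarrow> norm v = 1 \<Longrightarrow> inscribed_simplex (convex hull vertex_class \<Lambda> v)"
    and K: "cball 0 1 \<subseteq> K" "v\<^sub>0 \<in> interior K" "- v\<^sub>0 \<in> interior K"
    and N: "\<And>v. v \<in> voronoi_polytope \<Lambda> \<Longrightarrow> norm v = 1 \<Longrightarrow> v\<^sub>0 \<notin> vertex_class \<Lambda> v \<Longrightarrow> - v\<^sub>0 \<notin> vertex_class \<Lambda> v \<Longrightarrow>
      N \<bullet> simplex_matrix (convex hull vertex_class \<Lambda> v) < 0"
    and M: "M \<longlonglongrightarrow> mat 1" "\<And>k. t k > 0" "t \<longlonglongrightarrow> 0" "\<And>k x. M k *v x = x + t k *\<^sub>R (N *v (M k *v x))"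
      "\<And>k. invertible (M k)"
  shows "\<forall>\<^sub>F k in sequentially. covering_lattice K ((*v) (M k) ` \<Lambda>)"
proof (rule ccontr)
  assume "\<not> ?thesis"
  then have "\<exists>\<^sub>F k in sequentially. \<not> covering_lattice K ((*v) (M k) ` \<Lambda>)"
    by (simp add: not_eventually)
  then have "\<exists>\<^sub>F k in sequentially. \<not> covering_lattice K ((*v) (M k) ` \<Lambda>) \<and> (\<forall>x. norm (M k *v x) \<le> 2 * norm x)"
    by (rule frequently_rev_mp) (rule eventually_mono[OF eventually_matrix_norm_bounds[OF M(1)]], simp)
  then obtain r :: "nat \<Rightarrow> nat" where r: "strict_mono r" "\<And>k. \<not> covering_lattice K ((*v) (M (r k)) ` \<Lambda>)"
    "\<And>k x. norm (M (r k) *v x) \<le> 2 * norm x"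
    using frequently_subsequence by (metis (no_types, lifting))
  \<comment> \<open>Being uncovered is invariant under lattice translations, so the point may be
    taken in the bounded Voronoi polytope.\<close>
  have "\<exists>x. x \<in> voronoi_polytope ((*v) (M (r k)) ` \<Lambda>) \<and> (\<forall>l\<in>\<Lambda>. x - M (r k) *v l \<notin> K)" for k
  proof -
    let ?L = "(*v) (M (r k)) ` \<Lambda>"
    have L: "is_lattice ?L"
      using \<Lambda>(1) M(5) by (rule is_lattice_matrix_image)
    then obtain z where z: "\<forall>l\<in>?L. z - l \<notin> K"
      using r(2)[of k] unfolding covering_lattice_iff by blast
    obtain l where l: "l \<in> ?L" "z - l \<in> voronoi_polytope ?L"
      using voronoi_polytope_nearest[OF L] .
    have "z - l - l' \<notin> K" if "l' \<in> ?L" for l'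
      using bspec[OF z lattice_add[OF L l(1) that]] by (simp add: diff_diff_eq)
    then show ?thesis
      using l(2) by blast
  qed
  then obtain x where x: "\<And>k. x k \<in> voronoi_polytope ((*v) (M (r k)) ` \<Lambda>)" "\<And>k l. l \<in> \<Lambda> \<Longrightarrow> x k - M (r k) *v l \<notin> K"
    by metis
  have "x k \<in> cball 0 2" for k
    using voronoi_matrix_image_subset[OF \<Lambda> M(5) r(3)] x(1) by blast
  then obtain v and s :: "nat \<Rightarrow> nat" where s: "strict_mono s" "(x \<circ> s) \<longlonglongrightarrow> v"
    using compact_cball[of 0 2] unfolding compact_def by (metis (no_types, lifting))
  have rs: "strict_mono (r \<circ> s)"
    using r(1) s(1) by (rule strict_mono_o)
  have xv: "(\<lambda>k. x (s k)) \<longlonglongrightarrow> v" and M': "(\<lambda>k. M (r (s k))) \<longlonglongrightarrow> mat 1" and t': "(\<lambda>k. t (r (s k))) \<longlonglongrightarrow> 0"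
    using s(2) LIMSEQ_subseq_LIMSEQ[OF M(1) rs] LIMSEQ_subseq_LIMSEQ[OF M(3) rs] by (simp_all add: o_def)
  have nK: "norm (x (s k) - M (r (s k)) *v l) > 1" if "l \<in> \<Lambda>" for k l
    using x(2)[OF that, of "s k"] K(1) by force
  have vP: "v \<in> voronoi_polytope \<Lambda>"
    using x(1) by (intro voronoi_polytope_limit[OF M' xv])
  have "norm (x (s k)) \<ge> 1" for k
    using nK[OF lattice_zero[OF \<Lambda>(1)], of k] by simp
  then have "norm v \<ge> 1"
    by (intro tendsto_lowerbound[OF tendsto_norm[OF xv]]) simp_all
  then have nv: "norm v = 1"
    using vP \<Lambda>(2) by force
  \<comment> \<open>The lattice vector \<open>v - w\<close> moves points near \<open>v\<close> to
    points near \<open>w\<close>, eventually inside \<open>K\<close>.\<close>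
  have int: False if w: "w \<in> vertex_class \<Lambda> v" "w \<in> interior K" for w
  proof -
    have "\<forall>\<^sub>F k in sequentially. x (s k) - M (r (s k)) *v (v - w) \<in> K"
      using w(2) by (intro eventually_in_translate[OF M' xv]) simp
    then show False
      using x(2)[OF vertex_class_memD[OF w(1)]] by simp
  qed
  show False
  proof (rule uncovered_near_contracting_simplex[OF \<Lambda> vP nv ins[OF vP nv] N[OF vP nv] M' M(2) t' M(4) xv nK])
    show "v\<^sub>0 \<notin> vertex_class \<Lambda> v" "- v\<^sub>0 \<notin> vertex_class \<Lambda> v"
      using int K by blast+
  qed
qed

section \<open>Volume-increasing deformations\<close>

lemma abs_det_less_1:
  fixes A :: "real^'n^'n"
  assumes "(norm A)\<^sup>2 < CARD('n)"
  shows "\<bar>det A\<bar> < 1"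
proof (cases "A = 0")
  case True
  then show ?thesis
    by (simp flip: mat_0)
next
  case False
  define s where "s = sqrt (CARD('n)) / norm A"
  have "norm A < sqrt (CARD('n))"
    using assms by (rule real_less_rsqrt)
  then have "s > 1"
    using False by (simp add: s_def)
  have "norm (s *\<^sub>R A) = sqrt (CARD('n))"
    using False by (simp add: s_def)
  then have "(norm (s *\<^sub>R A))\<^sup>2 \<le> CARD('n)"
    by simp
  then have "\<bar>det (s *\<^sub>R A)\<bar> \<le> 1"
    by (rule abs_det_le_1)
  then have le: "s ^ CARD('n) * \<bar>det A\<bar> \<le> 1"
    using \<open>s > 1\<close> by (simp add: det_scaleR abs_mult)
  have "s ^ CARD('n) > 1"
    using \<open>s > 1\<close> by (intro one_less_power) auto
  show ?thesis
  proof (rule ccontr)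
    assume "\<not> \<bar>det A\<bar> < 1"
    then have "s ^ CARD('n) * 1 \<le> s ^ CARD('n) * \<bar>det A\<bar>"
      using \<open>s > 1\<close> by (intro mult_left_mono) auto
    then show False
      using le \<open>s ^ CARD('n) > 1\<close> by linarith
  qed
qed

text \<open>The maps are the inverses of \<open>mat 1 - t k *\<^sub>R N\<close>, so that the upper bound for determinants applies.\<close>

lemma volume_increasing_sequence:
  fixes N :: "real^'n^'n"
  assumes "N \<bullet> mat 1 > 0"
  obtains M :: "nat \<Rightarrow> real^'n^'n" and t :: "nat \<Rightarrow> real" where "M \<longlonglongrightarrow> mat 1" "\<And>k. t k > 0" "t \<longlonglongrightarrow> 0"
    "\<And>k x. M k *v x = x + t k *\<^sub>R (N *v (M k *v x))" "\<And>k. invertible (M k)" "\<And>k. \<bar>det (M k)\<bar> > 1"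
proof -
  define t0 where "t0 k = inverse (real (Suc k))" for k
  define A0 where "A0 k = mat 1 - t0 k *\<^sub>R N" for k
  have t0: "t0 \<longlonglongrightarrow> 0"
    unfolding t0_def by (rule LIMSEQ_inverse_real_of_nat)
  have "A0 \<longlonglongrightarrow> mat 1 - 0 *\<^sub>R N"
    unfolding A0_def by (intro tendsto_intros t0)
  then have A0: "A0 \<longlonglongrightarrow> mat 1"
    by simp
  have "(\<lambda>k. t0 k * (norm N)\<^sup>2) \<longlonglongrightarrow> 0 * (norm N)\<^sup>2"
    by (intro tendsto_intros t0)
  then have "\<forall>\<^sub>F k in sequentially. t0 k * (norm N)\<^sup>2 < 2 * (N \<bullet> mat 1)"
    using assms by (intro order_tendstoD) auto
  then have "\<forall>\<^sub>F k in sequentially. t0 k * (norm N)\<^sup>2 < 2 * (N \<bullet> mat 1) \<and> invertible (A0 k)"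
    using eventually_invertible_near_identity[OF A0] by (rule eventually_conj)
  then obtain K where K: "\<And>k. k \<ge> K \<Longrightarrow> t0 k * (norm N)\<^sup>2 < 2 * (N \<bullet> mat 1)" "\<And>k. k \<ge> K \<Longrightarrow> invertible (A0 k)"
    unfolding eventually_sequentially by blast
  define t where "t k = t0 (k + K)" for k
  define A where "A k = mat 1 - t k *\<^sub>R N" for k
  have AA: "A k = A0 (k + K)" for k
    by (simp add: A_def A0_def t_def)
  have t: "t \<longlonglongrightarrow> 0" "\<And>k. t k > 0"
    unfolding t_def using LIMSEQ_ignore_initial_segment[OF t0] by (auto simp: t0_def)
  have A: "A \<longlonglongrightarrow> mat 1" "\<And>k. invertible (A k)"
    unfolding AA using LIMSEQ_ignore_initial_segment[OF A0] K(2) by auto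
  define M where "M k = matrix_inv (A k)" for k
  have Mx: "M k *v x = x + t k *\<^sub>R (N *v (M k *v x))" for k x
  proof -
    have "x = A k *v (M k *v x)"
      by (simp add: M_def matrix_inv_vector_mult A)
    also have "\<dots> = M k *v x - t k *\<^sub>R (N *v (M k *v x))"
      by (simp only: A_def matrix_vector_mult_diff_rdistrib matrix_vector_mul_lid flip: scaleR_matrix_vector_assoc)
    finally show ?thesis
      by (simp add: algebra_simps)
  qed
  have "(\<lambda>k. M k *v x) \<longlonglongrightarrow> x" for x
  proof -
    have "\<forall>\<^sub>F k in sequentially. norm (M k *v x - x) \<le> t k * (norm N * (2 * norm x))"
      using eventually_matrix_norm_bounds[OF A(1)]
    proof eventually_elim
      case (elim k)
      have "norm (M k *v x) \<le> 2 * norm (A k *v (M k *v x))"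
        using elim by blast
      then have Mb: "norm (M k *v x) \<le> 2 * norm x"
        by (simp add: M_def matrix_inv_vector_mult A)
      have "norm (M k *v x - x) = t k * norm (N *v (M k *v x))"
        using Mx[of k x] t(2)[of k] by (metis abs_of_pos add_diff_cancel_left' norm_scaleR)
      also have "\<dots> \<le> t k * (norm N * norm (M k *v x))"
        using t(2)[of k] matrix_vector_mult_le_norm by (intro mult_left_mono) auto
      also have "\<dots> \<le> t k * (norm N * (2 * norm x))"
        using t(2)[of k] Mb by (intro mult_left_mono) auto
      finally show ?case .
    qed
    moreover have "(\<lambda>k. t k * (norm N * (2 * norm x))) \<longlonglongrightarrow> 0"
      by (rule tendsto_mult_left_zero[OF t(1)])
    ultimately have "(\<lambda>k. M k *v x - x) \<longlonglongrightarrow> 0"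
      by (rule Lim_null_comparison)
    then show ?thesis
      by (simp add: LIM_zero_iff)
  qed
  then have "(\<lambda>k. (M k *v axis j 1) $ i) \<longlonglongrightarrow> axis j 1 $ i" for i j
    by (rule tendsto_vec_nth)
  moreover have "(M k *v axis j 1) $ i = M k $ i $ j" for k i j
    unfolding matrix_vector_mult_basis by (simp add: column_def)
  moreover have "(mat 1 :: real^'n^'n) $ i $ j = axis j 1 $ i" for i j
    by (simp add: mat_def axis_def)
  ultimately have "(\<lambda>k. M k $ i $ j) \<longlonglongrightarrow> (mat 1 :: real^'n^'n) $ i $ j" for i j
    by (simp only:)
  then have "M \<longlonglongrightarrow> mat 1"
    by (intro vec_tendstoI)
  moreover have "invertible (M k)" for k
    unfolding M_def using A(2) by (rule invertible_matrix_inv)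
  moreover have "\<bar>det (M k)\<bar> > 1" for k
  proof -
    \<comment> \<open>The term linear in \<open>t k\<close> is negative and outweighs the quadratic
      one by the choice of \<open>K\<close>. So \<open>A k\<close> shrinks volume and its inverse
      expands it.\<close>
    have "(norm (A k))\<^sup>2 = CARD('n) + t k * (t k * (norm N)\<^sup>2 - 2 * (N \<bullet> mat 1))"
      using inner_add_scaleR_self[of "mat 1" "- t k" N] norm_mat_1_sq[where 'n = 'n]
      by (simp add: A_def power2_norm_eq_inner algebra_simps)
    also have "\<dots> < CARD('n)"
      using K(1)[of "k + K"] t(2)[of k] by (simp add: mult_pos_neg t_def)
    finally have "\<bar>det (A k)\<bar> < 1"
      by (rule abs_det_less_1)
    moreover have "\<bar>det (A k)\<bar> > 0"
      using A(2) by (simp add: invertible_det_nz)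
    moreover have "\<bar>det (M k)\<bar> * \<bar>det (A k)\<bar> = 1"
      using arg_cong[OF matrix_inv_mult(2)[OF A(2)], of det k] by (simp add: M_def det_mul flip: abs_mult)
    ultimately show ?thesis
      by (metis abs_ge_zero linorder_not_le mult_left_le_one_le order_less_irrefl order_le_less_trans)
  qed
  ultimately show thesis
    using that[of M t] t Mx by blast
qed


subsection \<open>Caps on the ball\<close>

definition capped_ball :: "real \<Rightarrow> real^'n \<Rightarrow> (real^'n) set" where
  "capped_ball \<epsilon> u = convex hull (cball 0 1 \<union> {(1 + \<epsilon>) *\<^sub>R u, - ((1 + \<epsilon>) *\<^sub>R u)})"

lemma capped_ball_subset_cball:
  assumes "norm u = 1" "\<epsilon> \<ge> 0"
  shows "capped_ball \<epsilon> u \<subseteq> cball 0 (1 + \<epsilon>)"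
  unfolding capped_ball_def using assms by (intro hull_minimal) auto

lemma cball_subset_capped_ball: "cball 0 1 \<subseteq> capped_ball \<epsilon> u"
  unfolding capped_ball_def by (rule order_trans[OF Un_upper1 hull_subset])

lemma body_capped_ball: "body (capped_ball \<epsilon> u)"
proof -
  let ?S = "cball 0 1 \<union> {(1 + \<epsilon>) *\<^sub>R u, - ((1 + \<epsilon>) *\<^sub>R u)}"
  have "compact (capped_ball \<epsilon> u)"
    unfolding capped_ball_def by (intro compact_convex_hull compact_Un) (auto simp: finite_imp_compact)
  moreover have "0 \<in> interior (capped_ball \<epsilon> u)"
    using subsetD[OF interior_mono[OF cball_subset_capped_ball[of \<epsilon> u]], of 0] by (simp add: interior_cball)
  moreover have "uminus ` ?S = ?S"
  proof
    show *: "uminus ` ?S \<subseteq> ?S"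
      by auto
    show "?S \<subseteq> uminus ` ?S"
      using image_mono[OF *, of uminus] unfolding uminus_image_involutive .
  qed
  then have "uminus ` capped_ball \<epsilon> u = capped_ball \<epsilon> u"
    unfolding capped_ball_def uminus_convex_hull by simp
  then have "(\<lambda>y. 2 *\<^sub>R 0 - y) ` capped_ball \<epsilon> u = capped_ball \<epsilon> u"
    by simp
  moreover have "convex (capped_ball \<epsilon> u)"
    unfolding capped_ball_def by (rule convex_convex_hull)
  ultimately show ?thesis
    unfolding body_def by blast
qed

text \<open>For \<open>q\<close> other than \<open>u\<close> and \<open>- u\<close>, the half-space
  bounded by the tangent hyperplane at the direction of \<open>p k\<close> contains the ball and,
  for small caps, both apices. It then contains the capped ball, but not \<open>p k\<close>.\<close>

lemma capped_ball_limit: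
  assumes u: "norm u = 1" and \<epsilon>: "\<And>k. \<epsilon> k \<ge> 0" "\<epsilon> \<longlonglongrightarrow> (0::real)"
    and p: "\<And>k. p k \<in> capped_ball (\<epsilon> k) u" "\<And>k. norm (p k) > 1" "p \<longlonglongrightarrow> q" and q: "norm q = 1"
  shows "q = u \<or> q = - u"
proof (rule ccontr)
  assume "\<not> ?thesis"
  then have ne: "q \<noteq> u" "q \<noteq> - u"
    by auto
  have "(norm (q - u))\<^sup>2 > 0" "(norm (q + u))\<^sup>2 > 0"
    using ne by (simp_all add: eq_neg_iff_add_eq_0)
  moreover have "(norm (q - u))\<^sup>2 = 2 - 2 * (q \<bullet> u)" "(norm (q + u))\<^sup>2 = 2 + 2 * (q \<bullet> u)"
    using u q norm_add_scaleR_sq[of q "-1" u] norm_add_scaleR_sq[of q 1 u] by (simp_all add: inner_commute)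
  ultimately have lt: "q \<bullet> u < 1" "- (q \<bullet> u) < 1"
    by linarith+
  have n: "(\<lambda>k. sgn (p k)) \<longlonglongrightarrow> q"
  proof -
    have "q \<noteq> 0" "sgn q = q"
      using q by (auto simp: sgn_div_norm)
    then show ?thesis
      using tendsto_sgn[OF p(3)] by simp
  qed
  have lim: "(\<lambda>k. (1 + \<epsilon> k) * (sgn (p k) \<bullet> u)) \<longlonglongrightarrow> (1 + 0) * (q \<bullet> u)" "(\<lambda>k. - ((1 + \<epsilon> k) * (sgn (p k) \<bullet> u))) \<longlonglongrightarrow> - ((1 + 0) * (q \<bullet> u))"
    by (intro tendsto_intros n \<epsilon>)+
  have "\<forall>\<^sub>F k in sequentially. (1 + \<epsilon> k) * (sgn (p k) \<bullet> u) < 1" "\<forall>\<^sub>F k in sequentially. - ((1 + \<epsilon> k) * (sgn (p k) \<bullet> u)) < 1"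
    by (rule order_tendstoD(2)[OF lim(1)], use lt in simp) (rule order_tendstoD(2)[OF lim(2)], use lt in simp)
  then have "\<forall>\<^sub>F k in sequentially. False"
  proof eventually_elim
    case (elim k)
    have "capped_ball (\<epsilon> k) u \<subseteq> {x. sgn (p k) \<bullet> x \<le> 1}"
      unfolding capped_ball_def
    proof (rule hull_minimal)
      show "convex {x. sgn (p k) \<bullet> x \<le> 1}"
        by (rule convex_halfspace_le)
      have "sgn (p k) \<bullet> x \<le> 1" if "x \<in> cball 0 1" for x
      proof -
        have "sgn (p k) \<bullet> x \<le> norm (sgn (p k)) * norm x"
          by (rule norm_cauchy_schwarz)
        also have "\<dots> \<le> 1 * 1"
          using that by (intro mult_mono) (auto simp: norm_sgn)
        finally show ?thesis by simp
      qed
      then show "cball 0 1 \<union> {(1 + \<epsilon> k) *\<^sub>R u, - ((1 + \<epsilon> k) *\<^sub>R u)} \<subseteq> {x. sgn (p k) \<bullet> x \<le> 1}"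
        using elim by auto
    qed
    then have "sgn (p k) \<bullet> p k \<le> 1"
      using p(1) by blast
    moreover have "sgn (p k) \<bullet> p k = norm (p k)"
    proof -
      have "p k \<noteq> 0"
        using p(2)[of k] by auto
      then show ?thesis
        by (simp add: sgn_div_norm dot_square_norm power2_eq_square)
    qed
    ultimately show False
      using p(2)[of k] by simp
  qed
  then show False
    by simp
qed

lemma dual_basis:
  fixes D :: "'a::euclidean_space set"
  assumes "independent D"
  obtains p where "\<And>l l'. l' \<in> D \<Longrightarrow> p l \<bullet> l' = (if l' = l then 1 else 0)"
proof -
  have "\<exists>f :: 'a \<Rightarrow> real. linear f \<and> (\<forall>x\<in>D. f x = (if x = l then 1 else 0))" for l
    by (rule linear_independent_extend[OF assms])
  then obtain f :: "'a \<Rightarrow> 'a \<Rightarrow> real" where f: "\<And>l. linear (f l)" "\<And>l x. x \<in> D \<Longrightarrow> f l x = (if x = l then 1 else 0)"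
    by metis
  have "adjoint (f l) 1 \<bullet> x = f l x" for l x
    using adjoint_works[OF f(1), of x l 1] by (simp add: inner_commute)
  then show thesis
    using f(2) by (intro that[of "\<lambda>l. adjoint (f l) 1"]) simp
qed

text \<open>If the weighted mean of \<open>norm (M k *v w)\<^sup>2\<close> over a maximal simplex exceeds 1, the points equidistant
  from the perturbed contacts are only covered by the caps.\<close>

lemma covering_by_caps_imp_mean_le_1:
  fixes M :: "nat \<Rightarrow> real^'n^'n"
  assumes \<Lambda>: "is_lattice \<Lambda>" "voronoi_polytope \<Lambda> \<subseteq> cball 0 1"
    and v: "v \<in> voronoi_polytope \<Lambda>" "norm v = 1" "inscribed_simplex (convex hull vertex_class \<Lambda> v)"
    and ind: "independent (contacts \<Lambda> v - {0})"
    and u: "norm u = 1" "u \<notin> vertex_class \<Lambda> v" "- u \<notin> vertex_class \<Lambda> v"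
    and \<epsilon>: "\<And>k. \<epsilon> k \<ge> 0" "\<epsilon> \<longlonglongrightarrow> 0"
    and M: "M \<longlonglongrightarrow> mat 1" "\<And>k. invertible (M k)"
    and cov: "\<And>k x. \<exists>l\<in>\<Lambda>. x - M k *v l \<in> capped_ball (\<epsilon> k) u"
    and big: "\<And>k. (\<Sum>w\<in>vertex_class \<Lambda> v. barycentric (convex hull vertex_class \<Lambda> v) 0 w * (norm (M k *v w))\<^sup>2) > 1"
  shows False
proof -
  let ?C = "vertex_class \<Lambda> v" and ?b = "barycentric (convex hull vertex_class \<Lambda> v) 0" and ?D = "contacts \<Lambda> v - {0}"
  have C: "finite ?C" "\<And>w. w \<in> ?C \<Longrightarrow> norm w = 1"
    using finite_vertex_class[OF \<Lambda>(1)] norm_vertex_class[of _ \<Lambda> v] v(2) by simp_all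
  have b: "sum ?b ?C = 1" "(\<Sum>w\<in>?C. ?b w *\<^sub>R w) = 0"
    using barycentric_sums[OF v(3)] by (simp_all add: vertices_convex_hull_vertex_class)
  have finD: "finite ?D"
    using finite_contacts[OF \<Lambda>(1)] by simp
  obtain p where p: "\<And>l l'. l' \<in> ?D \<Longrightarrow> p l \<bullet> l' = (if l' = l then 1 else (0::real))"
    using dual_basis[OF ind] by metis
  define G where "G k = (\<Sum>w\<in>?C. ?b w * (norm (M k *v w))\<^sup>2)" for k
  \<comment> \<open>The value that \<open>y \<bullet> (M k *v w)\<close> must take in order that
    \<open>norm (y + M k *v w)^2\<close> equals \<open>norm y ^ 2 + G k\<close> for every
    \<open>w\<close>.\<close>
  define g where "g k w = (G k - (norm (M k *v w))\<^sup>2) / 2" for k w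
  \<comment> \<open>The dual basis prescribes the inner products with the contacts, that is, the
    differences of the values on the class.\<close>
  define z where "z k = (\<Sum>l\<in>?D. (g k v - g k (v - l)) *\<^sub>R p l)" for k
  have Mw: "(\<lambda>k. M k *v w) \<longlonglongrightarrow> w" for w
    using tendsto_matrix_vector_mult[OF M(1) tendsto_const[of w]] by simp
  have "G \<longlonglongrightarrow> (\<Sum>w\<in>?C. ?b w * (norm w)\<^sup>2)"
    unfolding G_def by (intro tendsto_intros Mw)
  then have G: "G \<longlonglongrightarrow> 1"
    using b(1) C(2) by simp
  have g: "(\<lambda>k. g k w) \<longlonglongrightarrow> 0" if "w \<in> ?C" for w
  proof -
    have "(\<lambda>k. g k w) \<longlonglongrightarrow> (1 - (norm w)\<^sup>2) / 2"
      unfolding g_def by (intro tendsto_intros G Mw) simp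
    then show ?thesis
      using C(2)[OF that] by simp
  qed
  have vl: "v - l \<in> ?C" if "l \<in> contacts \<Lambda> v" for l
    using that by (simp add: vertex_class_def)
  have vC: "v \<in> ?C"
    by (rule vertex_class_self[OF \<Lambda>(1)])
  have "z \<longlonglongrightarrow> (\<Sum>l\<in>?D. (0 - 0) *\<^sub>R p l)"
    unfolding z_def by (intro tendsto_intros g vC vl) auto
  then have z0: "z \<longlonglongrightarrow> 0"
    by simp
  have zl: "z k \<bullet> l = g k v - g k (v - l)" if l: "l \<in> contacts \<Lambda> v" for k l
  proof (cases "l = 0")
    case False
    have "z k \<bullet> l = (\<Sum>l'\<in>?D. (g k v - g k (v - l')) * (p l' \<bullet> l))"
      by (simp add: z_def inner_sum_left)
    also have "\<dots> = (\<Sum>l'\<in>?D. if l' = l then g k v - g k (v - l') else 0)"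
      using l False by (intro sum.cong refl) (auto simp: p)
    also have "\<dots> = g k v - g k (v - l)"
      using finD l False by simp
    finally show ?thesis .
  qed simp
  have zw: "z k \<bullet> w = g k w" if w: "w \<in> ?C" for k w
  proof -
    \<comment> \<open>The remaining common offset. It vanishes because the weighted sum of the class
      is 0 and \<open>g\<close> has weighted mean 0, \<open>G\<close> being the mean.\<close>
    define c where "c = z k \<bullet> v - g k v"
    have zc: "z k \<bullet> w' = c + g k w'" if w': "w' \<in> ?C" for w'
    proof -
      obtain l where "l \<in> contacts \<Lambda> v" "w' = v - l"
        using w' unfolding vertex_class_def by blast
      then show ?thesis
        using zl[of l k] by (simp add: c_def inner_diff_right)
    qed
    have bg: "(\<Sum>w\<in>?C. ?b w * g k w) = (sum ?b ?C * G k - (\<Sum>w\<in>?C. ?b w * (norm (M k *v w))\<^sup>2)) / 2"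
      by (simp add: g_def sum_distrib_right right_diff_distrib sum_subtractf sum_divide_distrib diff_divide_distrib)
    have "0 = z k \<bullet> (\<Sum>w\<in>?C. ?b w *\<^sub>R w)"
      by (simp add: b)
    also have "\<dots> = (\<Sum>w\<in>?C. ?b w * (c + g k w))"
      by (simp add: inner_sum_right zc)
    also have "\<dots> = sum ?b ?C * c + (\<Sum>w\<in>?C. ?b w * g k w)"
      by (simp add: ring_distribs sum.distrib sum_distrib_right)
    finally have "c = 0"
      unfolding bg b(1) by (simp flip: G_def)
    then show ?thesis
      using zc[OF w] by simp
  qed
  \<comment> \<open>Transposed inverse, so that
    \<open>y k \<bullet> (M k *v w) = z k \<bullet> w\<close>.\<close>
  define y where "y k = z k v* matrix_inv (M k)" for k
  have yx: "y k \<bullet> x = z k \<bullet> (matrix_inv (M k) *v x)" for k x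
    by (simp add: y_def dot_lmul_matrix)
  have "\<forall>\<^sub>F k in sequentially. norm (y k) \<le> norm (z k) * 2"
    using eventually_matrix_norm_bounds[OF M(1)]
  proof eventually_elim
    case (elim k)
    have "norm (matrix_inv (M k) *v y k) \<le> 2 * norm (M k *v (matrix_inv (M k) *v y k))"
      using elim by blast
    then have "norm (matrix_inv (M k) *v y k) \<le> 2 * norm (y k)"
      by (simp add: matrix_inv_vector_mult M(2))
    then have "norm (z k) * norm (matrix_inv (M k) *v y k) \<le> norm (z k) * (2 * norm (y k))"
      by (intro mult_left_mono) auto
    moreover have "norm (y k) * norm (y k) = z k \<bullet> (matrix_inv (M k) *v y k)"
      by (simp flip: yx dot_square_norm power2_eq_square)
    ultimately have "norm (y k) * norm (y k) \<le> (norm (z k) * 2) * norm (y k)"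
      using norm_cauchy_schwarz[of "z k" "matrix_inv (M k) *v y k"] by simp
    then show ?case
      by (cases "y k = 0") auto
  qed
  then have y0: "y \<longlonglongrightarrow> 0"
    using tendsto_mult_left_zero[OF tendsto_norm_zero[OF z0], of 2] by (rule Lim_null_comparison)
  define x where "x k = M k *v v + y k" for k
  have xv: "x \<longlonglongrightarrow> v"
    using tendsto_add[OF Mw[of v] y0] by (simp add: x_def[abs_def])
  have far: "norm (x k - M k *v (v - w)) > 1" if w: "w \<in> ?C" for k w
  proof -
    have "x k - M k *v (v - w) = y k + M k *v w"
      by (simp add: x_def matrix_vector_mult_diff_distrib)
    moreover have "y k \<bullet> (M k *v w) = g k w"
      by (simp add: yx matrix_inv_vector_mult M(2) zw[OF w])
    ultimately have "(norm (x k - M k *v (v - w)))\<^sup>2 = (norm (y k))\<^sup>2 + G k"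
      using norm_add_scaleR_sq[of "y k" 1 "M k *v w"] by (simp add: g_def inner_commute field_simps)
    also have "\<dots> > 1"
      using big[of k] by (simp add: G_def add_strict_increasing2)
    finally show ?thesis
      by (metis norm_ge_zero one_power2 power_less_imp_less_base)
  qed
  have "\<forall>k. \<exists>l\<in>\<Lambda>. x k - M k *v l \<in> capped_ball (\<epsilon> k) u"
    using cov by blast
  then obtain l where l: "\<And>k. l k \<in> \<Lambda>" "\<And>k. x k - M k *v l k \<in> capped_ball (\<epsilon> k) u"
    by metis
  have nl: "norm (x k - M k *v l k) \<le> 1 + \<epsilon> k" for k
    using capped_ball_subset_cball[OF u(1) \<epsilon>(1)] l(2)[of k] by fastforce
  have "(\<lambda>k. norm (x k) + (1 + \<epsilon> k)) \<longlonglongrightarrow> norm v + (1 + 0)"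
    by (intro tendsto_intros xv \<epsilon>)
  then have "Bseq (\<lambda>k. norm (x k) + (1 + \<epsilon> k))"
    by (rule convergent_imp_Bseq[OF convergentI])
  then obtain c where c: "\<And>k. norm (norm (x k) + (1 + \<epsilon> k)) \<le> c"
    unfolding Bseq_def by blast
  have "norm (M k *v l k) \<le> c" for k
    using norm_triangle_ineq4[of "x k" "x k - M k *v l k"] nl[of k] c[of k] by simp
  then obtain l\<^sub>0 and r :: "nat \<Rightarrow> nat" where l0: "l\<^sub>0 \<in> \<Lambda>" "strict_mono r" "\<And>k. l (r k) = l\<^sub>0"
    using constant_lattice_subsequence[where l = l, OF \<Lambda>(1) M(1) l(1)] by metis
  define q where "q k = x (r k) - M (r k) *v l\<^sub>0" for k
  have qv: "q \<longlonglongrightarrow> v - l\<^sub>0"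
    unfolding q_def using LIMSEQ_subseq_LIMSEQ[OF xv l0(2)] LIMSEQ_subseq_LIMSEQ[OF Mw[of l\<^sub>0] l0(2)]
    by (intro tendsto_diff) (simp_all add: o_def)
  have \<epsilon>r: "(\<lambda>k. \<epsilon> (r k)) \<longlonglongrightarrow> 0"
    using LIMSEQ_subseq_LIMSEQ[OF \<epsilon>(2) l0(2)] by (simp add: o_def)
  have "norm (v - l\<^sub>0) \<le> 1 + 0"
  proof (rule LIMSEQ_le)
    show "(\<lambda>k. norm (q k)) \<longlonglongrightarrow> norm (v - l\<^sub>0)"
      by (intro tendsto_norm qv)
    show "(\<lambda>k. 1 + \<epsilon> (r k)) \<longlonglongrightarrow> 1 + 0"
      by (intro tendsto_intros \<epsilon>r)
    show "\<exists>N. \<forall>k\<ge>N. norm (q k) \<le> 1 + \<epsilon> (r k)"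
      using nl l0(3) by (metis q_def)
  qed
  moreover have "norm v \<le> norm (v - l\<^sub>0)"
    using v(1) l0(1) by (simp add: voronoi_polytope_def)
  ultimately have n1: "norm (v - l\<^sub>0) = 1"
    using v(2) by simp
  then have wC: "v - l\<^sub>0 \<in> ?C"
    using l0(1) v(2) by (intro vertex_class_memI) simp_all
  \<comment> \<open>The limit lies in the class, so the points before the limit have norm above 1
    and can only be covered by a cap.\<close>
  have "v - l\<^sub>0 = u \<or> v - l\<^sub>0 = - u"
  proof (rule capped_ball_limit[OF u(1) _ \<epsilon>r _ _ qv n1])
    show "\<epsilon> (r k) \<ge> 0" for k
      by (rule \<epsilon>(1))
    show "q k \<in> capped_ball (\<epsilon> (r k)) u" for k
      using l(2)[of "r k"] l0(3) by (simp add: q_def)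
    show "norm (q k) > 1" for k
      using far[OF wC, of "r k"] by (simp add: q_def)
  qed
  then show False
    using u(2,3) wC by auto
qed

subsection \<open>Extensibility\<close>

lemma inscribed_vertex_class:
  assumes "critical_covering_lattice (cball 0 1) \<Lambda>" "simple_lattice \<Lambda>" "v \<in> voronoi_polytope \<Lambda>" "norm v = 1"
  shows "inscribed_simplex (convex hull vertex_class \<Lambda> v)"
  using assms by (intro inscribed_maximal_primitive_simplex[OF assms(1,2)]) (auto simp: maximal_primitive_simplices_eq)

text \<open>The center of \<open>K\<close> need not be the center of the ball. After translating it
  to the origin, the ball is still contained and some point sticks out, so a pair of opposite unit
  vectors is interior.\<close>

lemma body_symmetric_translate:
  fixes K :: "(real^'n) set"
  assumes "body K" "cball 0 1 \<subset> K"
  obtains c u where "norm u = 1" "cball 0 1 \<subseteq> (\<lambda>y. y - c) ` K" "u \<in> interior ((\<lambda>y. y - c) ` K)" "- u \<in> interior ((\<lambda>y. y - c) ` K)"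
proof -
  obtain c where K: "convex K" "(\<lambda>y. 2 *\<^sub>R c - y) ` K = K"
    using assms(1) unfolding body_def by blast
  define K' where "K' = (\<lambda>y. y - c) ` K"
  have K': "y \<in> K' \<longleftrightarrow> y + c \<in> K" for y
    unfolding K'_def by (force intro: image_eqI[of _ _ "y + c"])
  have conv: "convex K'"
    unfolding K'_def using K(1) by (rule convex_translation_subtract)
  have sym: "- y \<in> K'" if "y \<in> K'" for y
  proof -
    have "2 *\<^sub>R c - (y + c) \<in> K"
      using that K(2) unfolding K' by blast
    then show ?thesis
      by (simp add: K' scaleR_2)
  qed
  have ball: "cball 0 1 \<subseteq> K'"
  proof
    fix b :: "real^'n" assume b: "b \<in> cball 0 1"
    then have "- b \<in> cball 0 1"
      by simp
    then have "b \<in> K" "- b \<in> K"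
      using assms(2) b by blast+
    then have "b - c \<in> K'" "- b - c \<in> K'"
      by (simp_all add: K')
    then have "b - c \<in> K'" "b + c \<in> K'"
      using sym[of "- b - c"] by (simp_all add: add.commute)
    \<comment> \<open>Central symmetry of \<open>K'\<close> supplies \<open>b + c\<close> besides
      \<open>b - c\<close>, and \<open>b\<close> is their midpoint.\<close>
    then have "(1/2) *\<^sub>R (b - c) + (1/2) *\<^sub>R (b + c) \<in> K'"
      using conv by (intro convexD) auto
    also have "(1/2) *\<^sub>R (b - c) + (1/2) *\<^sub>R (b + c) = b"
      by (simp add: scaleR_diff_right scaleR_add_right flip: scaleR_2 scaleR_left_distrib)
    finally show "b \<in> K'" .
  qed
  have "\<exists>p\<in>K'. norm p > 1"
  proof (cases "c = 0")
    case True
    then show ?thesis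
      using assms(2) K' by force
  next
    case False
    \<comment> \<open>The point of the unit sphere opposite to \<open>c\<close>; translation by
      \<open>- c\<close> moves it out to norm \<open>1 + norm c\<close>.\<close>
    define q where "q = - sgn c"
    have "q \<in> cball 0 1"
      using False by (simp add: q_def norm_sgn)
    then have "q \<in> K"
      using assms(2) by blast
    then have "q - c \<in> K'"
      by (simp add: K')
    moreover have "q - c = - ((1 + 1 / norm c) *\<^sub>R c)"
      by (simp add: q_def sgn_div_norm algebra_simps divide_inverse)
    then have "norm (q - c) = (1 + 1 / norm c) * norm c"
      by (simp add: abs_of_nonneg)
    then have "norm (q - c) > 1"
      using False by (simp add: algebra_simps)
    ultimately show ?thesis
      by blast
  qed
  then obtain p where p: "p \<in> K'" "norm p > 1"
    by blast
  \<comment> \<open>\<open>sgn x\<close> lies on the segment from \<open>x\<close> to the interior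
    point 0, strictly before \<open>x\<close>.\<close>
  have int: "sgn x \<in> interior K'" if x: "x \<in> K'" "norm x > 1" for x
  proof -
    have "0 \<in> interior K'"
      using subsetD[OF interior_mono[OF ball], of 0] by (simp add: interior_cball)
    moreover have "norm x > 0"
      using x(2) by linarith
    then have "1 / norm x < 1" "1 / norm x \<ge> 0"
      using x(2) by (simp_all only: pos_divide_less_eq mult_1) simp
    ultimately have "x - (1 - 1 / norm x) *\<^sub>R (x - 0) \<in> interior K'"
      using x by (intro mem_interior_convex_shrink[OF conv]) auto
    moreover have "x - (1 - 1 / norm x) *\<^sub>R (x - 0) = sgn x"
      by (simp add: sgn_div_norm algebra_simps divide_inverse)
    ultimately show ?thesis
      by simp
  qed
  have "p \<noteq> 0"
    using p(2) by auto
  show thesis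
  proof (rule that[of "sgn p" c, folded K'_def])
    show "norm (sgn p) = 1"
      using \<open>p \<noteq> 0\<close> by (simp add: norm_sgn)
    show "cball 0 1 \<subseteq> K'"
      by (rule ball)
    show "sgn p \<in> interior K'"
      using int p by blast
    show "- sgn p \<in> interior K'"
      using int[of "- p"] p sym by (simp add: sgn_minus)
  qed
qed

lemma body_cball: "body (cball 0 1 :: (real^'n) set)"
proof -
  have *: "uminus ` cball 0 1 \<subseteq> (cball 0 1 :: (real^'n) set)"
    by auto
  have "cball 0 1 \<subseteq> uminus ` (cball 0 1 :: (real^'n) set)"
    using image_mono[OF *, of uminus] unfolding uminus_image_involutive .
  then have "uminus ` cball 0 1 = (cball 0 1 :: (real^'n) set)"
    by (intro subset_antisym *)
  then have "(\<lambda>y. 2 *\<^sub>R 0 - y) ` cball 0 1 = (cball 0 1 :: (real^'n) set)"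
    by simp
  then show ?thesis
    unfolding body_def by (intro conjI exI[of _ 0]) (simp_all add: interior_cball)
qed

text \<open>One vertex \<open>v\<^sub>0\<close> of \<open>S\<close> suffices: turned to it, the
  bulge of the larger body covers near every vertex equivalent to it, and its opposite does so for
  \<open>- v\<^sub>0\<close>. The simplices elsewhere contract under a deformation that gains
  volume.\<close>

proposition not_redundantly_semieutactic_imp_inextensible:
  fixes \<Lambda> :: "(real^'n) set"
  assumes crit: "critical_covering_lattice (cball 0 1) \<Lambda>" and simple: "simple_lattice \<Lambda>"
    and S: "S \<in> maximal_primitive_simplices \<Lambda>" "\<not> semieutactic (maximal_primitive_simplices \<Lambda> - {S, uminus ` S})"
  shows "inextensible (cball 0 1 :: (real^'n) set)"
proof -
  let ?X = "maximal_primitive_simplices \<Lambda>"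
  have \<Lambda>: "is_lattice \<Lambda>" "voronoi_polytope \<Lambda> \<subseteq> cball 0 1"
    using crit by (auto simp: critical_covering_lattice_def covering_cball_iff)
  note X = maximal_primitive_simplices_eq[OF crit]
  obtain v\<^sub>0 where v0: "v\<^sub>0 \<in> voronoi_polytope \<Lambda>" "norm v\<^sub>0 = 1" "S = convex hull vertex_class \<Lambda> v\<^sub>0"
    using S(1) unfolding X by blast
  obtain N :: "real^'n^'n" where N: "N \<bullet> mat 1 > 0" "\<And>S'. S' \<in> ?X - {S, uminus ` S} \<Longrightarrow> N \<bullet> simplex_matrix S' < 0"
    using not_semieutactic_separation[OF _ _ symmetric_family_remove[OF symmetric_maximal_primitive_simplices[OF crit]] S(2)]
      finite_maximal_primitive_simplices[OF crit] inscribed_maximal_primitive_simplex[OF crit simple]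
    by (metis DiffD1 finite_Diff)
  have N': "N \<bullet> simplex_matrix (convex hull vertex_class \<Lambda> v) < 0"
    if v: "v \<in> voronoi_polytope \<Lambda>" "norm v = 1" "v\<^sub>0 \<notin> vertex_class \<Lambda> v" "- v\<^sub>0 \<notin> vertex_class \<Lambda> v" for v
  proof (rule N(2))
    have ne: "convex hull vertex_class \<Lambda> v \<noteq> convex hull vertex_class \<Lambda> w" if "w \<notin> vertex_class \<Lambda> v" for w
      using that vertices_convex_hull_vertex_class vertex_class_self[OF \<Lambda>(1)] by metis
    have "convex hull vertex_class \<Lambda> v \<noteq> S"
      unfolding v0(3) using v(3) by (rule ne)
    moreover have "convex hull vertex_class \<Lambda> v \<noteq> uminus ` S"
      unfolding v0(3) uminus_convex_hull vertex_class_uminus[OF \<Lambda>(1), symmetric] using v(4) by (rule ne)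
    moreover have "convex hull vertex_class \<Lambda> v \<in> ?X"
      unfolding X using v(1,2) by (intro imageI CollectI conjI)
    ultimately show "convex hull vertex_class \<Lambda> v \<in> ?X - {S, uminus ` S}"
      by simp
  qed
  obtain M t where M: "M \<longlonglongrightarrow> mat 1" "\<And>k. t k > (0::real)" "t \<longlonglongrightarrow> 0"
    "\<And>k x. M k *v x = x + t k *\<^sub>R (N *v (M k *v x))" "\<And>k. invertible (M k)" "\<And>k. \<bar>det (M k)\<bar> > 1"
    using volume_increasing_sequence[OF N(1)] by metis
  show ?thesis
    unfolding inextensible_def
  proof (intro conjI allI impI)
    show "body (cball 0 1 :: (real^'n) set)"
      by (rule body_cball)
    fix K :: "(real^'n) set" assume K: "body K \<and> cball 0 1 \<subset> K"
    obtain c u where cu: "norm u = 1" "cball 0 1 \<subseteq> (\<lambda>y. y - c) ` K" "u \<in> interior ((\<lambda>y. y - c) ` K)" "- u \<in> interior ((\<lambda>y. y - c) ` K)"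
      using K body_symmetric_translate by metis
    define K' where "K' = (\<lambda>y. y - c) ` K"
    obtain f where f: "orthogonal_transformation f" "f v\<^sub>0 = u"
      using orthogonal_transformation_exists_1[OF v0(2) cu(1)] by metis
    define A where "A = matrix f"
    have lin: "linear f"
      using f(1) by (simp add: orthogonal_transformation)
    have fA: "f x = A *v x" for x
      using lin by (simp add: A_def)
    have "orthogonal_matrix A"
      using f(1) by (simp add: A_def orthogonal_transformation_matrix)
    then have detA: "\<bar>det A\<bar> = 1"
      using det_orthogonal_matrix by fastforce
    then have invA: "invertible A"
      by (auto simp: invertible_det_nz)
    have surj: "\<exists>y. f y = x" for x
      using matrix_inv_vector_mult(2)[OF invA] fA by metis
    have int: "x \<in> interior (f -` K')" if "f x \<in> interior K'" for x
    proof (rule interiorI[of "f -` interior K'"])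
      show "open (f -` interior K')"
        using lin by (intro continuous_open_vimage linear_continuous_at) (simp_all add: linear_conv_bounded_linear)
    qed (use that interior_subset in auto)
    have "\<forall>\<^sub>F k in sequentially. covering_lattice (f -` K') ((*v) (M k) ` \<Lambda>)"
    proof (rule eventually_covering[OF \<Lambda> inscribed_vertex_class[OF crit simple] _ _ _ N' M(1-5)])
      show "cball 0 1 \<subseteq> f -` K'"
      proof
        fix x :: "real^'n" assume "x \<in> cball 0 1"
        then have "f x \<in> cball 0 1"
          by (simp add: orthogonal_transformation_norm[OF f(1)])
        then show "x \<in> f -` K'"
          using cu(2) unfolding K'_def by blast
      qed
      show "v\<^sub>0 \<in> interior (f -` K')" "- v\<^sub>0 \<in> interior (f -` K')"
        using cu(3,4) f(2) unfolding K'_def[symmetric] by (simp_all add: int linear_neg[OF lin])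
    qed
    then obtain k where k: "covering_lattice (f -` K') ((*v) (M k) ` \<Lambda>)"
      unfolding eventually_sequentially by blast
    \<comment> \<open>Applying the orthogonal map to the deformed lattice returns to
      \<open>K\<close>; the translation by \<open>c\<close> does not matter for covering.\<close>
    define L where "L = (*v) A ` ((*v) (M k) ` \<Lambda>)"
    have lat: "is_lattice ((*v) (M k) ` \<Lambda>)"
      using is_lattice_matrix_image[OF \<Lambda>(1) M(5)] .
    have "covering_lattice K L"
      unfolding covering_lattice_iff
    proof (intro conjI allI)
      show "is_lattice L"
        unfolding L_def by (rule is_lattice_matrix_image[OF lat invA])
      fix x
      obtain y where y: "f y = x - c"
        using surj by blast
      obtain l where l: "l \<in> (*v) (M k) ` \<Lambda>" "f (y - l) \<in> K'"
        using k unfolding covering_lattice_iff by blast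
      have "x - f l - c \<in> K'"
        using l(2) y by (simp add: linear_diff[OF lin] algebra_simps)
      then have "x - f l \<in> K"
        by (auto simp: K'_def)
      then show "\<exists>l\<in>L. x - l \<in> K"
        using l(1) fA unfolding L_def by blast
    qed
    then have "lattice_det L \<le> critical_det K"
      using K by (intro lattice_det_le_critical_det) (auto simp: body_def compact_imp_bounded)
    moreover have "lattice_det L = \<bar>det (M k)\<bar> * lattice_det \<Lambda>"
      unfolding L_def lattice_det_matrix_image[OF lat invA] lattice_det_matrix_image[OF \<Lambda>(1) M(5)] by (simp add: detA)
    moreover have "1 * lattice_det \<Lambda> < \<bar>det (M k)\<bar> * lattice_det \<Lambda>"
      using M(6) lattice_det_pos[OF \<Lambda>(1)] by (rule mult_strict_right_mono)
    ultimately show "critical_det (cball 0 1 :: (real^'n) set) < critical_det K"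
      using crit by (simp add: critical_covering_lattice_def)
  qed
qed

lemma capped_ball_orthogonal_image:
  assumes "orthogonal_transformation f" "x \<in> capped_ball \<epsilon> u"
  shows "f x \<in> capped_ball \<epsilon> (f u)"
proof -
  have lin: "linear f"
    using assms(1) by (simp add: orthogonal_transformation)
  let ?S = "\<lambda>u. cball 0 1 \<union> {(1 + \<epsilon>) *\<^sub>R u, - ((1 + \<epsilon>) *\<^sub>R u)}"
  have "f ` ?S u \<subseteq> ?S (f u)"
    using orthogonal_transformation_norm[OF assms(1)] by (auto simp: linear_neg[OF lin] linear_scale[OF lin])
  then have "f ` (convex hull ?S u) \<subseteq> convex hull ?S (f u)"
    unfolding convex_hull_linear_image[OF lin] by (rule hull_mono)
  then show ?thesis
    using assms(2) unfolding capped_ball_def by blast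
qed

text \<open>For a fixed point, one lattice vector serves along a subsequence by finiteness, and its
  inequality passes to the limit.\<close>

lemma covering_limit:
  fixes M :: "nat \<Rightarrow> real^'n^'n"
  assumes "is_lattice \<Lambda>" "M \<longlonglongrightarrow> mat 1" "\<epsilon> \<longlonglongrightarrow> (0::real)" "\<And>k. \<epsilon> k \<le> 1"
    and cov: "\<And>k x. \<exists>l\<in>\<Lambda>. norm (x - M k *v l) \<le> 1 + \<epsilon> k"
  shows "covering_lattice (cball 0 1) \<Lambda>"
  unfolding covering_lattice_iff
proof (intro conjI allI assms(1))
  fix x
  have "\<forall>k. \<exists>l\<in>\<Lambda>. norm (x - M k *v l) \<le> 1 + \<epsilon> k"
    using cov by blast
  then obtain l where l: "\<And>k. l k \<in> \<Lambda>" "\<And>k. norm (x - M k *v l k) \<le> 1 + \<epsilon> k"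
    by metis
  have "norm (M k *v l k) \<le> norm x + 2" for k
    using norm_triangle_ineq4[of x "x - M k *v l k"] l(2)[of k] assms(4)[of k] by simp
  then obtain l\<^sub>0 and r :: "nat \<Rightarrow> nat" where l0: "l\<^sub>0 \<in> \<Lambda>" "strict_mono r" "\<And>k. l (r k) = l\<^sub>0"
    using constant_lattice_subsequence[where l = l, OF assms(1,2) l(1)] by metis
  have "norm (x - mat 1 *v l\<^sub>0) \<le> 1 + 0"
  proof (rule LIMSEQ_le)
    have "(\<lambda>k. M (r k)) \<longlonglongrightarrow> mat 1" "(\<lambda>k. \<epsilon> (r k)) \<longlonglongrightarrow> 0"
      using LIMSEQ_subseq_LIMSEQ[OF assms(2) l0(2)] LIMSEQ_subseq_LIMSEQ[OF assms(3) l0(2)] by (simp_all add: o_def)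
    note lim = this
    show "(\<lambda>k. norm (x - M (r k) *v l\<^sub>0)) \<longlonglongrightarrow> norm (x - mat 1 *v l\<^sub>0)"
      by (intro tendsto_norm tendsto_diff tendsto_const tendsto_matrix_vector_mult lim)
    show "(\<lambda>k. 1 + \<epsilon> (r k)) \<longlonglongrightarrow> 1 + 0"
      by (intro tendsto_add tendsto_const lim)
    show "\<exists>N. \<forall>k\<ge>N. norm (x - M (r k) *v l\<^sub>0) \<le> 1 + \<epsilon> (r k)"
      using l(2) l0(3) by metis
  qed
  then show "\<exists>l\<in>\<Lambda>. x - l \<in> cball 0 1"
    using l0(1) by auto
qed

text \<open>Compactness and the uniqueness of the critical lattice reduce large covering lattices of slightly
  capped balls to small perturbations of \<open>\<Lambda>\<close>.\<close>

lemma inextensible_imp_improved_coverings: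
  fixes \<Lambda> :: "(real^'n) set"
  assumes crit: "critical_covering_lattice (cball 0 1) \<Lambda>"
    and uniq: "\<forall>\<Lambda>'. critical_covering_lattice (cball 0 1) \<Lambda>' \<longrightarrow> (\<exists>R. rotation_matrix R \<and> \<Lambda>' = (\<lambda>x. R *v x) ` \<Lambda>)"
    and inext: "inextensible (cball 0 1 :: (real^'n) set)"
  obtains M :: "nat \<Rightarrow> real^'n^'n" and \<epsilon> :: "nat \<Rightarrow> real" and u where "norm u = 1" "\<And>k. \<epsilon> k \<ge> 0" "\<epsilon> \<longlonglongrightarrow> 0"
    "M \<longlonglongrightarrow> mat 1" "\<And>k. invertible (M k)" "\<And>k. \<bar>det (M k)\<bar> > 1"
    "\<And>k x. \<exists>l\<in>\<Lambda>. x - M k *v l \<in> capped_ball (\<epsilon> k) u"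
proof -
  have \<Lambda>: "is_lattice \<Lambda>" "voronoi_polytope \<Lambda> \<subseteq> cball 0 1"
    using crit by (auto simp: critical_covering_lattice_def covering_cball_iff)
  define d where "d = lattice_det \<Lambda>"
  have d: "d > 0" "d = critical_det (cball 0 1 :: (real^'n) set)"
    using lattice_det_pos[OF \<Lambda>(1)] crit by (auto simp: d_def critical_covering_lattice_def)
  obtain u\<^sub>0 :: "real^'n" where u0: "norm u\<^sub>0 = 1"
    using critical_lattice_unit_vertex[OF crit] by blast
  define \<epsilon> where "\<epsilon> k = inverse (real (Suc k))" for k
  have \<epsilon>: "\<And>k. \<epsilon> k > 0" "\<epsilon> \<longlonglongrightarrow> 0" "\<And>k. \<epsilon> k \<le> 1"
    unfolding \<epsilon>_def using LIMSEQ_inverse_real_of_nat by (auto simp: inverse_le_1_iff)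
  have "\<exists>L. covering_lattice (capped_ball (\<epsilon> k) u\<^sub>0) L \<and> lattice_det L > d" for k
  proof -
    let ?K = "capped_ball (\<epsilon> k) u\<^sub>0"
    have "(1 + \<epsilon> k) *\<^sub>R u\<^sub>0 \<in> ?K"
      unfolding capped_ball_def by (intro hull_inc) auto
    moreover have "norm ((1 + \<epsilon> k) *\<^sub>R u\<^sub>0) > 1"
      using \<epsilon>(1)[of k] u0 by simp
    then have "(1 + \<epsilon> k) *\<^sub>R u\<^sub>0 \<notin> cball 0 1"
      by simp
    ultimately have "cball 0 1 \<subset> ?K"
      using cball_subset_capped_ball by blast
    then have lt: "d < critical_det ?K"
      using inext body_capped_ball unfolding inextensible_def d(2) by blast
    have "covering_lattice ?K \<Lambda>"
      using crit cball_subset_capped_ball covering_lattice_mono unfolding critical_covering_lattice_def by blast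
    then have "{lattice_det L | L. covering_lattice ?K L} \<noteq> {}"
      by blast
    then show ?thesis
      using less_cSupD[OF _ lt[unfolded critical_det_def]] by blast
  qed
  then obtain L where L: "\<And>k. covering_lattice (capped_ball (\<epsilon> k) u\<^sub>0) (L k)" "\<And>k. lattice_det (L k) > d"
    by metis
  have Llat: "is_lattice (L k)" for k
    using L(1) by (simp add: covering_lattice_def)
  have Lcov: "\<exists>l\<in>L k. norm (x - l) \<le> 1 + \<epsilon> k" for k x
    using L(1)[of k] capped_ball_subset_cball[OF u0, of "\<epsilon> k"] \<epsilon>(1)[of k] unfolding covering_lattice_iff
    by (meson less_imp_le mem_cball_0 subsetD)
  have Lcov2: "\<exists>l\<in>L k. norm (x - l) \<le> 2" for k x
    using Lcov[of k x] \<epsilon>(3)[of k] by force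
  obtain r T T\<^sub>0 where r: "strict_mono r" and T: "\<And>k. invertible (T k)" "\<And>k. L (r k) = lattice_of (T k)"
    "T \<longlonglongrightarrow> T\<^sub>0" "\<bar>det T\<^sub>0\<bar> \<ge> d"
    using lattice_sequence_compact[of 2 d L, OF _ d(1) Llat Lcov2 less_imp_le[OF L(2)]] by auto
  have T0: "invertible T\<^sub>0"
    using T(4) d(1) by (auto simp: invertible_det_nz)
  define \<Lambda>' where "\<Lambda>' = lattice_of T\<^sub>0"
  have \<Lambda>': "is_lattice \<Lambda>'" "lattice_det \<Lambda>' = \<bar>det T\<^sub>0\<bar>"
    using T0 lattice_det_lattice_of by (auto simp: \<Lambda>'_def is_lattice_def)
  \<comment> \<open>Convergence of bases becomes a linear map that carries the limit lattice to
    \<open>L (r k)\<close> and tends to the identity.\<close>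
  define M0 where "M0 k = T k ** matrix_inv T\<^sub>0" for k
  have "(\<lambda>k. T k ** matrix_inv T\<^sub>0) \<longlonglongrightarrow> T\<^sub>0 ** matrix_inv T\<^sub>0"
    by (rule tendsto_matrix_matrix_mult_right[OF T(3)])
  then have M0: "M0 \<longlonglongrightarrow> mat 1"
    by (simp add: M0_def[abs_def] matrix_inv_mult[OF T0])
  have M0T: "M0 k ** T\<^sub>0 = T k" for k
    by (simp add: M0_def matrix_inv_mult[OF T0] flip: matrix_mul_assoc)
  have LM: "L (r k) = (*v) (M0 k) ` \<Lambda>'" for k
    unfolding \<Lambda>'_def T(2) M0T[symmetric] by (rule lattice_of_matrix_mult)
  have \<epsilon>r: "(\<lambda>k. \<epsilon> (r k)) \<longlonglongrightarrow> 0"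
    using LIMSEQ_subseq_LIMSEQ[OF \<epsilon>(2) r] by (simp add: o_def)
  have "covering_lattice (cball 0 1) \<Lambda>'"
  proof (rule covering_limit[OF \<Lambda>'(1) M0 \<epsilon>r])
    show "\<epsilon> (r k) \<le> 1" for k
      by (rule \<epsilon>(3))
    show "\<exists>l\<in>\<Lambda>'. norm (x - M0 k *v l) \<le> 1 + \<epsilon> (r k)" for k x
      using Lcov[of "r k" x] unfolding LM by blast
  qed
  then have crit': "critical_covering_lattice (cball 0 1) \<Lambda>'"
    using lattice_det_le_critical_det[of "cball 0 1" \<Lambda>'] T(4) \<Lambda>'(2) d(2) by (simp add: critical_covering_lattice_def)
  then have detT0: "\<bar>det T\<^sub>0\<bar> = d"
    using \<Lambda>'(2) d(2) by (simp add: critical_covering_lattice_def)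
  obtain R where R: "rotation_matrix R" "\<Lambda>' = (\<lambda>x. R *v x) ` \<Lambda>"
    using uniq crit' by blast
  have Ro: "transpose R ** R = mat 1" "det R = 1"
    using R(1) by (auto simp: rotation_matrix_def orthogonal_matrix)
  have orth: "orthogonal_transformation ((*v) (transpose R))"
    using R(1) by (simp add: orthogonal_transformation_matrix rotation_matrix_def orthogonal_matrix_transpose)
  \<comment> \<open>Conjugation by \<open>R\<close> makes the perturbation act on
    \<open>\<Lambda>\<close> itself and turns the axis of the caps into
    \<open>transpose R *v u\<^sub>0\<close>.\<close>
  define M where "M k = transpose R ** (M0 k ** R)" for k
  define u where "u = transpose R *v u\<^sub>0"
  have "M \<longlonglongrightarrow> transpose R ** (mat 1 ** R)"
    unfolding M_def by (intro tendsto_matrix_matrix_mult_left tendsto_matrix_matrix_mult_right M0)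
  then have M: "M \<longlonglongrightarrow> mat 1"
    by (simp add: Ro)
  have detM: "\<bar>det (M k)\<bar> > 1" for k
  proof -
    have "d < \<bar>det (T k)\<bar>"
      using L(2)[of "r k"] T(1,2) by (simp add: lattice_det_lattice_of)
    also have "\<bar>det (T k)\<bar> = \<bar>det (M0 k)\<bar> * d"
      unfolding M0T[symmetric, of k] by (simp add: det_mul abs_mult detT0)
    also have "\<bar>det (M0 k)\<bar> = \<bar>det (M k)\<bar>"
      by (simp add: M_def det_mul Ro det_transpose)
    finally show ?thesis
      using d(1) by simp
  qed
  show thesis
  proof (rule that[of u "\<lambda>k. \<epsilon> (r k)" M])
    show "norm u = 1"
      using orthogonal_transformation_norm[OF orth] u0 by (simp add: u_def)
    show "\<epsilon> (r k) \<ge> 0" for k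
      using \<epsilon>(1) by (simp add: less_imp_le)
    show "(\<lambda>k. \<epsilon> (r k)) \<longlonglongrightarrow> 0" "M \<longlonglongrightarrow> mat 1"
      by fact+
    show "\<bar>det (M k)\<bar> > 1" for k
      by (rule detM)
    show "invertible (M k)" for k
      using detM[of k] by (auto simp: invertible_det_nz)
    show "\<exists>l\<in>\<Lambda>. x - M k *v l \<in> capped_ball (\<epsilon> (r k)) u" for k x
    proof -
      obtain l' where l': "l' \<in> L (r k)" "R *v x - l' \<in> capped_ball (\<epsilon> (r k)) u\<^sub>0"
        using L(1)[of "r k"] unfolding covering_lattice_iff by blast
      obtain l where l: "l \<in> \<Lambda>" "l' = M0 k *v (R *v l)"
        using l'(1) unfolding LM R(2) by blast
      have "transpose R *v (R *v x - l') \<in> capped_ball (\<epsilon> (r k)) u"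
        unfolding u_def using orth l'(2) by (rule capped_ball_orthogonal_image)
      moreover have "transpose R *v (R *v x - l') = x - M k *v l"
        by (simp add: l(2) M_def matrix_vector_mult_diff_distrib matrix_vector_mul_assoc Ro matrix_mul_assoc)
      ultimately show ?thesis
        using l(1) by auto
    qed
  qed
qed

text \<open>There are finitely many simplices, so a single late \<open>k\<close> satisfies the means
  inequality for all of them except one pair; the eutaxy of the rest contradicts the determinant
  being above 1.\<close>

proposition redundantly_semieutactic_imp_not_inextensible:
  fixes \<Lambda> :: "(real^'n) set"
  assumes crit: "critical_covering_lattice (cball 0 1) \<Lambda>"
    and uniq: "\<forall>\<Lambda>'. critical_covering_lattice (cball 0 1) \<Lambda>' \<longrightarrow> (\<exists>R. rotation_matrix R \<and> \<Lambda>' = (\<lambda>x. R *v x) ` \<Lambda>)"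
    and simple: "simple_lattice \<Lambda>"
    and red: "redundantly_semieutactic (maximal_primitive_simplices \<Lambda>)"
  shows "\<not> inextensible (cball 0 1 :: (real^'n) set)"
proof
  assume inext: "inextensible (cball 0 1 :: (real^'n) set)"
  let ?X = "maximal_primitive_simplices \<Lambda>"
  have \<Lambda>: "is_lattice \<Lambda>" "voronoi_polytope \<Lambda> \<subseteq> cball 0 1"
    using crit by (auto simp: critical_covering_lattice_def covering_cball_iff)
  note X = maximal_primitive_simplices_eq[OF crit]
  obtain M :: "nat \<Rightarrow> real^'n^'n" and \<epsilon> u where u: "norm u = 1" and \<epsilon>: "\<And>k. \<epsilon> k \<ge> 0" "\<epsilon> \<longlonglongrightarrow> (0::real)"
    and M: "M \<longlonglongrightarrow> mat 1" "\<And>k. invertible (M k)" "\<And>k. \<bar>det (M k)\<bar> > 1"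
    and cov: "\<And>k x. \<exists>l\<in>\<Lambda>. x - M k *v l \<in> capped_ball (\<epsilon> k) u"
    using inextensible_imp_improved_coverings[OF crit uniq inext] by metis
  obtain v\<^sub>1 where "v\<^sub>1 \<in> voronoi_polytope \<Lambda>" "norm v\<^sub>1 = 1"
    using critical_lattice_unit_vertex[OF crit] .
  then have "\<exists>S. S \<in> ?X"
    unfolding X by blast
  \<comment> \<open>The simplex with vertex \<open>u\<close> if there is one, and any simplex
    otherwise; the implication covers both cases.\<close>
  then obtain S where S: "S \<in> ?X" "\<And>S'. S' \<in> ?X \<Longrightarrow> u \<in> vertices S' \<Longrightarrow> u \<in> vertices S"
    by metis
  have S_unique: "S' = S" if S': "S' \<in> ?X" "u \<in> vertices S'" for S'
  proof -
    obtain v w where vw: "S' = convex hull vertex_class \<Lambda> v" "S = convex hull vertex_class \<Lambda> w"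
      using S' S(1) unfolding X by blast
    have "u \<in> vertex_class \<Lambda> v" "u \<in> vertex_class \<Lambda> w"
      using S'(2) S(2)[OF S'] unfolding vw vertices_convex_hull_vertex_class by blast+
    then show ?thesis
      unfolding vw using vertex_class_eq[OF \<Lambda>(1)] by metis
  qed
  let ?X' = "?X - {S, uminus ` S}"
  have semi: "semieutactic ?X'"
    using red S(1) unfolding redundantly_semieutactic_def by blast
  then have X': "finite ?X'" "\<And>S'. S' \<in> ?X' \<Longrightarrow> inscribed_simplex S'"
    unfolding semieutactic_def by blast+
  from semi obtain \<upsilon> where \<upsilon>: "\<forall>S'\<in>?X'. \<upsilon> S' \<ge> (0::real)"
    "id = (\<lambda>y. \<Sum>S'\<in>?X'. \<upsilon> S' *\<^sub>R Q_map S' (y :: real^'n))"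
    unfolding semieutactic_def by (elim conjE exE)
  have "\<forall>\<^sub>F k in sequentially. \<forall>S'\<in>?X'. (\<Sum>w\<in>vertices S'. barycentric S' 0 w * (norm (M k *v w))\<^sup>2) \<le> 1"
  proof (rule eventually_ball_finite[OF X'(1)], rule ballI)
    fix S' assume S': "S' \<in> ?X'"
    then obtain v where v: "v \<in> voronoi_polytope \<Lambda>" "norm v = 1" "S' = convex hull vertex_class \<Lambda> v"
      unfolding X by blast
    have "u \<notin> vertex_class \<Lambda> v"
      using S_unique[of S'] S' unfolding v(3) vertices_convex_hull_vertex_class by blast
    moreover have "- u \<notin> vertex_class \<Lambda> v"
    proof
      assume "- u \<in> vertex_class \<Lambda> v"
      then have "u \<in> vertices (uminus ` S')"
        unfolding vertices_uminus v(3) vertices_convex_hull_vertex_class by (rule image_eqI[rotated]) simp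
      moreover have "uminus ` S' \<in> ?X"
        using symmetric_maximal_primitive_simplices[OF crit] S' unfolding symmetric_family_def by blast
      ultimately have "uminus ` S' = S"
        by (intro S_unique)
      then have "S' = uminus ` S"
        using uminus_image_involutive[of S'] by simp
      then show False
        using S' by blast
    qed
    ultimately have u': "u \<notin> vertex_class \<Lambda> v" "- u \<notin> vertex_class \<Lambda> v"
      by blast+
    have vV: "v \<in> vertices (voronoi_polytope \<Lambda>)"
      using unit_norm_imp_vertex[OF \<Lambda>(2) v(1,2)] .
    show "\<forall>\<^sub>F k in sequentially. (\<Sum>w\<in>vertices S'. barycentric S' 0 w * (norm (M k *v w))\<^sup>2) \<le> 1"
    proof (rule ccontr)
      assume "\<not> ?thesis"
      then have "\<exists>\<^sub>F k in sequentially. (\<Sum>w\<in>vertices S'. barycentric S' 0 w * (norm (M k *v w))\<^sup>2) > 1"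
        by (simp add: not_eventually not_le)
      then obtain r :: "nat \<Rightarrow> nat" where r: "strict_mono r"
        "\<And>k. (\<Sum>w\<in>vertices S'. barycentric S' 0 w * (norm (M (r k) *v w))\<^sup>2) > 1"
        by (elim frequently_subsequence) (rule that)
      have lim: "(\<lambda>k. \<epsilon> (r k)) \<longlonglongrightarrow> 0" "(\<lambda>k. M (r k)) \<longlonglongrightarrow> mat 1"
        using LIMSEQ_subseq_LIMSEQ[OF \<epsilon>(2) r(1)] LIMSEQ_subseq_LIMSEQ[OF M(1) r(1)] by (simp_all add: o_def)
      show False
        by (rule covering_by_caps_imp_mean_le_1[OF \<Lambda> v(1,2) X'(2)[OF S', unfolded v(3)]
              simple_lattice_independent_contacts[OF \<Lambda> simple vV] u u' \<epsilon>(1) lim M(2) cov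
              r(2)[unfolded v(3) vertices_convex_hull_vertex_class]])
    qed
  qed
  then obtain k where "\<forall>S'\<in>?X'. (\<Sum>w\<in>vertices S'. barycentric S' 0 w * (norm (M k *v w))\<^sup>2) \<le> 1"
    unfolding eventually_sequentially by blast
  then have "\<bar>det (M k)\<bar> \<le> 1"
    using \<upsilon>(1) X'(2) by (intro eutactic_abs_det_le_1[OF \<upsilon>(2)]) blast+
  then show False
    using M(3)[of k] by simp
qed

theorem theorem2:
  fixes \<Lambda>\<^sub>0 :: "(real^'n) set"
  assumes "critical_covering_lattice (cball 0 1) \<Lambda>\<^sub>0"
    and "\<And>\<Lambda>. critical_covering_lattice (cball 0 1) \<Lambda> \<Longrightarrow>
           \<exists>R. rotation_matrix R \<and> \<Lambda> = (\<lambda>x. R *v x) ` \<Lambda>\<^sub>0"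
    and "simple_lattice \<Lambda>\<^sub>0"
  shows "extensible (cball 0 1 :: (real^'n) set) \<longleftrightarrow>
         redundantly_semieutactic (maximal_primitive_simplices \<Lambda>\<^sub>0)"
proof
  assume "extensible (cball 0 1 :: (real^'n) set)"
  then show "redundantly_semieutactic (maximal_primitive_simplices \<Lambda>\<^sub>0)"
    using not_redundantly_semieutactic_imp_inextensible[OF assms(1,3)]
    unfolding extensible_def redundantly_semieutactic_def by blast
next
  assume "redundantly_semieutactic (maximal_primitive_simplices \<Lambda>\<^sub>0)"
  then have "\<not> inextensible (cball 0 1 :: (real^'n) set)"
    using assms(2) by (intro redundantly_semieutactic_imp_not_inextensible[OF assms(1) _ assms(3)]) auto
  then show "extensible (cball 0 1 :: (real^'n) set)"
    by (simp add: extensible_def body_cball)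
qed

end
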